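(* The optimization problem of computing a minimum-cost $2$-diverse database is $\mathsf{NP}$-hard, even restricted to instances in which all attributes are binary and there are exactly three sensitive attributes.
   Context: An instance is a database (matrix) with rows (records) and columns (attributes), where each attribute is labeled either quasi-identifier or sensitive, giving a partition of the attributes into sets $Q$ and $S$. A database $D$ is $\ell$-diverse if for every row $u_0$ of $D$ there are at least $\ell-1$ distinct other rows $u_1,\dots,u_{\ell-1}$ of $D$ such that (1) for all $q\in Q$ and $0\le i<j<\ell$, $u_i[q]=u_j[q]$, and (2) for all $s\in S$ and $0\le i<j<\ell$, $u_i[s]\ne u_j[s]$. One may replace entries of quasi-identifier attributes by a symbol $\star$ (treated as an ordinary value for the equality in (1)); the cost of an $\ell$-diverse solution is the number of stars introduced among the attributes in $Q$, and the problem asks for an $\ell$-diverse database obtainable this way with minimum cost. *)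

theory Defs
  imports Main
begin

text \<open>Tape symbols are natural numbers: 0 is the blank, 1 and 2 stand for the bits
  \<^const>\<open>False\<close> and \<^const>\<open>True\<close>; a machine may use further symbols. Tapes are infinite
  in both directions.\<close>

datatype move = Left | Stay | Right

type_synonym tape = "(int \<Rightarrow> nat) \<times> int"

text \<open>A machine has the non-halting states 0, ..., \<open>states M - 1\<close>, the start state 0 and the
  halting state \<open>states M\<close>; its tape alphabet is 0, ..., \<open>symbols M - 1\<close>.\<close>

record tm =
  tapes :: nat
  symbols :: nat
  states :: nat
  delta :: "nat \<Rightarrow> nat list \<Rightarrow> nat \<times> (nat \<times> move) list"

definition valid_tm :: "tm \<Rightarrow> bool" where
  "valid_tm M \<longleftrightarrow> tapes M \<ge> 1 \<and> symbols M \<ge> 3 \<and>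
     (\<forall>q < states M. \<forall>rs. length rs = tapes M \<and> (\<forall>r \<in> set rs. r < symbols M) \<longrightarrow>
        fst (delta M q rs) \<le> states M \<and>
        length (snd (delta M q rs)) = tapes M \<and>
        (\<forall>(w, d) \<in> set (snd (delta M q rs)). w < symbols M))"

definition read_tape :: "tape \<Rightarrow> nat" where
  "read_tape tp = fst tp (snd tp)"

fun head_shift :: "move \<Rightarrow> int" where
  "head_shift Left = -1"
| "head_shift Stay = 0"
| "head_shift Right = 1"

fun act :: "nat \<times> move \<Rightarrow> tape \<Rightarrow> tape" where
  "act (w, d) (c, h) = (c(h := w), h + head_shift d)"

fun step :: "tm \<Rightarrow> nat \<times> tape list \<Rightarrow> nat \<times> tape list" where
  "step M (q, tps) =
     (if q < states M
      then (let (q', as) = delta M q (map read_tape tps) in (q', map2 act as tps))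
      else (q, tps))"

definition inscribe :: "bool list \<Rightarrow> int \<Rightarrow> nat" where
  "inscribe x i =
     (if 0 \<le> i \<and> i < int (length x) then (if x ! nat i then 2 else 1) else 0)"

text \<open>The input is on the first tape and the output on the last one; these coincide for a
  single-tape machine.\<close>

definition initial :: "tm \<Rightarrow> bool list \<Rightarrow> nat \<times> tape list" where
  "initial M x = (0, (inscribe x, 0) # replicate (tapes M - 1) (inscribe [], 0))"

definition halts_with :: "tm \<Rightarrow> nat \<times> tape list \<Rightarrow> bool list \<Rightarrow> bool" where
  "halts_with M cf y \<longleftrightarrow> fst cf = states M \<and> fst (last (snd cf)) = inscribe y"

definition polytime_function :: "(bool list \<Rightarrow> bool list) \<Rightarrow> bool" where
  "polytime_function f \<longleftrightarrow>
     (\<exists>M c d. valid_tm M \<and>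
        (\<forall>x. \<exists>t \<le> c * length x ^ d + c. halts_with M ((step M ^^ t) (initial M x)) (f x)))"

definition enc_bool :: "bool \<Rightarrow> bool list" where
  "enc_bool b = [b]"

definition enc_list :: "('a \<Rightarrow> bool list) \<Rightarrow> 'a list \<Rightarrow> bool list" where
  "enc_list e xs = concat (map (\<lambda>x. True # e x) xs) @ [False]"

text \<open>Unary; hardness for unary numbers implies hardness for binary ones.\<close>

definition enc_nat :: "nat \<Rightarrow> bool list" where
  "enc_nat k = replicate k True @ [False]"

type_synonym language = "bool list set"

definition class_P :: "language set" where
  "class_P = {L. polytime_function (\<lambda>x. [x \<in> L])}"

definition class_NP :: "language set" where
  "class_NP = {L. \<exists>R \<in> class_P. \<exists>c d. \<forall>x.
     x \<in> L \<longleftrightarrow>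
     (\<exists>u. length u \<le> c * length x ^ d + c \<and> enc_list enc_bool x @ u \<in> R)}"

definition polytime_reducible :: "language \<Rightarrow> language \<Rightarrow> bool" (infix "\<le>\<^sub>p" 50) where
  "A \<le>\<^sub>p B \<longleftrightarrow> (\<exists>f. polytime_function f \<and> (\<forall>x. x \<in> A \<longleftrightarrow> f x \<in> B))"

definition NP_hard :: "language \<Rightarrow> bool" where
  "NP_hard L \<longleftrightarrow> (\<forall>A \<in> class_NP. A \<le>\<^sub>p L)"

record ('i, 's) min_problem =
  instances :: "'i set"
  solutions :: "'i \<Rightarrow> 's set"
  cost :: "'i \<Rightarrow> 's \<Rightarrow> nat"

definition optimal :: "('i, 's) min_problem \<Rightarrow> 'i \<Rightarrow> 's \<Rightarrow> bool" where
  "optimal P I y \<longleftrightarrow>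
     y \<in> solutions P I \<and> (\<forall>z \<in> solutions P I. cost P I y \<le> cost P I z)"

definition restrict_instances ::
  "('i, 's) min_problem \<Rightarrow> 'i set \<Rightarrow> ('i, 's) min_problem" where
  "restrict_instances P X = P\<lparr>instances := instances P \<inter> X\<rparr>"

definition decision_version ::
  "('i \<Rightarrow> bool list) \<Rightarrow> ('i, 's) min_problem \<Rightarrow> language" where
  "decision_version e P =
     {e I @ enc_nat k | I k. I \<in> instances P \<and> (\<exists>y. optimal P I y \<and> cost P I y \<le> k)}"

definition NP_hard_min :: "('i \<Rightarrow> bool list) \<Rightarrow> ('i, 's) min_problem \<Rightarrow> bool" where
  "NP_hard_min e P \<longleftrightarrow> NP_hard (decision_version e P)"

datatype label = Quasi | Sensitive

text \<open>Rows are referred to by their index, so a database may contain equal rows.\<close>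

record 'v database =
  labels :: "label list"
  rows :: "'v list list"

definition valid_database :: "'v database \<Rightarrow> bool" where
  "valid_database D \<longleftrightarrow> (\<forall>r \<in> set (rows D). length r = length (labels D))"

definition quasi :: "'v database \<Rightarrow> nat set" where
  "quasi D = {j. j < length (labels D) \<and> labels D ! j = Quasi}"

definition sensitive :: "'v database \<Rightarrow> nat set" where
  "sensitive D = {j. j < length (labels D) \<and> labels D ! j = Sensitive}"

definition diverse :: "nat \<Rightarrow> 'v database \<Rightarrow> bool" where
  "diverse l D \<longleftrightarrow>
     (\<forall>i0 < length (rows D). \<exists>u :: nat \<Rightarrow> nat.
        u 0 = i0 \<and> (\<forall>i < l. u i < length (rows D)) \<and> inj_on u {..<l} \<and>
        (\<forall>q \<in> quasi D. \<forall>i j. i < j \<and> j < l \<longrightarrow> rows D ! u i ! q = rows D ! u j ! q) \<and>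
        (\<forall>s \<in> sensitive D. \<forall>i j. i < j \<and> j < l \<longrightarrow> rows D ! u i ! s \<noteq> rows D ! u j ! s))"

text \<open>In a database with suppressed entries, \<^const>\<open>None\<close> is the star.\<close>

definition suppression :: "'v database \<Rightarrow> 'v option database \<Rightarrow> bool" where
  "suppression D E \<longleftrightarrow>
     valid_database E \<and> labels E = labels D \<and> length (rows E) = length (rows D) \<and>
     (\<forall>i < length (rows D). \<forall>j < length (labels D).
        rows E ! i ! j = Some (rows D ! i ! j) \<or> j \<in> quasi D \<and> rows E ! i ! j = None)"

definition stars :: "'v option database \<Rightarrow> nat" where
  "stars E = card {(i, j). i < length (rows E) \<and> j \<in> quasi E \<and> rows E ! i ! j = None}"

definition diversity_problem :: "nat \<Rightarrow> ('v database, 'v option database) min_problem" where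
  "diversity_problem l =
     \<lparr>instances = {D. valid_database D},
      solutions = (\<lambda>D. {E. suppression D E \<and> diverse l E}),
      cost = (\<lambda>D. stars)\<rparr>"

text \<open>The type of entries of a database all of whose attributes are binary is \<^typ>\<open>bool\<close>.\<close>

definition enc_database :: "bool database \<Rightarrow> bool list" where
  "enc_database D =
     enc_list (\<lambda>a. enc_bool (a = Sensitive)) (labels D) @
     enc_list (enc_list enc_bool) (rows D)"

lemma enc_list_prefix_free:
  assumes e: "\<And>x y u v. e x @ u = e y @ v \<Longrightarrow> x = y \<and> u = v"
  shows "enc_list e xs @ u = enc_list e ys @ v \<Longrightarrow> xs = ys \<and> u = v"
proof (induction xs arbitrary: ys)
  case Nil
  then show ?case by (cases ys) (auto simp: enc_list_def)
next
  case (Cons x xs)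
  then obtain y ys' where ys: "ys = y # ys'"
    by (cases ys) (auto simp: enc_list_def)
  with Cons.prems have "e x @ (enc_list e xs @ u) = e y @ (enc_list e ys' @ v)"
    by (simp add: enc_list_def)
  from e[OF this] Cons.IH ys show ?case by blast
qed

lemma enc_nat_inj: "enc_nat k = enc_nat k' \<Longrightarrow> k = k'"
  by (drule arg_cong[where f = length]) (simp add: enc_nat_def)

lemma enc_instance_inj:
  assumes "enc_database D @ enc_nat k = enc_database D' @ enc_nat k'"
  shows "D = D' \<and> k = k'"
proof -
  have b: "enc_bool x @ u = enc_bool y @ v \<Longrightarrow> x = y \<and> u = v" for x y u v
    by (simp add: enc_bool_def)
  have a: "enc_bool (x = Sensitive) @ u = enc_bool (y = Sensitive) @ v \<Longrightarrow> x = y \<and> u = v"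
    for x y u v
    by (cases x; cases y) (simp_all add: enc_bool_def)
  note l = enc_list_prefix_free[of "\<lambda>a. enc_bool (a = Sensitive)", OF a]
  note r = enc_list_prefix_free[of "enc_list enc_bool",
      OF enc_list_prefix_free[of enc_bool, OF b]]
  from assms have "labels D = labels D' \<and>
      enc_list (enc_list enc_bool) (rows D) @ enc_nat k =
      enc_list (enc_list enc_bool) (rows D') @ enc_nat k'"
    using l by (simp add: enc_database_def)
  moreover from this have "rows D = rows D' \<and> enc_nat k = enc_nat k'"
    using r by blast
  ultimately show ?thesis
    using enc_nat_inj by simp
qed

end

theory Submission imports Defs begin

text \<open>Consider \<open>m + 1\<close> rows with sensitive values \<^term>\<open>True\<close>, all of whose quasi-identifiers are
  \<^term>\<open>True\<close>, and any number of rows with sensitive values \<^term>\<open>False\<close>. In a 2-diverse solution, each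
  group of rows with equal quasi-identifiers contains one of the former, so there are at most \<open>m + 1\<close>
  groups, and a column without a star is \<^term>\<open>True\<close> throughout the group. If the unit vectors are
  present with high multiplicity, a cheap solution has to keep one column in each of \<open>m\<close> groups and
  nothing in the last group; the remaining rows are then affordable iff each of them is \<^term>\<open>True\<close> in
  one of the \<open>m\<close> columns. So hitting sets of size \<open>m\<close> reduce to 2-diversity.

  With the literals over \<open>m\<close> variables as columns, and a row for each variable and each clause, this
  is satisfiability. The computations of a verifier are described by clauses which propagate the facts
  of the computation forward from the input, so that every satisfying assignment contains the actual
  computation on some certificate.

  The reduction only writes bits that depend on comparisons between loop counters with a
  polynomial range. It is carried out by a machine that keeps the differences of counters as head
  positions, so that every comparison reads a single symbol.\<close>

subsection \<open>Structured Turing machines\<close>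

text \<open>Hardness refers to concrete Turing machines, so the proof starts from an arbitrary
  language in NP and also has to build the reducing machine. One number \<open>N\<close>, polynomial
  in the input length, bounds the times, the tape positions and every loop of that machine. The
  three sensitive entries of a row are equal and act as a single bit. The budget is best read
  through the entries that survive: one in each of \<open>m\<close> rows with sensitive value True,
  one in each copy of \<open>m\<close> of the unit vectors, and one in every row of a set to be hit.
  There are \<open>2 * m\<close> columns, one per literal, and the pairs of complementary literals
  force a hitting set of size \<open>m\<close> to be a truth assignment. The multiplicity of the
  unit vectors has to be at least what all other rows could keep together, which is of order
  \<open>N ^ 6\<close>; \<open>N ^ 8\<close> also absorbs the constants that depend on the verifier.
  An assignment may contain more facts than the computation. This does no harm: all clauses but the
  last have a positive literal, and the last one is violated as soon as the facts of a rejecting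
  computation are present.\<close>

text \<open>The tapes carry names; \<open>L\<close> lists the names in the order of the tapes. A fragment consists of
  its number of states (which is also its exit state) and its transition function.\<close>

type_synonym 'i store = "'i \<Rightarrow> tape"
type_synonym 'i fragment = "nat \<times> (nat \<Rightarrow> ('i \<Rightarrow> nat) \<Rightarrow> nat \<times> ('i \<Rightarrow> nat \<times> move))"

text \<open>The default 0 agrees with that of \<open>look\<close>, so that a fragment sees the same
  symbols through a store as through the list of symbols passed to a machine.\<close>

definition view :: "'i list \<Rightarrow> 'i store \<Rightarrow> 'i \<Rightarrow> nat" where
  "view L \<sigma> i = (if i \<in> set L then read_tape (\<sigma> i) else 0)"

definition update :: "'i list \<Rightarrow> ('i \<Rightarrow> nat \<times> move) \<Rightarrow> 'i store \<Rightarrow> 'i store" where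
  "update L a \<sigma> i = (if i \<in> set L then act (a i) (\<sigma> i) else \<sigma> i)"

fun fstep :: "'i list \<Rightarrow> (nat \<Rightarrow> ('i \<Rightarrow> nat) \<Rightarrow> nat \<times> ('i \<Rightarrow> nat \<times> move)) \<Rightarrow> nat \<times> 'i store \<Rightarrow> nat \<times> 'i store" where
  "fstep L \<delta> (q, \<sigma>) = (fst (\<delta> q (view L \<sigma>)), update L (snd (\<delta> q (view L \<sigma>))) \<sigma>)"

text \<open>Every step starts in a state below \<open>n\<close>; the exit state is never executed,
  so it can be identified with the entry of the next fragment.\<close>

fun path where
  "path L n \<delta> cf 0 cf' \<longleftrightarrow> cf = cf'"
| "path L n \<delta> cf (Suc t) cf' \<longleftrightarrow> fst cf < n \<and> path L n \<delta> (fstep L \<delta> cf) t cf'"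

definition runs :: "'i list \<Rightarrow> 'i fragment \<Rightarrow> 'i store \<Rightarrow> nat \<Rightarrow> 'i store \<Rightarrow> bool" where
  "runs L F \<sigma> T \<sigma>' \<longleftrightarrow> (\<exists>t\<le>T. path L (fst F) (snd F) (0, \<sigma>) t (fst F, \<sigma>'))"

definition keep :: "('i \<Rightarrow> nat) \<Rightarrow> 'i \<Rightarrow> nat \<times> move" where
  "keep r i = (r i, Stay)"

definition skip :: "'i fragment" where
  "skip = (0, \<lambda>q r. (0, keep r))"

definition perform :: "(('i \<Rightarrow> nat) \<Rightarrow> 'i \<Rightarrow> nat \<times> move) \<Rightarrow> 'i fragment" where
  "perform a = (1, \<lambda>q r. (1, a r))"

fun sequence :: "'i fragment \<Rightarrow> 'i fragment \<Rightarrow> 'i fragment" where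
  "sequence (m, \<delta>) (n, \<epsilon>) =
     (m + n, \<lambda>q r. if q < m then \<delta> q r else apfst ((+) m) (\<epsilon> (q - m) r))"

text \<open>State 0 is the test. The body is entered at \<open>f 0\<close> rather than at 1 because
  a body without states has its entry as its exit, which \<open>f\<close> sends back to the
  test.\<close>

fun while_do :: "(('i \<Rightarrow> nat) \<Rightarrow> bool) \<Rightarrow> 'i fragment \<Rightarrow> 'i fragment" where
  "while_do c (n, \<delta>) =
     (let f = (\<lambda>q. if q = n then 0 else Suc q) in
      (Suc n, \<lambda>q r. if q = 0 then (if c r then f 0 else Suc n, keep r)
                     else apfst f (\<delta> (q - 1) r)))"

fun if_then_else :: "(('i \<Rightarrow> nat) \<Rightarrow> bool) \<Rightarrow> 'i fragment \<Rightarrow> 'i fragment \<Rightarrow> 'i fragment" where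
  "if_then_else c (m, \<delta>) (n, \<epsilon>) =
     (let f = (\<lambda>q. if q = m then Suc (m + n) else Suc q) in
      (Suc (m + n), \<lambda>q r. if q = 0 then (if c r then f 0 else Suc m, keep r)
         else if q \<le> m then apfst f (\<delta> (q - 1) r)
         else apfst (\<lambda>q. Suc (m + q)) (\<epsilon> (q - Suc m) r)))"

lemma update_keep [simp]: "update L (keep (view L \<sigma>)) \<sigma> = \<sigma>"
proof
  fix i
  show "update L (keep (view L \<sigma>)) \<sigma> i = \<sigma> i"
    by (cases "\<sigma> i") (auto simp: update_def keep_def view_def read_tape_def)
qed

lemma path_append:
  "path L n \<delta> cf s cf' \<Longrightarrow> path L n \<delta> cf' t cf'' \<Longrightarrow> path L n \<delta> cf (s + t) cf''"
  by (induction s arbitrary: cf) auto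

text \<open>All combinators rename the states of their components. The exit state may be sent
  anywhere, which is how a loop is closed and how branches are joined.\<close>

lemma path_embed:
  assumes "\<And>q r. q < n \<Longrightarrow> \<delta>' (f q) r = apfst f (\<delta> q r)" and "\<And>q. q < n \<Longrightarrow> f q < n'"
  shows "path L n \<delta> (q, \<sigma>) t (q', \<sigma>') \<Longrightarrow> path L n' \<delta>' (f q, \<sigma>) t (f q', \<sigma>')"
proof (induction t arbitrary: q \<sigma>)
  case (Suc t)
  then show ?case using assms by auto
qed auto

lemma runs_skip: "runs L skip \<sigma> T \<sigma>"
  unfolding runs_def skip_def by (intro exI[of _ 0]) auto

lemma runs_perform:
  "\<sigma>' = update L (a (view L \<sigma>)) \<sigma> \<Longrightarrow> runs L (perform a) \<sigma> (Suc 0) \<sigma>'"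
  unfolding runs_def perform_def by (intro exI[of _ 1]) auto

lemma runs_mono: "runs L F \<sigma> T \<sigma>' \<Longrightarrow> T \<le> T' \<Longrightarrow> runs L F \<sigma> T' \<sigma>'"
  unfolding runs_def by (meson order_trans)

lemma runs_sequence:
  assumes "runs L F \<sigma> S \<sigma>'" and "runs L G \<sigma>' T \<sigma>''"
  shows "runs L (sequence F G) \<sigma> (S + T) \<sigma>''"
proof -
  obtain m \<delta> n \<epsilon> where F: "F = (m, \<delta>)" and G: "G = (n, \<epsilon>)" by (cases F, cases G)
  let ?\<delta> = "snd (sequence F G)"
  from assms obtain s t where s: "s \<le> S" "path L m \<delta> (0, \<sigma>) s (m, \<sigma>')"
    and t: "t \<le> T" "path L n \<epsilon> (0, \<sigma>') t (n, \<sigma>'')"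
    by (auto simp: runs_def F G)
  have "path L (m + n) ?\<delta> (0, \<sigma>) s (m, \<sigma>')"
    using path_embed[of m ?\<delta> "\<lambda>q. q" \<delta> "m + n", OF _ _ s(2)] by (simp add: F G apfst_def map_prod_def)
  moreover have "path L (m + n) ?\<delta> (m + 0, \<sigma>') t (m + n, \<sigma>'')"
    using path_embed[of n ?\<delta> "(+) m" \<epsilon> "m + n", OF _ _ t(2)] by (simp add: F G)
  ultimately have "path L (m + n) ?\<delta> (0, \<sigma>) (s + t) (m + n, \<sigma>'')"
    using path_append by fastforce
  with s(1) t(1) show ?thesis by (auto simp: runs_def F G intro!: exI[of _ "s + t"])
qed

lemma runs_if_then_else:
  assumes "runs L (if c (view L \<sigma>) then F else G) \<sigma> T \<sigma>'"
  shows "runs L (if_then_else c F G) \<sigma> (Suc T) \<sigma>'"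
proof -
  obtain m \<delta> n \<epsilon> where F: "F = (m, \<delta>)" and G: "G = (n, \<epsilon>)" by (cases F, cases G)
  let ?\<delta> = "snd (if_then_else c F G)"
  define f where "f = (\<lambda>q. if q = m then Suc (m + n) else Suc q)"
  have d: "?\<delta> = (\<lambda>q r. if q = 0 then (if c r then f 0 else Suc m, keep r)
         else if q \<le> m then apfst f (\<delta> (q - 1) r)
         else apfst (\<lambda>q. Suc (m + q)) (\<epsilon> (q - Suc m) r))"
    by (simp only: F G f_def if_then_else.simps Let_def snd_conv)
  have fst: "fst (if_then_else c F G) = Suc (m + n)"
    by (simp add: F G Let_def)
  show ?thesis
  proof (cases "c (view L \<sigma>)")
    case True
    with assms obtain t where t: "t \<le> T" "path L m \<delta> (0, \<sigma>) t (m, \<sigma>')"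
      by (auto simp: runs_def F)
    have "path L (Suc (m + n)) ?\<delta> (f 0, \<sigma>) t (f m, \<sigma>')"
      by (rule path_embed[OF _ _ t(2)]) (auto simp: d f_def)
    then have "path L (Suc (m + n)) ?\<delta> (0, \<sigma>) (Suc t) (Suc (m + n), \<sigma>')"
      using True by (simp add: d) (simp add: f_def)
    with t(1) show ?thesis unfolding runs_def fst by (meson Suc_le_mono)
  next
    case False
    with assms obtain t where t: "t \<le> T" "path L n \<epsilon> (0, \<sigma>) t (n, \<sigma>')"
      by (auto simp: runs_def G)
    have "path L (Suc (m + n)) ?\<delta> (Suc (m + 0), \<sigma>) t (Suc (m + n), \<sigma>')"
      by (rule path_embed[OF _ _ t(2), where f = "\<lambda>q. Suc (m + q)"]) (auto simp: d)
    then have "path L (Suc (m + n)) ?\<delta> (0, \<sigma>) (Suc t) (Suc (m + n), \<sigma>')"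
      using False by (simp add: d)
    with t(1) show ?thesis unfolding runs_def fst by (meson Suc_le_mono)
  qed
qed

lemma runs_while_done:
  assumes "\<not> c (view L \<sigma>)"
  shows "runs L (while_do c F) \<sigma> (Suc 0) \<sigma>"
  using assms by (cases F) (auto simp: runs_def Let_def intro!: exI[of _ 1])

lemma runs_while_step:
  assumes c: "c (view L \<sigma>)" and "runs L F \<sigma> S \<sigma>'" and "runs L (while_do c F) \<sigma>' T \<sigma>''"
  shows "runs L (while_do c F) \<sigma> (Suc (S + T)) \<sigma>''"
proof -
  obtain n \<delta> where F: "F = (n, \<delta>)" by (cases F)
  let ?\<delta> = "snd (while_do c F)"
  define f where "f = (\<lambda>q. if q = n then 0 else Suc q)"
  have d: "?\<delta> = (\<lambda>q r. if q = 0 then (if c r then f 0 else Suc n, keep r)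
                     else apfst f (\<delta> (q - 1) r))"
    by (simp only: F f_def while_do.simps Let_def snd_conv)
  have fst: "fst (while_do c F) = Suc n"
    by (simp add: F Let_def)
  from assms obtain s t where s: "s \<le> S" "path L n \<delta> (0, \<sigma>) s (n, \<sigma>')"
    and t: "t \<le> T" "path L (Suc n) ?\<delta> (0, \<sigma>') t (Suc n, \<sigma>'')"
    by (auto simp: runs_def F fst[unfolded F] simp del: while_do.simps)
  have "path L (Suc n) ?\<delta> (f 0, \<sigma>) s (f n, \<sigma>')"
    by (rule path_embed[OF _ _ s(2)]) (auto simp: d f_def)
  then have "path L (Suc n) ?\<delta> (f 0, \<sigma>) (s + t) (Suc n, \<sigma>'')"
    using t(2) by (intro path_append) (auto simp: f_def)
  then have "path L (Suc n) ?\<delta> (0, \<sigma>) (Suc (s + t)) (Suc n, \<sigma>'')"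
    using c by (simp add: d)
  with s(1) t(1) show ?thesis unfolding runs_def fst
    by (meson Suc_le_mono add_mono)
qed

text \<open>\<open>s i\<close> is the store at the test before round \<open>i\<close>. A round pays
  one step for the test and \<open>T\<close> for the body; the final 1 is the failing test.\<close>

lemma runs_while:
  assumes "\<And>i. i < m \<Longrightarrow> c (view L (s i))" and "\<And>i. i < m \<Longrightarrow> runs L F (s i) T (s (Suc i))"
    and "\<not> c (view L (s m))"
  shows "runs L (while_do c F) (s 0) (m * Suc T + 1) (s m)"
  using assms
proof (induction m arbitrary: s)
  case 0
  then show ?case by (simp add: runs_while_done)
next
  case (Suc m)
  have "runs L (while_do c F) (s (Suc 0)) (m * Suc T + 1) (s (Suc m))"
    using Suc.IH[of "\<lambda>i. s (Suc i)"] Suc.prems by simp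
  with Suc.prems have "runs L (while_do c F) (s 0) (Suc (T + (m * Suc T + 1))) (s (Suc m))"
    by (intro runs_while_step[of c]) auto
  then show ?case by (simp add: algebra_simps)
qed

section \<open>From fragments to valid Turing machines\<close>

definition well_formed :: "'i fragment \<Rightarrow> bool" where
  "well_formed F \<longleftrightarrow> (\<forall>q < fst F. \<forall>r. (\<forall>i. r i < 6) \<longrightarrow>
     fst (snd F q r) \<le> fst F \<and> (\<forall>i. fst (snd (snd F q r) i) < 6))"

lemma well_formed_skip [simp]: "well_formed skip"
  by (simp add: well_formed_def skip_def)

lemma well_formed_perform:
  "(\<And>r i. (\<forall>i. r i < 6) \<Longrightarrow> fst (a r i) < 6) \<Longrightarrow> well_formed (perform a)"
  by (simp add: well_formed_def perform_def)

lemma well_formed_sequence [simp]: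
  assumes "well_formed F" and "well_formed G"
  shows "well_formed (sequence F G)"
proof -
  obtain m \<delta> n \<epsilon> where FG: "F = (m, \<delta>)" "G = (n, \<epsilon>)" by (cases F, cases G)
  show ?thesis
    unfolding well_formed_def
  proof (intro allI impI)
    fix q and r :: "'a \<Rightarrow> nat"
    assume q: "q < fst (sequence F G)" and r: "\<forall>i. r i < 6"
    show "fst (snd (sequence F G) q r) \<le> fst (sequence F G) \<and>
      (\<forall>i. fst (snd (snd (sequence F G) q r) i) < 6)"
    proof (cases "q < m")
      case True
      then show ?thesis using assms(1) r by (auto simp: FG well_formed_def intro: trans_le_add1)
    next
      case False
      then have "q - m < n" using q by (auto simp: FG)
      then show ?thesis using False assms(2) r by (auto simp: FG well_formed_def)
    qed
  qed
qed

lemma well_formed_while_do [simp]: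
  assumes "well_formed F"
  shows "well_formed (while_do c F)"
proof -
  obtain n \<delta> where F: "F = (n, \<delta>)" by (cases F)
  show ?thesis
    unfolding well_formed_def
  proof (intro allI impI)
    fix q and r :: "'a \<Rightarrow> nat"
    assume q: "q < fst (while_do c F)" and r: "\<forall>i. r i < 6"
    show "fst (snd (while_do c F) q r) \<le> fst (while_do c F) \<and>
      (\<forall>i. fst (snd (snd (while_do c F) q r) i) < 6)"
    proof (cases "q = 0")
      case True
      then show ?thesis using r by (auto simp: F Let_def keep_def)
    next
      case False
      then have "q - 1 < n" using q by (auto simp: F Let_def)
      then show ?thesis using False assms r by (auto simp: F Let_def well_formed_def)
    qed
  qed
qed

lemma well_formed_if_then_else [simp]:
  assumes "well_formed F" and "well_formed G"
  shows "well_formed (if_then_else c F G)"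
proof -
  obtain m \<delta> n \<epsilon> where FG: "F = (m, \<delta>)" "G = (n, \<epsilon>)" by (cases F, cases G)
  show ?thesis
    unfolding well_formed_def
  proof (intro allI impI)
    fix q and r :: "'a \<Rightarrow> nat"
    assume q: "q < fst (if_then_else c F G)" and r: "\<forall>i. r i < 6"
    show "fst (snd (if_then_else c F G) q r) \<le> fst (if_then_else c F G) \<and>
      (\<forall>i. fst (snd (snd (if_then_else c F G) q r) i) < 6)"
    proof (cases "q = 0")
      case True
      then show ?thesis using r by (auto simp: FG Let_def keep_def)
    next
      case q0: False
      show ?thesis
      proof (cases "q \<le> m")
        case True
        then have "q - 1 < m" using q0 by auto
        with assms(1) r have "fst (\<delta> (q - 1) r) \<le> m \<and> (\<forall>i. fst (snd (\<delta> (q - 1) r) i) < 6)"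
          by (auto simp: FG well_formed_def)
        then show ?thesis using q0 True by (auto simp: FG Let_def)
      next
        case False
        then have "q - Suc m < n" using q by (auto simp: FG Let_def)
        then show ?thesis using q0 False assms(2) r by (auto simp: FG Let_def well_formed_def)
      qed
    qed
  qed
qed

definition look :: "'i list \<Rightarrow> nat list \<Rightarrow> 'i \<Rightarrow> nat" where
  "look L rs i = (case map_of (zip L rs) i of None \<Rightarrow> 0 | Some s \<Rightarrow> s)"

lemma look_map: "look L (map (\<lambda>i. read_tape (\<sigma> i)) L) = view L \<sigma>"
  by (rule ext) (simp add: look_def view_def map_of_zip_map)

text \<open>The alphabet has room for the blank, the two bits, the symbol 3 for guessed cells and
  ruler cells, and the end mark 4.\<close>

definition machine :: "'i list \<Rightarrow> 'i fragment \<Rightarrow> tm" where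
  "machine L F = \<lparr>tapes = length L, symbols = 6, states = fst F,
     delta = \<lambda>q rs. (fst (snd F q (look L rs)), map (snd (snd F q (look L rs))) L)\<rparr>"

lemma valid_machine:
  assumes "L \<noteq> []" and "well_formed F"
  shows "valid_tm (machine L F)"
proof -
  have look: "look L rs i < 6" if "\<forall>r\<in>set rs. r < 6" for rs i
    using that by (auto simp: look_def split: option.split dest!: map_of_SomeD set_zip_rightD)
  show ?thesis
    unfolding valid_tm_def
  proof (intro conjI allI impI)
    show "tapes (machine L F) \<ge> 1" "symbols (machine L F) \<ge> 3"
      using assms(1) by (cases L; simp add: machine_def)+
    fix q rs
    assume q: "q < states (machine L F)"
      and rs: "length rs = tapes (machine L F) \<and> (\<forall>r\<in>set rs. r < symbols (machine L F))"
    have "\<forall>i. look L rs i < 6" using look rs by (simp add: machine_def)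
    with assms(2) q have "fst (snd F q (look L rs)) \<le> fst F"
      "\<forall>i. fst (snd (snd F q (look L rs)) i) < 6"
      by (simp_all add: well_formed_def machine_def)
    then show "fst (delta (machine L F) q rs) \<le> states (machine L F)"
      "length (snd (delta (machine L F) q rs)) = tapes (machine L F)"
      "\<forall>(w, d)\<in>set (snd (delta (machine L F) q rs)). w < symbols (machine L F)"
      by (auto simp: machine_def) (metis fst_conv)
  qed
qed

lemma machine_path:
  assumes "path L (fst F) (snd F) (q, \<sigma>) t (q', \<sigma>')"
  shows "(step (machine L F) ^^ t) (q, map \<sigma> L) = (q', map \<sigma>' L)"
  using assms
proof (induction t arbitrary: q \<sigma>)
  case (Suc t)
  let ?r = "view L \<sigma>"
  have "map2 act (map (snd (snd F q ?r)) L) (map \<sigma> L) = map (update L (snd (snd F q ?r)) \<sigma>) L"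
    by (simp add: zip_map_map zip_same_conv_map update_def)
  moreover from Suc.prems have "q < fst F"
    "path L (fst F) (snd F) (fst (snd F q ?r), update L (snd (snd F q ?r)) \<sigma>) t (q', \<sigma>')"
    by auto
  ultimately show ?case
    using Suc.IH by (simp add: machine_def look_map comp_def funpow_Suc_right del: funpow.simps)
qed auto

subsection \<open>Emission programs\<close>

text \<open>The \<open>Base\<close> tapes hold copies of the input and count the loops that measure
  out polynomial lengths. A loop variable \<open>v\<close> owns a ruler \<open>Var v\<close>, a copy
  \<open>Ini v\<close> of the initial tape of the verifier, and the tapes \<open>Diff\<close> in
  which it occurs.\<close>

datatype tid = In | Base nat | Var nat | Ini nat | Diff nat nat | Out

text \<open>The order matters only at its ends: the machine model has its input on the first tape
  and its output on the last one.\<close>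

definition tids :: "nat \<Rightarrow> tid list" where
  "tids E = In # map Base [0..<E] @ map Var [0..<15] @ map Ini [0..<15] @
     map (\<lambda>(u, v). Diff u v) (List.product [0..<15] [0..<15]) @ [Out]"

lemma set_tids:
  "set (tids E) = {In, Out} \<union> Base ` {..<E} \<union> Var ` {..<15} \<union> Ini ` {..<15} \<union>
     (\<lambda>(u, v). Diff u v) ` ({..<15} \<times> {..<15})"
  by (simp add: tids_def insert_commute atLeast0LessThan) blast

lemma mem_tids [simp]:
  "In \<in> set (tids E)" "Out \<in> set (tids E)" "Base i \<in> set (tids E) \<longleftrightarrow> i < E"
  "Var v \<in> set (tids E) \<longleftrightarrow> v < 15" "Ini v \<in> set (tids E) \<longleftrightarrow> v < 15"
  "Diff u v \<in> set (tids E) \<longleftrightarrow> u < 15 \<and> v < 15"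
  unfolding set_tids by auto

datatype test = Eq nat nat | Succ nat nat | Final nat | Symbol nat nat | Neg test | Conj test test

datatype prog = Nop | Emit bool | Then prog prog | Cond test prog prog | For nat prog

fun passes :: "test \<Rightarrow> (tid \<Rightarrow> nat) \<Rightarrow> bool" where
  "passes (Eq u v) r \<longleftrightarrow> r (Diff u v) = 1"
| "passes (Succ u v) r \<longleftrightarrow> r (Diff u v) = 2"
| "passes (Final v) r \<longleftrightarrow> r (Var v) = 4"
| "passes (Symbol v s) r \<longleftrightarrow> r (Ini v) = s"
| "passes (Neg c) r \<longleftrightarrow> \<not> passes c r"
| "passes (Conj c d) r \<longleftrightarrow> passes c r \<and> passes d r"

fun holds :: "nat \<Rightarrow> (int \<Rightarrow> nat) \<Rightarrow> test \<Rightarrow> (nat \<Rightarrow> nat) \<Rightarrow> bool" where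
  "holds N J (Eq u v) e \<longleftrightarrow> e u = e v"
| "holds N J (Succ u v) e \<longleftrightarrow> e u = Suc (e v)"
| "holds N J (Final v) e \<longleftrightarrow> Suc (e v) = N"
| "holds N J (Symbol v s) e \<longleftrightarrow> J (int (e v)) = s"
| "holds N J (Neg c) e \<longleftrightarrow> \<not> holds N J c e"
| "holds N J (Conj c d) e \<longleftrightarrow> holds N J c e \<and> holds N J d e"

fun emission :: "nat \<Rightarrow> (int \<Rightarrow> nat) \<Rightarrow> prog \<Rightarrow> (nat \<Rightarrow> nat) \<Rightarrow> bool list" where
  "emission N J Nop e = []"
| "emission N J (Emit b) e = [b]"
| "emission N J (Then p q) e = emission N J p e @ emission N J q e"
| "emission N J (Cond c p q) e = (if holds N J c e then emission N J p e else emission N J q e)"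
| "emission N J (For v p) e = concat (map (\<lambda>i. emission N J p (e(v := i))) [0..<N])"

fun test_vars :: "test \<Rightarrow> nat set" where
  "test_vars (Eq u v) = {u, v}"
| "test_vars (Succ u v) = {u, v}"
| "test_vars (Final v) = {v}"
| "test_vars (Symbol v s) = {v}"
| "test_vars (Neg c) = test_vars c"
| "test_vars (Conj c d) = test_vars c \<union> test_vars d"

fun loop_vars :: "prog \<Rightarrow> nat set" where
  "loop_vars (Then p q) = loop_vars p \<union> loop_vars q"
| "loop_vars (Cond c p q) = loop_vars p \<union> loop_vars q"
| "loop_vars (For v p) = insert v (loop_vars p)"
| "loop_vars _ = {}"

text \<open>A loop expects its variable to be 0 and resets it to 0, so an inner loop over the same
  variable would destroy the value of the outer one.\<close>

fun admissible :: "prog \<Rightarrow> bool" where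
  "admissible (Then p q) \<longleftrightarrow> admissible p \<and> admissible q"
| "admissible (Cond c p q) \<longleftrightarrow> test_vars c \<subseteq> {..<15} \<and> admissible p \<and> admissible q"
| "admissible (For v p) \<longleftrightarrow> v < 15 \<and> v \<notin> loop_vars p \<and> admissible p"
| "admissible _ \<longleftrightarrow> True"

fun emit_action :: "bool \<Rightarrow> (tid \<Rightarrow> nat) \<Rightarrow> tid \<Rightarrow> nat \<times> move" where
  "emit_action b r Out = (if b then 2 else 1, Right)"
| "emit_action b r i = keep r i"

text \<open>A change of \<open>v\<close> by \<open>d\<close> moves the difference tapes with
  \<open>v\<close> on the left along and those with \<open>v\<close> on the right in the opposite
  direction \<open>d'\<close>.\<close>

fun shift :: "nat \<Rightarrow> move \<Rightarrow> move \<Rightarrow> (tid \<Rightarrow> nat) \<Rightarrow> tid \<Rightarrow> nat \<times> move" where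
  "shift v d d' r (Var u) = (r (Var u), if u = v then d else Stay)"
| "shift v d d' r (Ini u) = (r (Ini u), if u = v then d else Stay)"
| "shift v d d' r (Diff a b) =
     (r (Diff a b), if a = b then Stay else if a = v then d else if b = v then d' else Stay)"
| "shift v d d' r i = keep r i"

abbreviation "increment v \<equiv> perform (shift v Right Left)"
abbreviation "decrement v \<equiv> perform (shift v Left Right)"

text \<open>After its last round a loop has run off the right end of the ruler. It steps back, walks
  left to the blank in cell -1 and returns to cell 0, ready to be run again.\<close>

fun compile :: "prog \<Rightarrow> tid fragment" where
  "compile Nop = skip"
| "compile (Emit b) = perform (emit_action b)"
| "compile (Then p q) = sequence (compile p) (compile q)"
| "compile (Cond c p q) = if_then_else (passes c) (compile p) (compile q)"
| "compile (For v p) =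
     sequence (while_do (\<lambda>r. r (Var v) \<noteq> 0) (sequence (compile p) (increment v)))
       (sequence (decrement v)
         (sequence (while_do (\<lambda>r. r (Var v) \<noteq> 0) (decrement v)) (increment v)))"

fun duration :: "nat \<Rightarrow> prog \<Rightarrow> nat" where
  "duration N Nop = 0"
| "duration N (Emit b) = 1"
| "duration N (Then p q) = duration N p + duration N q"
| "duration N (Cond c p q) = Suc (duration N p + duration N q)"
| "duration N (For v p) = N * (duration N p + 2) + N * 2 + 4"

definition ruler :: "nat \<Rightarrow> int \<Rightarrow> nat" where
  "ruler N j = (if 0 \<le> j \<and> j < int N then if j = int N - 1 then 4 else 3 else 0)"

text \<open>On a difference tape, cell 0 decides equality and cell 1 the successor relation; no
  other difference is ever asked for.\<close>

definition marks :: "int \<Rightarrow> nat" where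
  "marks j = (if j = 0 then 1 else if j = 1 then 2 else 0)"

text \<open>The value of a variable is the position of the heads of its tapes, and a tape \<^term>\<open>Diff u v\<close>
  has its head at the difference of two variables. The last cell of the ruler carries the symbol 4.\<close>

fun conf :: "nat \<Rightarrow> (int \<Rightarrow> nat) \<Rightarrow> tid store \<Rightarrow> (nat \<Rightarrow> int) \<Rightarrow> bool list \<Rightarrow> tid store" where
  "conf N J \<tau> e out (Var v) = (ruler N, e v)"
| "conf N J \<tau> e out (Ini v) = (J, e v)"
| "conf N J \<tau> e out (Diff u v) = (marks, if u < 15 \<and> v < 15 then e u - e v else 0)"
| "conf N J \<tau> e out Out = (inscribe out, int (length out))"
| "conf N J \<tau> e out i = \<tau> i"

lemma view_conf [simp]:
  "v < 15 \<Longrightarrow> view (tids E) (conf N J \<tau> e out) (Var v) = ruler N (e v)"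
  "v < 15 \<Longrightarrow> view (tids E) (conf N J \<tau> e out) (Ini v) = J (e v)"
  "u < 15 \<Longrightarrow> v < 15 \<Longrightarrow> view (tids E) (conf N J \<tau> e out) (Diff u v) = marks (e u - e v)"
  by (simp_all add: view_def read_tape_def)

lemma update_shift:
  assumes "v < 15" and "head_shift d' = - head_shift d"
  shows "update (tids E) (shift v d d' (view (tids E) (conf N J \<tau> e out))) (conf N J \<tau> e out) =
    conf N J \<tau> (e(v := e v + head_shift d)) out"
proof
  fix i
  show "update (tids E) (shift v d d' (view (tids E) (conf N J \<tau> e out))) (conf N J \<tau> e out) i =
    conf N J \<tau> (e(v := e v + head_shift d)) out i"
  proof (cases i)
    case (Base b)
    then show ?thesis by (cases "\<tau> (Base b)") (auto simp: update_def keep_def view_def read_tape_def)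
  next
    case In
    then show ?thesis by (cases "\<tau> In") (auto simp: update_def keep_def view_def read_tape_def)
  qed (use assms in \<open>auto simp: update_def keep_def view_def read_tape_def\<close>)
qed

lemma inscribe_snoc:
  "(inscribe xs)(int (length xs) := if b then 2 else 1) = inscribe (xs @ [b])"
  by (rule ext) (auto simp: inscribe_def nth_append)

lemma update_emit:
  "update (tids E) (emit_action b (view (tids E) (conf N J \<tau> e out))) (conf N J \<tau> e out) =
     conf N J \<tau> e (out @ [b])"
proof
  fix i
  show "update (tids E) (emit_action b (view (tids E) (conf N J \<tau> e out))) (conf N J \<tau> e out) i =
    conf N J \<tau> e (out @ [b]) i"
  proof (cases i)
    case (Base x2)
    then show ?thesis by (cases "\<tau> (Base x2)") (auto simp: update_def keep_def view_def read_tape_def)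
  next
    case In
    then show ?thesis by (cases "\<tau> In") (auto simp: update_def keep_def view_def read_tape_def)
  next
    case Out
    then show ?thesis using inscribe_snoc[of out b] by (auto simp: update_def)
  qed (auto simp: update_def keep_def view_def read_tape_def)
qed

lemma runs_increment:
  "v < 15 \<Longrightarrow> runs (tids E) (increment v) (conf N J \<tau> e out) (Suc 0) (conf N J \<tau> (e(v := e v + 1)) out)"
  by (rule runs_perform) (simp add: update_shift)

lemma runs_decrement:
  "v < 15 \<Longrightarrow> runs (tids E) (decrement v) (conf N J \<tau> e out) (Suc 0) (conf N J \<tau> (e(v := e v - 1)) out)"
  by (rule runs_perform) (simp add: update_shift)

lemma passes_conf:
  assumes "test_vars c \<subseteq> {..<15}" and "N > 0" and "\<forall>v\<in>test_vars c. e v < N"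
  shows "passes c (view (tids E) (conf N J \<tau> (\<lambda>v. int (e v)) out)) \<longleftrightarrow> holds N J c e"
  using assms by (induction c) (auto simp: marks_def ruler_def)

text \<open>The loop variables are 0 outside of their loops.\<close>

lemma runs_compile:
  assumes "admissible p" and "\<forall>v\<in>loop_vars p. e v = 0" and "\<forall>v. e v < N"
  shows "runs (tids E) (compile p) (conf N J \<tau> (\<lambda>v. int (e v)) out) (duration N p)
    (conf N J \<tau> (\<lambda>v. int (e v)) (out @ emission N J p e))"
  using assms
proof (induction p arbitrary: e out)
  case Nop
  then show ?case by (simp add: runs_skip)
next
  case (Emit b)
  then show ?case by (simp add: runs_perform update_emit)
next
  case (Then p q)
  from Then.prems have "runs (tids E) (compile p) (conf N J \<tau> (\<lambda>v. int (e v)) out) (duration N p)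
    (conf N J \<tau> (\<lambda>v. int (e v)) (out @ emission N J p e))" by (intro Then.IH(1)) auto
  moreover from Then.prems have "runs (tids E) (compile q)
    (conf N J \<tau> (\<lambda>v. int (e v)) (out @ emission N J p e)) (duration N q)
    (conf N J \<tau> (\<lambda>v. int (e v)) ((out @ emission N J p e) @ emission N J q e))"
    by (intro Then.IH(2)) auto
  ultimately show ?case by (auto intro: runs_sequence)
next
  case (Cond c p q)
  have "N > 0" using Cond.prems(3) by (metis gr0I not_less0)
  with Cond.prems have c:
    "passes c (view (tids E) (conf N J \<tau> (\<lambda>v. int (e v)) out)) \<longleftrightarrow> holds N J c e"
    by (intro passes_conf) auto
  have "runs (tids E) (if holds N J c e then compile p else compile q)
    (conf N J \<tau> (\<lambda>v. int (e v)) out) (duration N p + duration N q)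
    (conf N J \<tau> (\<lambda>v. int (e v)) (out @ emission N J (Cond c p q) e))"
    using Cond.IH(1)[of e out] Cond.IH(2)[of e out] Cond.prems by (auto elim!: runs_mono)
  then show ?case by (simp add: runs_if_then_else c del: emission.simps)
next
  case (For v p)
  have v: "v < 15" "e v = 0" and p: "admissible p" "v \<notin> loop_vars p" using For.prems by auto
  let ?I = "\<lambda>e :: nat \<Rightarrow> nat. \<lambda>u. int (e u)"
  \<comment> \<open>\<open>s i\<close> is the store at the test before round \<open>i\<close>;
    \<open>z i\<close> is the store during the way back, where \<open>v\<close> goes from
    \<open>N - 1\<close> down to -1.\<close>
  define outs where "outs i = out @ concat (map (\<lambda>i. emission N J p (e(v := i))) [0..<i])" for i
  define s where "s i = conf N J \<tau> (?I (e(v := i))) (outs i)" for i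
  define z where "z i = conf N J \<tau> (\<lambda>u. if u = v then int N - 1 - int i else int (e u)) (outs N)" for i
  have "runs (tids E) (while_do (\<lambda>r. r (Var v) \<noteq> 0) (sequence (compile p) (increment v)))
    (s 0) (N * Suc (duration N p + Suc 0) + 1) (s N)"
  proof (rule runs_while)
    show "view (tids E) (s i) (Var v) \<noteq> 0" if "i < N" for i
      using that v by (simp add: s_def ruler_def)
    show "\<not> view (tids E) (s N) (Var v) \<noteq> 0"
      using v by (simp add: s_def ruler_def)
    fix i
    assume i: "i < N"
    have o: "outs (Suc i) = outs i @ emission N J p (e(v := i))" by (simp add: outs_def)
    have "runs (tids E) (compile p) (s i) (duration N p) (conf N J \<tau> (?I (e(v := i))) (outs (Suc i)))"
      unfolding s_def o by (rule For.IH) (use For.prems p i in auto)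
    moreover have "runs (tids E) (increment v) (conf N J \<tau> (?I (e(v := i))) (outs (Suc i))) (Suc 0)
      (s (Suc i))"
      using runs_increment[OF v(1), of E N J \<tau> "?I (e(v := i))" "outs (Suc i)"]
      by (simp add: s_def fun_upd_def if_distrib add.commute cong: if_cong)
    ultimately show "runs (tids E) (sequence (compile p) (increment v)) (s i)
      (duration N p + Suc 0) (s (Suc i))"
      by (rule runs_sequence)
  qed
  moreover have "runs (tids E) (decrement v) (s N) (Suc 0) (z 0)"
    using runs_decrement[OF v(1), of E N J \<tau> "?I (e(v := N))" "outs N"]
    by (simp add: s_def z_def fun_upd_def if_distrib cong: if_cong)
  moreover have "runs (tids E) (while_do (\<lambda>r. r (Var v) \<noteq> 0) (decrement v)) (z 0) (N * Suc (Suc 0) + 1) (z N)"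
  proof (rule runs_while)
    show "view (tids E) (z i) (Var v) \<noteq> 0" if "i < N" for i
      using that v by (simp add: z_def ruler_def)
    show "\<not> view (tids E) (z N) (Var v) \<noteq> 0"
      using v by (simp add: z_def ruler_def)
    show "runs (tids E) (decrement v) (z i) (Suc 0) (z (Suc i))" for i
      using runs_decrement[OF v(1), of E N J \<tau> "\<lambda>u. if u = v then int N - 1 - int i else int (e u)" "outs N"]
      by (simp add: z_def fun_upd_def if_distrib cong: if_cong)
  qed
  moreover have "runs (tids E) (increment v) (z N) (Suc 0) (conf N J \<tau> (?I e) (outs N))"
  proof -
    have "(\<lambda>u. if u = v then - 1 else int (e u))(v := 0) = ?I e" using v(2) by auto
    moreover have "int N - 1 - int N = - 1" by simp
    ultimately show ?thesis
      using runs_increment[OF v(1), of E N J \<tau> "\<lambda>u. if u = v then - 1 else int (e u)" "outs N"]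
      by (simp add: z_def cong: if_cong)
  qed
  ultimately have "runs (tids E) (compile (For v p)) (s 0)
    ((N * Suc (duration N p + Suc 0) + 1) + (Suc 0 + ((N * Suc (Suc 0) + 1) + Suc 0)))
    (conf N J \<tau> (?I e) (outs N))"
    unfolding compile.simps by (blast intro: runs_sequence)
  moreover have "s 0 = conf N J \<tau> (?I e) out"
    using v(2) fun_upd_idem[of e v 0] by (simp add: s_def outs_def)
  ultimately show ?case
    by (auto simp: outs_def algebra_simps elim!: runs_mono)
qed

lemma well_formed_compile [simp]: "well_formed (compile p)"
proof -
  have "well_formed (perform (shift v d d'))" for v d d'
    by (rule well_formed_perform, rename_tac r i, case_tac i) (auto simp: keep_def)
  moreover have "well_formed (perform (emit_action b))" for b
    by (rule well_formed_perform, rename_tac r i, case_tac i) (auto simp: keep_def)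
  ultimately show ?thesis by (induction p) auto
qed

subsection \<open>Polynomial bounds\<close>

text \<open>The shape of the bound is the one in \<open>polytime_function\<close> and
  \<open>class_NP\<close>.\<close>

definition poly_bounded :: "(nat \<Rightarrow> nat) \<Rightarrow> bool" where
  "poly_bounded f \<longleftrightarrow> (\<exists>c d. \<forall>n. f n \<le> c * n ^ d + c)"

lemma poly_bounded_mono: "poly_bounded g \<Longrightarrow> (\<And>n. f n \<le> g n) \<Longrightarrow> poly_bounded f"
  unfolding poly_bounded_def by (meson order_trans)

lemma poly_bounded_const: "poly_bounded (\<lambda>n. k)"
  unfolding poly_bounded_def by (intro exI[of _ k] exI[of _ 0]) simp

lemma poly_bounded_id: "poly_bounded (\<lambda>n. n)"
  unfolding poly_bounded_def by (intro exI[of _ 1]) simp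

lemma poly_bounded_mult:
  assumes "poly_bounded f" and "poly_bounded g"
  shows "poly_bounded (\<lambda>n. f n * g n)"
proof -
  from assms obtain a d b e where f: "f n \<le> a * n ^ d + a" and g: "g n \<le> b * n ^ e + b" for n
    by (auto simp: poly_bounded_def)
  have "f n * g n \<le> (4 * a * b) * n ^ (d + e) + 4 * a * b" for n
  proof -
    \<comment> \<open>For \<open>n = 0\<close> both factors are at most 2; otherwise each of the
      four products is at most \<open>n ^ (d + e)\<close>.\<close>
    have "(n ^ d + 1) * (n ^ e + 1) \<le> 4 * n ^ (d + e) + 4"
    proof (cases "n = 0")
      case True
      then show ?thesis by (cases d; cases e) simp_all
    next
      case False
      then have "n ^ d \<le> n ^ (d + e)" "n ^ e \<le> n ^ (d + e)" by (auto intro: power_increasing)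
      moreover have "(n ^ d + 1) * (n ^ e + 1) = n ^ (d + e) + n ^ d + n ^ e + 1"
        by (simp add: algebra_simps power_add)
      ultimately show ?thesis by linarith
    qed
    then have "(a * b) * ((n ^ d + 1) * (n ^ e + 1)) \<le> (a * b) * (4 * n ^ (d + e) + 4)"
      by (rule mult_le_mono2)
    moreover have "f n * g n \<le> (a * n ^ d + a) * (b * n ^ e + b)" by (rule mult_le_mono[OF f g])
    ultimately show ?thesis by (simp add: algebra_simps)
  qed
  then show ?thesis unfolding poly_bounded_def by blast
qed

text \<open>Twice the product of the successors dominates a sum, so this reduces to
  products.\<close>

lemma poly_bounded_add:
  assumes "poly_bounded f" and "poly_bounded g"
  shows "poly_bounded (\<lambda>n. f n + g n)"
proof -
  from assms obtain a d b e where f: "f n \<le> a * n ^ d + a" and g: "g n \<le> b * n ^ e + b" for n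
    by (auto simp: poly_bounded_def)
  have F: "poly_bounded (\<lambda>n. a * n ^ d + a + 1)" and G: "poly_bounded (\<lambda>n. b * n ^ e + b + 1)"
    unfolding poly_bounded_def
    by (rule exI[of _ "Suc a"], rule exI[of _ d], simp)
      (rule exI[of _ "Suc b"], rule exI[of _ e], simp)
  have "poly_bounded (\<lambda>n. 2 * ((a * n ^ d + a + 1) * (b * n ^ e + b + 1)))"
    by (intro poly_bounded_mult poly_bounded_const F G)
  moreover have "f n + g n \<le> 2 * ((a * n ^ d + a + 1) * (b * n ^ e + b + 1))" for n
  proof -
    have "u + v \<le> 2 * ((u + 1) * (v + 1))" for u v :: nat by (simp add: algebra_simps)
    from this[of "a * n ^ d + a" "b * n ^ e + b"] f[of n] g[of n] show ?thesis by linarith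
  qed
  ultimately show ?thesis by (rule poly_bounded_mono)
qed

lemma poly_bounded_power: "poly_bounded f \<Longrightarrow> poly_bounded (\<lambda>n. f n ^ k)"
  by (induction k) (auto intro: poly_bounded_const poly_bounded_mult)

lemmas poly_bounded_intros =
  poly_bounded_const poly_bounded_id poly_bounded_add poly_bounded_mult poly_bounded_power

lemma poly_bounded_duration:
  assumes N: "poly_bounded N"
  shows "poly_bounded (\<lambda>n. duration (N n) p)"
proof (induction p)
  case (Cond c p q)
  then have "poly_bounded (\<lambda>n. (duration (N n) p + duration (N n) q) + 1)"
    by (intro poly_bounded_intros)
  then show ?case by simp
qed (auto intro!: poly_bounded_intros N)

subsection \<open>Setting up the tapes\<close>

fun sym :: "bool \<Rightarrow> nat" where
  "sym b = (if b then 2 else 1)"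

text \<open>The symbol 3 marks the cells in which a certificate is to be guessed.\<close>

definition guess_tape :: "nat \<Rightarrow> bool list \<Rightarrow> int \<Rightarrow> nat" where
  "guess_tape B w j =
     (if 0 \<le> j \<and> j < int (length w) then sym (w ! nat j)
      else if 0 \<le> j \<and> j < int (length w + B) then 3 else 0)"

text \<open>The preparation treats all tapes of one kind alike, so one tape of each kind describes
  the store; only the heads \<open>bp\<close> of the \<open>Base\<close> tapes differ, since they
  count nested loops. \<open>D\<close> gives the tapes outside \<open>tids E\<close>.\<close>

definition pre :: "nat \<Rightarrow> tid store \<Rightarrow> bool list \<Rightarrow> int \<Rightarrow> (int \<Rightarrow> nat) \<Rightarrow> (nat \<Rightarrow> int) \<Rightarrow> tape \<Rightarrow> tape \<Rightarrow> tape \<Rightarrow> tid store"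
  where
  "pre E D x i bc bp tv tj td t =
     (if t \<in> set (tids E)
      then (case t of In \<Rightarrow> (inscribe x, i) | Base b \<Rightarrow> (bc, bp b) | Var v \<Rightarrow> tv | Ini v \<Rightarrow> tj
        | Diff u v \<Rightarrow> td | Out \<Rightarrow> (inscribe [], 0))
      else D t)"

lemma view_pre [simp]:
  "view (tids E) (pre E D x i bc bp tv tj td) In = inscribe x i"
  "b < E \<Longrightarrow> view (tids E) (pre E D x i bc bp tv tj td) (Base b) = bc (bp b)"
  "v < 15 \<Longrightarrow> view (tids E) (pre E D x i bc bp tv tj td) (Var v) = read_tape tv"
  "v < 15 \<Longrightarrow> view (tids E) (pre E D x i bc bp tv tj td) (Ini v) = read_tape tj"
  by (simp_all add: view_def pre_def read_tape_def)

fun prepare where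
  "prepare fi fb fv fj fd r In = fi r (r In)"
| "prepare fi fb fv fj fd r (Base b) = fb b r (r (Base b))"
| "prepare fi fb fv fj fd r (Var v) = fv r (r (Var v))"
| "prepare fi fb fv fj fd r (Ini v) = fj r (r (Ini v))"
| "prepare fi fb fv fj fd r (Diff u v) = fd r (r (Diff u v))"
| "prepare fi fb fv fj fd r Out = (r Out, Stay)"

abbreviation mv :: "move \<Rightarrow> (tid \<Rightarrow> nat) \<Rightarrow> nat \<Rightarrow> nat \<times> move" where
  "mv d \<equiv> \<lambda>r s. (s, d)"

abbreviation "put s d \<equiv> \<lambda>(r :: tid \<Rightarrow> nat) (s' :: nat). (s :: nat, d :: move)"

lemma runs_prepare:
  assumes "r = view (tids E) (pre E D x i bc bp tv tj td)"
    and "act (fi r (inscribe x i)) (inscribe x, i) = (inscribe x, i')"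
    and "\<And>b. b < E \<Longrightarrow> act (fb b r (bc (bp b))) (bc, bp b) = (bc', bp' b)"
    and "act (fv r (read_tape tv)) tv = tv'"
    and "act (fj r (read_tape tj)) tj = tj'"
    and "act (fd r (read_tape td)) td = td'"
  shows "runs (tids E) (perform (prepare fi fb fv fj fd)) (pre E D x i bc bp tv tj td) (Suc 0)
    (pre E D x i' bc' bp' tv' tj' td')"
proof (rule runs_perform, rule ext)
  fix t
  show "pre E D x i' bc' bp' tv' tj' td' t =
    update (tids E) (prepare fi fb fv fj fd (view (tids E) (pre E D x i bc bp tv tj td)))
      (pre E D x i bc bp tv tj td) t"
    unfolding assms(1)[symmetric]
    by (cases t) (use assms in \<open>auto simp: update_def pre_def view_def read_tape_def\<close>)
qed

abbreviation "base_move b d \<equiv>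
  perform (prepare (mv Stay) (\<lambda>b' r s. (s, if b' = b then d else Stay)) (mv Stay) (mv Stay) (mv Stay))"

text \<open>A copy of the input serves as a counter: its nonblank cells give one round for each
  input bit. The head is returned to the origin so that the loop can be nested.\<close>

definition for_base :: "nat \<Rightarrow> tid fragment \<Rightarrow> tid fragment" where
  "for_base b F =
     sequence (while_do (\<lambda>r. r (Base b) \<noteq> 0) (sequence F (base_move b Right)))
       (sequence (base_move b Left)
         (sequence (while_do (\<lambda>r. r (Base b) \<noteq> 0) (base_move b Left)) (base_move b Right)))"

fun nest :: "nat \<Rightarrow> tid fragment \<Rightarrow> tid fragment" where
  "nest 0 F = F"
| "nest (Suc k) F = for_base k (nest k F)"

fun repeat :: "nat \<Rightarrow> tid fragment \<Rightarrow> tid fragment" where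
  "repeat 0 F = skip"
| "repeat (Suc k) F = sequence F (repeat k F)"

fun nest_time :: "nat \<Rightarrow> nat \<Rightarrow> nat \<Rightarrow> nat" where
  "nest_time n 0 T = T"
| "nest_time n (Suc k) T = n * (nest_time n k T + 2) + n * 2 + 4"

lemma act_keep: "act (read_tape t, Stay) t = t"
  by (cases t) (simp add: read_tape_def)

lemma runs_base_move:
  "runs (tids E) (base_move b d) (pre E D x i bc bp tv tj td) (Suc 0)
     (pre E D x i bc (bp(b := bp b + head_shift d)) tv tj td)"
  by (rule runs_prepare[OF refl]) (auto simp: act_keep)

text \<open>\<open>tv\<close> and \<open>tj\<close> are indexed by the number of elementary actions
  performed so far. One run of the body performs \<open>k\<close> of them, so no number has to be
  computed by the machine.\<close>

lemma runs_for_base: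
  assumes "b < E" and "bp b = 0" and bc: "\<And>j. bc j \<noteq> 0 \<longleftrightarrow> 0 \<le> j \<and> j < int n"
    and F: "\<And>m l. l \<le> n \<Longrightarrow> runs (tids E) F (pre E D x i bc (bp(b := int l)) (tv m) (tj m) td) T
      (pre E D x i bc (bp(b := int l)) (tv (m + k)) (tj (m + k)) td)"
  shows "runs (tids E) (for_base b F) (pre E D x i bc bp (tv m) (tj m) td) (n * (T + 2) + n * 2 + 4)
    (pre E D x i bc bp (tv (m + n * k)) (tj (m + n * k)) td)"
proof -
  define s where "s l = pre E D x i bc (bp(b := int l)) (tv (m + l * k)) (tj (m + l * k)) td" for l
  define z where "z l = pre E D x i bc (bp(b := int n - 1 - int l)) (tv (m + n * k)) (tj (m + n * k)) td" for l
  have "runs (tids E) (while_do (\<lambda>r. r (Base b) \<noteq> 0) (sequence F (base_move b Right)))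
    (s 0) (n * Suc (T + Suc 0) + 1) (s n)"
  proof (rule runs_while)
    show "view (tids E) (s l) (Base b) \<noteq> 0" if "l < n" for l
      using that assms(1) by (simp add: s_def bc del: neq0_conv)
    show "\<not> view (tids E) (s n) (Base b) \<noteq> 0"
      using assms(1) bc[of "int n"] by (simp add: s_def)
    fix l
    assume "l < n"
    with F[of l "m + l * k"] have "runs (tids E) F (s l) T
        (pre E D x i bc (bp(b := int l)) (tv (m + Suc l * k)) (tj (m + Suc l * k)) td)"
      by (simp add: s_def algebra_simps)
    moreover have "runs (tids E) (base_move b Right)
        (pre E D x i bc (bp(b := int l)) (tv (m + Suc l * k)) (tj (m + Suc l * k)) td) (Suc 0) (s (Suc l))"
      using runs_base_move[of E b Right D x i bc "bp(b := int l)" "tv (m + Suc l * k)" "tj (m + Suc l * k)" td]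
      by (simp add: s_def add.commute)
    ultimately show "runs (tids E) (sequence F (base_move b Right)) (s l) (T + Suc 0) (s (Suc l))"
      by (rule runs_sequence)
  qed
  moreover have "runs (tids E) (base_move b Left) (s n) (Suc 0) (z 0)"
    using runs_base_move[of E b Left D x i bc "bp(b := int n)" "tv (m + n * k)" "tj (m + n * k)" td]
    by (simp add: s_def z_def)
  moreover have "runs (tids E) (while_do (\<lambda>r. r (Base b) \<noteq> 0) (base_move b Left)) (z 0) (n * Suc (Suc 0) + 1) (z n)"
  proof (rule runs_while)
    show "view (tids E) (z l) (Base b) \<noteq> 0" if "l < n" for l
      using that assms(1) by (simp add: z_def bc del: neq0_conv)
    show "\<not> view (tids E) (z n) (Base b) \<noteq> 0"
      using assms(1) bc[of "- 1"] by (simp add: z_def)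
    show "runs (tids E) (base_move b Left) (z l) (Suc 0) (z (Suc l))" for l
      using runs_base_move[of E b Left D x i bc "bp(b := int n - 1 - int l)" "tv (m + n * k)" "tj (m + n * k)" td]
      by (simp add: z_def algebra_simps)
  qed
  moreover have "runs (tids E) (base_move b Right) (z n) (Suc 0)
      (pre E D x i bc bp (tv (m + n * k)) (tj (m + n * k)) td)"
    using runs_base_move[of E b Right D x i bc "bp(b := - 1)" "tv (m + n * k)" "tj (m + n * k)" td]
      fun_upd_idem[of bp b 0] assms(2)
    by (simp add: z_def)
  ultimately have "runs (tids E) (for_base b F) (s 0)
    ((n * Suc (T + Suc 0) + 1) + (Suc 0 + ((n * Suc (Suc 0) + 1) + Suc 0)))
    (pre E D x i bc bp (tv (m + n * k)) (tj (m + n * k)) td)"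
    unfolding for_base_def by (blast intro: runs_sequence)
  moreover have "s 0 = pre E D x i bc bp (tv m) (tj m) td"
    using assms(2) fun_upd_idem[of bp b 0] by (simp add: s_def)
  ultimately show ?thesis by (auto simp: algebra_simps elim!: runs_mono)
qed

lemma runs_nest:
  assumes "k \<le> E" and "\<And>b. b < k \<Longrightarrow> bp b = 0" and bc: "\<And>j. bc j \<noteq> 0 \<longleftrightarrow> 0 \<le> j \<and> j < int n"
    and F: "\<And>m bp. runs (tids E) F (pre E D x i bc bp (tv m) (tj m) td) T
      (pre E D x i bc bp (tv (Suc m)) (tj (Suc m)) td)"
  shows "runs (tids E) (nest k F) (pre E D x i bc bp (tv m) (tj m) td) (nest_time n k T)
    (pre E D x i bc bp (tv (m + n ^ k)) (tj (m + n ^ k)) td)"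
  using assms(1,2)
proof (induction k arbitrary: bp m)
  case 0
  then show ?case using F by simp
next
  case (Suc k)
  have "runs (tids E) (for_base k (nest k F)) (pre E D x i bc bp (tv m) (tj m) td)
      (n * (nest_time n k T + 2) + n * 2 + 4)
      (pre E D x i bc bp (tv (m + n * n ^ k)) (tj (m + n * n ^ k)) td)"
  proof (rule runs_for_base)
    fix m l
    assume "l \<le> n"
    show "runs (tids E) (nest k F) (pre E D x i bc (bp(k := int l)) (tv m) (tj m) td) (nest_time n k T)
        (pre E D x i bc (bp(k := int l)) (tv (m + n ^ k)) (tj (m + n ^ k)) td)"
      using Suc.prems by (intro Suc.IH) auto
  qed (use Suc.prems bc in auto)
  then show ?case by simp
qed

lemma runs_repeat:
  assumes "\<And>m. runs (tids E) F (s m) T (s (m + k))"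
  shows "runs (tids E) (repeat c F) (s m) (c * T) (s (m + c * k))"
proof (induction c arbitrary: m)
  case 0
  then show ?case by (simp add: runs_skip)
next
  case (Suc c)
  from runs_sequence[OF assms[of m] Suc.IH[of "m + k"]] show ?case by (simp add: add.assoc)
qed

text \<open>This runs \<open>F\<close> exactly \<open>c * n ^ d + c\<close> times, where
  \<open>n\<close> is the input length; it is used to write that many cells.\<close>

definition poly_repeat :: "nat \<Rightarrow> nat \<Rightarrow> tid fragment \<Rightarrow> tid fragment" where
  "poly_repeat c d F = sequence (repeat c (nest d F)) (repeat c F)"

lemma runs_poly_repeat:
  assumes "d \<le> E" and bc: "\<And>j. bc j \<noteq> 0 \<longleftrightarrow> 0 \<le> j \<and> j < int n"
    and F: "\<And>m bp. runs (tids E) F (pre E D x i bc bp (tv m) (tj m) td) T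
      (pre E D x i bc bp (tv (Suc m)) (tj (Suc m)) td)"
  shows "runs (tids E) (poly_repeat c d F) (pre E D x i bc (\<lambda>_. 0) (tv 0) (tj 0) td)
    (c * nest_time n d T + c * T)
    (pre E D x i bc (\<lambda>_. 0) (tv (c * n ^ d + c)) (tj (c * n ^ d + c)) td)"
proof -
  let ?s = "\<lambda>m. pre E D x i bc (\<lambda>_. 0) (tv m) (tj m) td"
  have 1: "runs (tids E) (repeat c (nest d F)) (?s 0) (c * nest_time n d T) (?s (0 + c * n ^ d))"
    by (rule runs_repeat, rule runs_nest[where tv = tv and tj = tj]) (use assms in auto)
  have 2: "runs (tids E) (repeat c F) (?s (0 + c * n ^ d)) (c * T) (?s (0 + c * n ^ d + c * 1))"
    by (rule runs_repeat) (use F in simp)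
  from runs_sequence[OF 1 2] show ?thesis by (simp add: poly_repeat_def)
qed

lemma poly_bounded_nest_time: "poly_bounded (\<lambda>n. nest_time n k T)"
  by (induction k) (auto intro!: poly_bounded_intros)

abbreviation stay :: "(tid \<Rightarrow> nat) \<Rightarrow> nat \<Rightarrow> nat \<times> move" where
  "stay \<equiv> mv Stay"

text \<open>Each input bit goes to the \<open>Base\<close> tapes and, preceded by True (symbol 2),
  to the \<open>Ini\<close> tapes. This is \<open>enc_list enc_bool\<close> up to the closing False,
  which \<open>rewind_input\<close> adds.\<close>

definition copy_input :: "tid fragment" where
  "copy_input = while_do (\<lambda>r. r In \<noteq> 0)
     (sequence (perform (prepare stay (\<lambda>b r s. (r In, Right)) stay (put 2 Right) stay))
       (perform (prepare (mv Right) (\<lambda>b. stay) stay (\<lambda>r s. (r In, Right)) stay)))"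

definition rewind_input :: "tid fragment" where
  "rewind_input =
     sequence (perform (prepare (mv Left) (\<lambda>b. mv Left) stay (put 1 Right) stay))
       (sequence (while_do (\<lambda>r. r In \<noteq> 0) (perform (prepare (mv Left) (\<lambda>b. mv Left) stay stay stay)))
         (perform (prepare (mv Right) (\<lambda>b. mv Right) stay stay stay)))"

text \<open>The heads stand behind the last cell written. The last cell of each ruler is overwritten
  by the end mark before the way back. As the tapes of a kind agree, looking at variable 0 is
  enough.\<close>

definition finish_rulers :: "tid fragment" where
  "finish_rulers =
     sequence (perform (prepare stay (\<lambda>b. stay) (mv Left) (mv Left) stay))
     (sequence (perform (prepare stay (\<lambda>b. stay) (put 4 Left) stay stay))
     (sequence (while_do (\<lambda>r. r (Var 0) \<noteq> 0) (perform (prepare stay (\<lambda>b. stay) (mv Left) stay stay)))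
     (sequence (while_do (\<lambda>r. r (Ini 0) \<noteq> 0) (perform (prepare stay (\<lambda>b. stay) stay (mv Left) stay)))
       (perform (prepare stay (\<lambda>b. stay) (mv Right) (mv Right) stay)))))"

text \<open>\<open>c\<close> and \<open>d\<close> determine the number of guessed cells,
  \<open>C\<close> and \<open>e\<close> the loop range. The first two actions write
  \<open>marks\<close> on the difference tapes.\<close>

definition preparation :: "nat \<Rightarrow> nat \<Rightarrow> nat \<Rightarrow> nat \<Rightarrow> tid fragment" where
  "preparation c d C e =
     sequence (perform (prepare stay (\<lambda>b. stay) stay stay (put 1 Right)))
     (sequence (perform (prepare stay (\<lambda>b. stay) stay stay (put 2 Left)))
     (sequence copy_input
     (sequence rewind_input
     (sequence (poly_repeat c d (perform (prepare stay (\<lambda>b. stay) stay (put 3 Right) stay)))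
     (sequence (poly_repeat C e (perform (prepare stay (\<lambda>b. stay) (put 3 Right) stay stay)))
       finish_rulers)))))"

lemma enc_list_snoc:
  "enc_list enc_bool x = concat (map (\<lambda>b. [True, b]) x) @ [False]"
  by (simp add: enc_list_def enc_bool_def)

lemma length_pairs: "length (concat (map (\<lambda>b. [True, b]) x)) = 2 * length x"
  by (induction x) auto

lemma inscribe_at: "i < length x \<Longrightarrow> inscribe x (int i) = sym (x ! i)"
  by (simp add: inscribe_def)

lemma inscribe_nonblank: "inscribe x j \<noteq> 0 \<longleftrightarrow> 0 \<le> j \<and> j < int (length x)"
  by (simp add: inscribe_def)

lemma act_read: "act (fst t (snd t), d) t = (fst t, snd t + head_shift d)"
  by (cases t) simp

lemma runs_copy_input:
  fixes x td E D
  defines "s \<equiv> \<lambda>i. pre E D x (int i) (inscribe (take i x)) (\<lambda>_. int i) (inscribe [], 0)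
      (inscribe (concat (map (\<lambda>b. [True, b]) (take i x))), 2 * int i) td"
  shows "runs (tids E) copy_input (s 0) (length x * 3 + 1) (s (length x))"
proof -
  have "runs (tids E) copy_input (s 0) (length x * Suc (Suc 0 + Suc 0) + 1) (s (length x))"
    unfolding copy_input_def
  proof (rule runs_while)
    show "view (tids E) (s i) In \<noteq> 0" if "i < length x" for i
      using that by (simp add: s_def inscribe_def)
    show "\<not> view (tids E) (s (length x)) In \<noteq> 0"
      by (simp add: s_def inscribe_def)
    fix i
    assume i: "i < length x"
    let ?w = "concat (map (\<lambda>b. [True, b]) (take i x))"
    have t: "take (Suc i) x = take i x @ [x ! i]" using i by (rule take_Suc_conv_app_nth)
    have l: "length ?w = 2 * i" using i by (simp only: length_pairs) simp
    let ?m = "pre E D x (int i) (inscribe (take (Suc i) x)) (\<lambda>_. int (Suc i)) (inscribe [], 0)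
      (inscribe (?w @ [True]), 2 * int i + 1) td"
    have "runs (tids E) (perform (prepare stay (\<lambda>b r s. (r In, Right)) stay (put 2 Right) stay)) (s i) (Suc 0) ?m"
      unfolding s_def
    proof (rule runs_prepare[OF refl])
      show "act (view (tids E) (pre E D x (int i) (inscribe (take i x)) (\<lambda>_. int i) (inscribe [], 0)
        (inscribe ?w, 2 * int i) td) In, Right) (inscribe (take i x), int i) =
        (inscribe (take (Suc i) x), int (Suc i))"
        using inscribe_snoc[of "take i x" "x ! i"] i by (simp add: t inscribe_at min_def)
      show "act (2, Right) (inscribe ?w, 2 * int i) = (inscribe (?w @ [True]), 2 * int i + 1)"
        using inscribe_snoc[of ?w True] l by simp
    qed (auto simp: act_read read_tape_def)
    moreover have "runs (tids E) (perform (prepare (mv Right) (\<lambda>b. stay) stay (\<lambda>r s. (r In, Right)) stay)) ?m (Suc 0) (s (Suc i))"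
      unfolding s_def
    proof (rule runs_prepare[OF refl])
      show "act (view (tids E) ?m In, Right) (inscribe (?w @ [True]), 2 * int i + 1) =
        (inscribe (concat (map (\<lambda>b. [True, b]) (take (Suc i) x))), 2 * int (Suc i))"
        using inscribe_snoc[of "?w @ [True]" "x ! i"] i l
        by (simp add: t inscribe_at add.commute del: append_assoc) (simp add: t)
    qed (auto simp: act_read read_tape_def)
    ultimately show "runs (tids E)
      (sequence (perform (prepare stay (\<lambda>b r s. (r In, Right)) stay (put 2 Right) stay))
       (perform (prepare (mv Right) (\<lambda>b. stay) stay (\<lambda>r s. (r In, Right)) stay)))
      (s i) (Suc 0 + Suc 0) (s (Suc i))"
      by (rule runs_sequence)
  qed
  then show ?thesis by (simp add: numeral_3_eq_3)
qed

lemma runs_rewind_input: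
  fixes x
  defines "n \<equiv> length x"
  shows "runs (tids E) rewind_input
    (pre E D x (int n) (inscribe x) (\<lambda>_. int n) tv
      (inscribe (concat (map (\<lambda>b. [True, b]) x)), 2 * int n) td) (n * 2 + 3)
    (pre E D x 0 (inscribe x) (\<lambda>_. 0) tv (guess_tape 0 (enc_list enc_bool x), int (length (enc_list enc_bool x))) td)"
proof -
  let ?w = "concat (map (\<lambda>b. [True, b]) x)"
  let ?t = "(guess_tape 0 (enc_list enc_bool x), int (length (enc_list enc_bool x)))"
  define s where "s i = pre E D x (int n - 1 - int i) (inscribe x) (\<lambda>_. int n - 1 - int i) tv ?t td" for i
  have g: "guess_tape 0 w = inscribe w" for w
    by (rule ext) (simp add: guess_tape_def inscribe_def)
  have "runs (tids E) (perform (prepare (mv Left) (\<lambda>b. mv Left) stay (put 1 Right) stay))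
    (pre E D x (int n) (inscribe x) (\<lambda>_. int n) tv (inscribe ?w, 2 * int n) td) (Suc 0) (s 0)"
    unfolding s_def
  proof (rule runs_prepare[OF refl])
    show "act (1, Right) (inscribe ?w, 2 * int n) = ?t"
      using inscribe_snoc[of ?w False] by (simp add: g enc_list_snoc length_pairs n_def)
  qed (auto simp: act_read read_tape_def)
  moreover have "runs (tids E) (while_do (\<lambda>r. r In \<noteq> 0)
      (perform (prepare (mv Left) (\<lambda>b. mv Left) stay stay stay))) (s 0) (n * Suc (Suc 0) + 1) (s n)"
  proof (rule runs_while)
    show "view (tids E) (s i) In \<noteq> 0" if "i < n" for i
      using that by (simp add: s_def inscribe_def n_def)
    show "\<not> view (tids E) (s n) In \<noteq> 0"
      by (simp add: s_def inscribe_def n_def)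
    show "runs (tids E) (perform (prepare (mv Left) (\<lambda>b. mv Left) stay stay stay)) (s i) (Suc 0) (s (Suc i))" for i
      unfolding s_def by (rule runs_prepare[OF refl]) (auto simp: act_read read_tape_def)
  qed
  moreover have "runs (tids E) (perform (prepare (mv Right) (\<lambda>b. mv Right) stay stay stay)) (s n) (Suc 0)
    (pre E D x 0 (inscribe x) (\<lambda>_. 0) tv ?t td)"
    unfolding s_def by (rule runs_prepare[OF refl]) (auto simp: act_read read_tape_def)
  ultimately have "runs (tids E) rewind_input
    (pre E D x (int n) (inscribe x) (\<lambda>_. int n) tv (inscribe ?w, 2 * int n) td)
    (Suc 0 + ((n * Suc (Suc 0) + 1) + Suc 0))
    (pre E D x 0 (inscribe x) (\<lambda>_. 0) tv ?t td)"
    unfolding rewind_input_def by (blast intro: runs_sequence)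
  then show ?thesis by (rule runs_mono) simp
qed

lemma guess_tape_Suc:
  "(guess_tape m w)(int (length w) + int m := 3) = guess_tape (Suc m) w"
  by (rule ext) (auto simp: guess_tape_def)

lemma runs_finish_rulers:
  assumes "N > 0" and "length w > 0"
  shows "runs (tids E) finish_rulers
    (pre E D x i bc bp (guess_tape N [], int N) (guess_tape B w, int (length w + B)) td)
    (N * 2 + (length w + B) * 2 + 10)
    (pre E D x i bc bp (ruler N, 0) (guess_tape B w, 0) td)"
proof -
  let ?m = "length w + B"
  \<comment> \<open>Writing the end mark at \<open>N - 1\<close> leaves the head at
    \<open>N - 2\<close>, hence \<open>N - 1\<close> rounds back to cell -1.\<close>
  define s where "s l = pre E D x i bc bp (ruler N, int N - 2 - int l) (guess_tape B w, int ?m - 1) td" for l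
  define z where "z l = pre E D x i bc bp (ruler N, - 1) (guess_tape B w, int ?m - 1 - int l) td" for l
  have r: "(guess_tape N [])(int N - 1 := 4) = ruler N"
    using assms by (auto simp: guess_tape_def ruler_def fun_eq_iff)
  have s1: "runs (tids E) (perform (prepare stay (\<lambda>b. stay) (mv Left) (mv Left) stay))
    (pre E D x i bc bp (guess_tape N [], int N) (guess_tape B w, int ?m) td) (Suc 0)
    (pre E D x i bc bp (guess_tape N [], int N - 1) (guess_tape B w, int ?m - 1) td)"
    by (rule runs_prepare[OF refl]) (auto simp: act_read read_tape_def)
  have s2: "runs (tids E) (perform (prepare stay (\<lambda>b. stay) (put 4 Left) stay stay))
    (pre E D x i bc bp (guess_tape N [], int N - 1) (guess_tape B w, int ?m - 1) td) (Suc 0) (s 0)"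
    unfolding s_def by (rule runs_prepare[OF refl]) (auto simp: act_read read_tape_def r)
  have s3: "runs (tids E) (while_do (\<lambda>r. r (Var 0) \<noteq> 0) (perform (prepare stay (\<lambda>b. stay) (mv Left) stay stay)))
    (s 0) ((N - 1) * Suc (Suc 0) + 1) (s (N - 1))"
  proof (rule runs_while)
    show "view (tids E) (s i) (Var 0) \<noteq> 0" if "i < N - 1" for i
      using that by (simp add: s_def read_tape_def ruler_def)
    show "\<not> view (tids E) (s (N - 1)) (Var 0) \<noteq> 0"
      using assms by (simp add: s_def read_tape_def ruler_def)
    show "runs (tids E) (perform (prepare stay (\<lambda>b. stay) (mv Left) stay stay)) (s i) (Suc 0) (s (Suc i))" for i
      unfolding s_def by (rule runs_prepare[OF refl]) (auto simp: act_read read_tape_def)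
  qed
  have sz: "s (N - 1) = z 0"
    using assms by (simp add: s_def z_def)
  have s4: "runs (tids E) (while_do (\<lambda>r. r (Ini 0) \<noteq> 0) (perform (prepare stay (\<lambda>b. stay) stay (mv Left) stay)))
    (z 0) (?m * Suc (Suc 0) + 1) (z ?m)"
  proof (rule runs_while)
    show "view (tids E) (z l) (Ini 0) \<noteq> 0" if "l < ?m" for l
      using that by (simp add: z_def read_tape_def guess_tape_def)
    show "\<not> view (tids E) (z ?m) (Ini 0) \<noteq> 0"
      by (simp add: z_def read_tape_def guess_tape_def)
    show "runs (tids E) (perform (prepare stay (\<lambda>b. stay) stay (mv Left) stay)) (z l) (Suc 0) (z (Suc l))" for l
      unfolding z_def by (rule runs_prepare[OF refl]) (auto simp: act_read read_tape_def)
  qed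
  have s5: "runs (tids E) (perform (prepare stay (\<lambda>b. stay) (mv Right) (mv Right) stay)) (z ?m) (Suc 0)
    (pre E D x i bc bp (ruler N, 0) (guess_tape B w, 0) td)"
    unfolding z_def by (rule runs_prepare[OF refl]) (auto simp: act_read read_tape_def)
  show ?thesis
    unfolding finish_rulers_def
    by (rule runs_mono[OF runs_sequence[OF s1 runs_sequence[OF s2 runs_sequence[OF s3[unfolded sz]
        runs_sequence[OF s4 s5]]]]]) (simp add: algebra_simps)
qed

lemma runs_preparation:
  fixes x
  defines "n \<equiv> length x" and "w \<equiv> enc_list enc_bool x"
  assumes "d \<le> E" and "e \<le> E" and "C > 0"
    and N: "N = C * n ^ e + C" and B: "B = c * n ^ d + c"
  shows "runs (tids E) (preparation c d C e)
    (pre E D x 0 (inscribe []) (\<lambda>_. 0) (inscribe [], 0) (inscribe [], 0) (inscribe [], 0))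
    (2 + (n * 3 + 1) + (n * 2 + 3) + (c * nest_time n d 1 + c) + (C * nest_time n e 1 + C) +
      (N * 2 + (length w + B) * 2 + 10))
    (pre E D x 0 (inscribe x) (\<lambda>_. 0) (ruler N, 0) (guess_tape B w, 0) (marks, 0))"
proof -
  have g: "guess_tape 0 [] = inscribe []"
    by (rule ext) (simp add: guess_tape_def inscribe_def)
  have "(inscribe [])(0 := 1, 1 := 2) = marks"
    by (auto simp: inscribe_def marks_def fun_eq_iff)
  then have s2: "runs (tids E) (perform (prepare stay (\<lambda>b. stay) stay stay (put 2 Left)))
    (pre E D x 0 (inscribe []) (\<lambda>_. 0) (inscribe [], 0) (inscribe [], 0) ((inscribe [])(0 := 1), 1)) (Suc 0)
    (pre E D x 0 (inscribe []) (\<lambda>_. 0) (inscribe [], 0) (inscribe [], 0) (marks, 0))"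
    by (intro runs_prepare[OF refl]) (auto simp: act_read read_tape_def)
  have s1: "runs (tids E) (perform (prepare stay (\<lambda>b. stay) stay stay (put 1 Right)))
    (pre E D x 0 (inscribe []) (\<lambda>_. 0) (inscribe [], 0) (inscribe [], 0) (inscribe [], 0)) (Suc 0)
    (pre E D x 0 (inscribe []) (\<lambda>_. 0) (inscribe [], 0) (inscribe [], 0) ((inscribe [])(0 := 1), 1))"
    by (intro runs_prepare[OF refl]) (auto simp: act_read read_tape_def)
  have s3: "runs (tids E) copy_input
    (pre E D x 0 (inscribe []) (\<lambda>_. 0) (inscribe [], 0) (inscribe [], 0) (marks, 0)) (n * 3 + 1)
    (pre E D x (int n) (inscribe x) (\<lambda>_. int n) (inscribe [], 0)
      (inscribe (concat (map (\<lambda>b. [True, b]) x)), 2 * int n) (marks, 0))"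
    using runs_copy_input[of E D x "(marks, 0)"] by (simp add: n_def)
  have s4: "runs (tids E) rewind_input
    (pre E D x (int n) (inscribe x) (\<lambda>_. int n) (inscribe [], 0)
      (inscribe (concat (map (\<lambda>b. [True, b]) x)), 2 * int n) (marks, 0)) (n * 2 + 3)
    (pre E D x 0 (inscribe x) (\<lambda>_. 0) (inscribe [], 0) (guess_tape 0 w, int (length w)) (marks, 0))"
    unfolding n_def w_def by (rule runs_rewind_input)
  have f5: "runs (tids E) (perform (prepare stay (\<lambda>b. stay) stay (put 3 Right) stay))
    (pre E D x 0 (inscribe x) bp (inscribe [], 0) (guess_tape m w, int (length w + m)) (marks, 0)) 1
    (pre E D x 0 (inscribe x) bp (inscribe [], 0) (guess_tape (Suc m) w, int (length w + (Suc m))) (marks, 0))" for m bp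
    unfolding One_nat_def by (rule runs_prepare[OF refl]) (auto simp: act_read read_tape_def guess_tape_Suc )
  have s5: "runs (tids E) (poly_repeat c d (perform (prepare stay (\<lambda>b. stay) stay (put 3 Right) stay)))
    (pre E D x 0 (inscribe x) (\<lambda>_. 0) (inscribe [], 0) (guess_tape 0 w, int (length w)) (marks, 0))
    (c * nest_time n d 1 + c)
    (pre E D x 0 (inscribe x) (\<lambda>_. 0) (inscribe [], 0) (guess_tape B w, int (length w + B)) (marks, 0))"
    using runs_poly_repeat[where tv = "\<lambda>m. (inscribe [], 0)" and tj = "\<lambda>m. (guess_tape m w, int (length w + m))", OF assms(3) inscribe_nonblank f5, of c]
    by (simp add: n_def B)
  have f6: "runs (tids E) (perform (prepare stay (\<lambda>b. stay) (put 3 Right) stay stay))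
    (pre E D x 0 (inscribe x) bp (guess_tape m [], int m) (guess_tape B w, int (length w + B)) (marks, 0)) 1
    (pre E D x 0 (inscribe x) bp (guess_tape (Suc m) [], int (Suc m)) (guess_tape B w, int (length w + B)) (marks, 0))" for m bp
    unfolding One_nat_def by (rule runs_prepare[OF refl]) (auto simp: act_read read_tape_def guess_tape_Suc guess_tape_Suc[of _ "[]", simplified])
  have s6: "runs (tids E) (poly_repeat C e (perform (prepare stay (\<lambda>b. stay) (put 3 Right) stay stay)))
    (pre E D x 0 (inscribe x) (\<lambda>_. 0) (inscribe [], 0) (guess_tape B w, int (length w + B)) (marks, 0))
    (C * nest_time n e 1 + C)
    (pre E D x 0 (inscribe x) (\<lambda>_. 0) (guess_tape N [], int N) (guess_tape B w, int (length w + B)) (marks, 0))"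
    using runs_poly_repeat[where tv = "\<lambda>m. (guess_tape m [], int m)" and tj = "\<lambda>m. (guess_tape B w, int (length w + B))", OF assms(4) inscribe_nonblank f6, of C]
    by (simp add: n_def N g)
  have s7: "runs (tids E) finish_rulers
    (pre E D x 0 (inscribe x) (\<lambda>_. 0) (guess_tape N [], int N) (guess_tape B w, int (length w + B)) (marks, 0))
    (N * 2 + (length w + B) * 2 + 10)
    (pre E D x 0 (inscribe x) (\<lambda>_. 0) (ruler N, 0) (guess_tape B w, 0) (marks, 0))"
    using assms by (intro runs_finish_rulers) (auto simp: enc_list_def)
  show ?thesis
    unfolding preparation_def
    by (rule runs_mono[OF runs_sequence[OF s1 runs_sequence[OF s2 runs_sequence[OF s3 runs_sequence[OF s4
        runs_sequence[OF s5 runs_sequence[OF s6 s7]]]]]]]) simp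
qed

lemma well_formed_prepare:
  assumes "\<And>r s. (\<forall>i. r i < 6) \<Longrightarrow> s < 6 \<Longrightarrow>
    fst (fi r s) < 6 \<and> (\<forall>b. fst (fb b r s) < 6) \<and> fst (fv r s) < 6 \<and> fst (fj r s) < 6 \<and> fst (fd r s) < 6"
  shows "well_formed (perform (prepare fi fb fv fj fd))"
  by (rule well_formed_perform, rename_tac r i, case_tac i) (use assms in auto)

lemma well_formed_poly_repeat:
  assumes "well_formed F"
  shows "well_formed (poly_repeat c d F)"
proof -
  have "well_formed (base_move b m)" for b m
    by (rule well_formed_prepare) auto
  then have "well_formed (nest k F)" for k
    by (induction k) (use assms in \<open>simp_all add: for_base_def\<close>)
  then have "well_formed (repeat l (nest k F))" for k l
    by (induction l) auto
  from this[of c d] this[of c 0] show ?thesis by (simp add: poly_repeat_def)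
qed

lemma well_formed_preparation: "well_formed (preparation c d C e)"
  unfolding preparation_def copy_input_def rewind_input_def finish_rulers_def
  by (intro well_formed_sequence well_formed_while_do well_formed_poly_repeat well_formed_prepare) auto

text \<open>This is the interface to the machine model: afterwards, only a program and a polynomial
  loop range have to be given. The program may inspect the encoded input padded with guessed cells,
  which is the initial tape of a verifier whose certificate is unknown.\<close>

theorem polytime_emission:
  assumes p: "admissible p" and C: "C > 0"
  shows "polytime_function (\<lambda>x. emission (C * length x ^ e + C)
    (guess_tape (c * length x ^ d + c) (enc_list enc_bool x)) p (\<lambda>_. 0))"
proof -
  \<comment> \<open>Enough counters for both nests of loops, of depths \<open>d\<close> and
    \<open>e\<close>.\<close>
  define E where "E = max d e"
  let ?F = "sequence (preparation c d C e) (compile p)"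
  let ?M = "machine (tids E) ?F"
  let ?N = "\<lambda>n. C * n ^ e + C" and ?B = "\<lambda>n. c * n ^ d + c"
  define T where "T n = (2 + (n * 3 + 1) + (n * 2 + 3) + (c * nest_time n d 1 + c) + (C * nest_time n e 1 + C) +
      (?N n * 2 + ((2 * n + 1) + ?B n) * 2 + 10)) + duration (?N n) p" for n
  have "poly_bounded T"
    unfolding T_def
    by (intro poly_bounded_intros poly_bounded_nest_time poly_bounded_duration)
  then obtain a b where T: "T n \<le> a * n ^ b + a" for n by (auto simp: poly_bounded_def)
  have "\<exists>t \<le> a * length x ^ b + a. halts_with ?M ((step ?M ^^ t) (initial ?M x))
     (emission (?N (length x)) (guess_tape (?B (length x)) (enc_list enc_bool x)) p (\<lambda>_. 0))" for x
  proof -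
    let ?n = "length x"
    let ?J = "guess_tape (?B ?n) (enc_list enc_bool x)"
    let ?z = "(inscribe [], 0) :: tape"
    let ?conf = "conf (?N ?n) ?J (\<lambda>_. (inscribe x, 0)) (\<lambda>_. 0)"
    \<comment> \<open>Taking the target configuration itself as default makes both descriptions
      agree outside the tape list.\<close>
    define D where "D = ?conf []"
    have l: "length (enc_list enc_bool x) = 2 * ?n + 1"
      by (simp only: enc_list_snoc length_append length_pairs) simp
    have "runs (tids E) (preparation c d C e) (pre E D x 0 (inscribe []) (\<lambda>_. 0) ?z ?z ?z)
      (2 + (?n * 3 + 1) + (?n * 2 + 3) + (c * nest_time ?n d 1 + c) + (C * nest_time ?n e 1 + C) +
      (?N ?n * 2 + ((2 * ?n + 1) + ?B ?n) * 2 + 10))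
      (pre E D x 0 (inscribe x) (\<lambda>_. 0) (ruler (?N ?n), 0) (?J, 0) (marks, 0))"
      using runs_preparation[of d E e C "?N ?n" x "?B ?n" c D] C by (simp only: l) (simp add: E_def)
    moreover have "pre E D x 0 (inscribe x) (\<lambda>_. 0) (ruler (?N ?n), 0) (?J, 0) (marks, 0) = ?conf []"
    proof
      fix t
      show "pre E D x 0 (inscribe x) (\<lambda>_. 0) (ruler (?N ?n), 0) (?J, 0) (marks, 0) t = ?conf [] t"
        by (cases t) (auto simp: pre_def D_def)
    qed
    moreover have "runs (tids E) (compile p) (?conf []) (duration (?N ?n) p)
      (?conf (emission (?N ?n) ?J p (\<lambda>_. 0)))"
      using runs_compile[OF p, of "\<lambda>_. 0" "?N ?n" E ?J _ "[]"] C by simp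
    ultimately have "runs (tids E) ?F (pre E D x 0 (inscribe []) (\<lambda>_. 0) ?z ?z ?z) (T ?n)
      (?conf (emission (?N ?n) ?J p (\<lambda>_. 0)))"
      unfolding T_def by (auto intro: runs_sequence)
    then obtain t where t: "t \<le> T ?n" and path: "path (tids E) (fst ?F) (snd ?F)
      (0, pre E D x 0 (inscribe []) (\<lambda>_. 0) ?z ?z ?z) t (fst ?F, ?conf (emission (?N ?n) ?J p (\<lambda>_. 0)))"
      unfolding runs_def by blast
    have "initial ?M x = (0, map (pre E D x 0 (inscribe []) (\<lambda>_. 0) ?z ?z ?z) (tids E))"
    proof -
      define L where "L = tl (tids E)"
      have L: "tids E = In # L" "In \<notin> set L" by (auto simp: L_def tids_def)
      have "map (pre E D x 0 (inscribe []) (\<lambda>_. 0) ?z ?z ?z) L = map (\<lambda>_. ?z) L"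
      proof (rule map_cong[OF refl])
        fix t
        assume "t \<in> set L"
        with L have "t \<noteq> In" "t \<in> set (tids E)" by auto
        then show "pre E D x 0 (inscribe []) (\<lambda>_. 0) ?z ?z ?z t = ?z"
          by (cases t) (simp_all add: pre_def)
      qed
      then show ?thesis
        using L(1) by (simp add: initial_def machine_def map_replicate_const pre_def)
    qed
    moreover have "last (map (?conf y) (tids E)) = (inscribe y, int (length y))" for y
      by (simp add: tids_def)
    ultimately have "halts_with ?M ((step ?M ^^ t) (initial ?M x)) (emission (?N ?n) ?J p (\<lambda>_. 0))"
      using machine_path[OF path] by (simp add: halts_with_def machine_def del: step.simps)
    with t T[of ?n] show ?thesis by (meson order_trans)
  qed
  moreover have "valid_tm ?M"
    by (rule valid_machine) (auto simp: tids_def well_formed_preparation)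
  ultimately show ?thesis unfolding polytime_function_def by blast
qed

subsection \<open>Hitting sets as 2-diverse databases\<close>

lemma less_2_iff: "(i :: nat) < j \<and> j < 2 \<longleftrightarrow> i = 0 \<and> j = 1"
  by linarith

lemma diverse_2D:
  assumes "diverse 2 D" and "i < length (rows D)"
  obtains i' where "i' < length (rows D)" "\<And>q. q \<in> quasi D \<Longrightarrow> rows D ! i ! q = rows D ! i' ! q"
    "\<And>s. s \<in> sensitive D \<Longrightarrow> rows D ! i ! s \<noteq> rows D ! i' ! s"
proof -
  from assms(1)[unfolded diverse_def, THEN spec, THEN mp, OF assms(2)]
  obtain u :: "nat \<Rightarrow> nat" where "u 0 = i \<and> (\<forall>i<2. u i < length (rows D)) \<and> inj_on u {..<2} \<and>
      (\<forall>q\<in>quasi D. \<forall>i j. i < j \<and> j < 2 \<longrightarrow> rows D ! u i ! q = rows D ! u j ! q) \<and>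
      (\<forall>s\<in>sensitive D. \<forall>i j. i < j \<and> j < 2 \<longrightarrow> rows D ! u i ! s \<noteq> rows D ! u j ! s)"
    by (rule exE)
  then show ?thesis by (intro that[of "u 1"]) (auto simp: less_2_iff)
qed

text \<open>It suffices to find a partner among the values of the rows: differing in some sensitive
  attribute, it has another index.\<close>

lemma diverse_2I:
  assumes "sensitive D \<noteq> {}"
    and "\<And>r. r \<in> set (rows D) \<Longrightarrow> \<exists>r'\<in>set (rows D).
      (\<forall>q\<in>quasi D. r ! q = r' ! q) \<and> (\<forall>s\<in>sensitive D. r ! s \<noteq> r' ! s)"
  shows "diverse 2 D"
  unfolding diverse_def less_2_iff
proof (intro allI impI)
  fix i
  assume i: "i < length (rows D)"
  with assms(2)[of "rows D ! i"] obtain i' where i': "i' < length (rows D)"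
    "\<forall>q\<in>quasi D. rows D ! i ! q = rows D ! i' ! q" "\<forall>s\<in>sensitive D. rows D ! i ! s \<noteq> rows D ! i' ! s"
    by (metis in_set_conv_nth nth_mem)
  let ?u = "\<lambda>k :: nat. if k = 0 then i else i'"
  from i' assms(1) have "i \<noteq> i'" by auto
  then have "inj_on ?u {..<2}" by (auto simp: inj_on_def lessThan_nat_numeral)
  with i i' show "\<exists>u. u 0 = i \<and> (\<forall>i<2::nat. u i < length (rows D)) \<and> inj_on u {..<2} \<and>
      (\<forall>q\<in>quasi D. \<forall>i j. i = 0 \<and> j = 1 \<longrightarrow> rows D ! u i ! q = rows D ! u j ! q) \<and>
      (\<forall>s\<in>sensitive D. \<forall>i j. i = 0 \<and> j = 1 \<longrightarrow> rows D ! u i ! s \<noteq> rows D ! u j ! s)"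
    by (intro exI[of _ ?u]) auto
qed

section \<open>Databases built from instances of hitting set\<close>

definition labelled :: "nat \<Rightarrow> 'v list list \<Rightarrow> 'v database" where
  "labelled K R = \<lparr>labels = replicate K Quasi @ replicate 3 Sensitive, rows = R\<rparr>"

lemma labelled_simps [simp]:
  "labels (labelled K R) = replicate K Quasi @ replicate 3 Sensitive" "rows (labelled K R) = R"
  by (simp_all add: labelled_def)

lemma quasi_labelled [simp]: "quasi (labelled K R) = {..<K}"
  by (auto simp: quasi_def nth_append)

lemma sensitive_labelled [simp]: "sensitive (labelled K R) = {K..<K + 3}"
  by (auto simp: sensitive_def nth_append)

lemma stars_labelled:
  "stars (labelled K R) = (\<Sum>r\<leftarrow>R. card {j. j < K \<and> r ! j = None})"
proof -
  have "{(i, j). i < length R \<and> j < K \<and> R ! i ! j = None} =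
      Sigma {..<length R} (\<lambda>i. {j. j < K \<and> R ! i ! j = None})"
    by auto
  then have "stars (labelled K R) = (\<Sum>i<length R. card {j. j < K \<and> R ! i ! j = None})"
    by (simp add: stars_def)
  then show ?thesis by (simp add: sum_list_sum_nth atLeast0LessThan)
qed

definition unit :: "nat \<Rightarrow> nat \<Rightarrow> bool list" where
  "unit K l = map (\<lambda>j. j = l) [0..<K]"

text \<open>\<open>K\<close> is the number of columns and \<open>N\<close> the size of the hitting
  set. The sets to be hit are given by their characteristic vectors \<open>es\<close>; the copies of
  the unit vectors are called anchors below, the rows with sensitive values True red.\<close>

definition hitting_rows :: "nat \<Rightarrow> nat \<Rightarrow> nat \<Rightarrow> bool list list \<Rightarrow> bool list list" where
  "hitting_rows K N \<mu> es =
     replicate (N + 1) (replicate K True @ replicate 3 True) @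
     concat (replicate \<mu> (map (\<lambda>l. unit K l @ replicate 3 False) [0..<K])) @
     map (\<lambda>e. e @ replicate 3 False) es"

lemma length_concat_replicate [simp]: "length (concat (replicate m xs)) = m * length xs"
  by (induction m) auto

lemma nth_concat_replicate:
  "i < m * length xs \<Longrightarrow> concat (replicate m xs) ! i = xs ! (i mod length xs)"
proof (induction m arbitrary: i)
  case (Suc m)
  show ?case
  proof (cases "i < length xs")
    case False
    then have "(i - length xs) mod length xs = i mod length xs"
      by (metis le_mod_geq not_le)
    with False Suc show ?thesis by (auto simp: nth_append)
  qed (auto simp: nth_append)
qed simp

lemma length_hitting_rows: "length (hitting_rows K N \<mu> es) = N + 1 + \<mu> * K + length es"
  by (simp add: hitting_rows_def)

lemma sum_list_concat_replicate:
  "(\<Sum>x\<leftarrow>concat (replicate m xs). f x) = m * (\<Sum>x\<leftarrow>xs. f x :: nat)"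
  by (induction m) auto

lemma list_all2_concat_replicate:
  "list_all2 P xs ys \<Longrightarrow> list_all2 P (concat (replicate m xs)) (concat (replicate m ys))"
  by (induction m) (auto intro: list_all2_appendI)

lemma list_all2_map_map:
  "(\<And>x. x \<in> set xs \<Longrightarrow> P (f x) (g x)) \<Longrightarrow> list_all2 P (map f xs) (map g xs)"
  by (auto simp: list.rel_map intro: list.rel_refl_strong)

lemma suppression_labelledI:
  assumes "list_all2 (\<lambda>r r'. length r' = K + 3 \<and>
    (\<forall>j<K + 3. r' ! j = Some (r ! j) \<or> j < K \<and> r' ! j = None)) R R'"
  shows "suppression (labelled K R) (labelled K R')"
  using assms by (auto simp: suppression_def valid_database_def list_all2_conv_all_nth in_set_conv_nth)

text \<open>The equation for \<open>k\<close> counts entries: all of them, minus one kept in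
  \<open>N\<close> red rows, in the \<mu> copies of each of \<open>N\<close> unit vectors, and in
  each row of \<open>es\<close>. Adding the kept entries avoids subtraction on natural
  numbers.\<close>

lemma hitting_set_imp_diverse:
  assumes K: "N + 1 < K" and \<mu>: "\<mu> > 0" and es: "\<And>e. e \<in> set es \<Longrightarrow> length e = K"
    and S: "S \<subseteq> {..<K}" "card S = N" "\<And>e. e \<in> set es \<Longrightarrow> \<exists>j\<in>S. e ! j"
    and k: "k + (\<mu> * N + length es + N) = K * (N + 1 + \<mu> * K + length es)"
  shows "\<exists>E. suppression (labelled K (hitting_rows K N \<mu> es)) E \<and> diverse 2 E \<and> stars E \<le> k"
proof -
  define pat where "pat l = map (\<lambda>j. if j = l then Some True else None) [0..<K]" for l
  define row where "row p b = p @ replicate 3 (Some b)" for p and b :: bool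
  let ?star = "replicate K None"
  from S(3) obtain h where h: "\<And>e. e \<in> set es \<Longrightarrow> h e \<in> S \<and> e ! h e" by metis
  have fin: "finite S" using S(1) finite_subset by blast
  define sl where "sl = sorted_list_of_set S"
  have sl: "set sl = S" "length sl = N" using fin S(2) by (auto simp: sl_def)
  \<comment> \<open>The groups are the columns in \<open>S\<close> and one group of stars only. A
    unit vector joins its column if that is in \<open>S\<close>, and the stars otherwise;
    \<open>e\<close> joins the column \<open>h e\<close> by which it is hit; each group gets one red
    row.\<close>
  define R where "R = map (\<lambda>l. row (pat l) True) sl @ [row ?star True] @
     concat (replicate \<mu> (map (\<lambda>l. row (if l \<in> S then pat l else ?star) False) [0..<K])) @
     map (\<lambda>e. row (pat (h e)) False) es"
  let ?P = "\<lambda>r r'. length r' = K + 3 \<and> (\<forall>j<K + 3. r' ! j = Some (r ! j) \<or> j < K \<and> r' ! j = None)"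
  have P: "?P (v @ replicate 3 b) (row p b)"
    if "length v = K" "length p = K" "\<And>j. j < K \<Longrightarrow> p ! j = Some (v ! j) \<or> p ! j = None" for v p b
    using that by (auto simp: row_def nth_append)
  have len: "length (pat l) = K" for l by (simp add: pat_def)
  have "list_all2 ?P (hitting_rows K N \<mu> es) R"
    unfolding hitting_rows_def R_def append_assoc[symmetric]
  proof (intro list_all2_appendI list_all2_concat_replicate)
    have "list_all2 ?P (map (\<lambda>_. replicate K True @ replicate 3 True) sl) (map (\<lambda>l. row (pat l) True) sl)"
      by (rule list_all2_map_map, rule P) (auto simp: pat_def)
    then have "list_all2 ?P (replicate N (replicate K True @ replicate 3 True)) (map (\<lambda>l. row (pat l) True) sl)"
      by (simp only: map_replicate_const sl)
    moreover have "list_all2 ?P [replicate K True @ replicate 3 True] [row ?star True]"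
      by (intro list.rel_intros P) auto
    ultimately have "list_all2 ?P (replicate N (replicate K True @ replicate 3 True) @
        [replicate K True @ replicate 3 True]) (map (\<lambda>l. row (pat l) True) sl @ [row ?star True])"
      by (rule list_all2_appendI)
    then show "list_all2 ?P (replicate (N + 1) (replicate K True @ replicate 3 True))
        (map (\<lambda>l. row (pat l) True) sl @ [row ?star True])"
      by (simp add: replicate_append_same)
    show "list_all2 ?P (map (\<lambda>l. unit K l @ replicate 3 False) [0..<K])
      (map (\<lambda>l. row (if l \<in> S then pat l else ?star) False) [0..<K])"
      by (rule list_all2_map_map, rule P) (auto simp: unit_def pat_def)
    show "list_all2 ?P (map (\<lambda>e. e @ replicate 3 False) es) (map (\<lambda>e. row (pat (h e)) False) es)"
      by (rule list_all2_map_map, rule P) (use h es in \<open>auto simp: pat_def\<close>)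
  qed
  then have supp: "suppression (labelled K (hitting_rows K N \<mu> es)) (labelled K R)"
    by (rule suppression_labelledI)
  have "S \<noteq> {..<K}" using K S(2) by auto
  \<comment> \<open>The red row of stars needs a partner; an anchor of a column outside
    \<open>S\<close> provides it.\<close>
  then obtain z where z: "z < K" "z \<notin> S" using S(1) by auto
  have setR: "set R = (\<lambda>l. row (pat l) True) ` S \<union> {row ?star True} \<union>
      (\<lambda>l. row (if l \<in> S then pat l else ?star) False) ` {..<K} \<union> (\<lambda>e. row (pat (h e)) False) ` set es"
    using \<mu> by (auto simp: R_def sl)
  have pair: "(\<forall>q\<in>{..<K}. row p b ! q = row p (\<not> b) ! q) \<and> (\<forall>s\<in>{K..<K + 3}. row p b ! s \<noteq> row p (\<not> b) ! s)"
    if "length p = K" for p b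
    using that by (auto simp: row_def nth_append)
  have div: "diverse 2 (labelled K R)"
  proof (rule diverse_2I)
    fix r
    assume "r \<in> set (rows (labelled K R))"
    then obtain p b where r: "r = row p b" "length p = K" "row p (\<not> b) \<in> set R"
    proof -
      have "\<exists>p b. r = row p b \<and> length p = K \<and> row p (\<not> b) \<in> set R"
        using \<open>r \<in> set (rows (labelled K R))\<close>
        unfolding labelled_simps
      proof (subst (asm) setR, elim UnE imageE singletonE)
        fix l
        assume "r = row (pat l) True" "l \<in> S"
        moreover have "row (pat l) False \<in> set R"
          unfolding setR using \<open>l \<in> S\<close> S(1) by (intro UnI1 UnI2) auto
        ultimately show ?thesis using len by (intro exI[of _ "pat l"] exI[of _ True]) auto
      next
        assume "r = row ?star True"
        moreover have "row ?star False \<in> set R"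
          unfolding setR using z by (intro UnI1 UnI2) auto
        ultimately show ?thesis by (intro exI[of _ ?star] exI[of _ True]) auto
      next
        fix l
        assume "r = row (if l \<in> S then pat l else ?star) False" "l \<in> {..<K}"
        moreover have "row (if l \<in> S then pat l else ?star) True \<in> set R"
          unfolding setR by auto
        ultimately show ?thesis using len
          by (intro exI[of _ "if l \<in> S then pat l else ?star"] exI[of _ False]) auto
      next
        fix e
        assume "r = row (pat (h e)) False" "e \<in> set es"
        moreover have "row (pat (h e)) True \<in> set R"
          unfolding setR using h \<open>e \<in> set es\<close> by auto
        ultimately show ?thesis using len by (intro exI[of _ "pat (h e)"] exI[of _ False]) auto
      qed
      then show ?thesis using that by blast
    qed
    with pair[of p b] show "\<exists>r'\<in>set (rows (labelled K R)). (\<forall>q\<in>quasi (labelled K R). r ! q = r' ! q) \<and>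
        (\<forall>s\<in>sensitive (labelled K R). r ! s \<noteq> r' ! s)"
      by auto
  qed simp
  let ?c = "\<lambda>r. card {j. j < K \<and> r ! j = None}"
  have cpat: "?c (row (pat l) b) = K - 1" if "l < K" for l b
  proof -
    have "{j. j < K \<and> row (pat l) b ! j = None} = {..<K} - {l}"
      by (auto simp: row_def pat_def nth_append)
    then show ?thesis using that by simp
  qed
  have cstar: "?c (row ?star b) = K" for b
  proof -
    have "{j. j < K \<and> row ?star b ! j = None} = {..<K}"
      by (auto simp: row_def nth_append)
    then show ?thesis by simp
  qed
  have 1: "(\<Sum>r\<leftarrow>map (\<lambda>l. row (pat l) True) sl. ?c r) = N * (K - 1)"
  proof -
    have "(\<Sum>r\<leftarrow>map (\<lambda>l. row (pat l) True) sl. ?c r) = (\<Sum>l\<leftarrow>sl. K - 1)"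
      unfolding map_map comp_def using cpat S(1) sl(1) by (intro arg_cong[of _ _ sum_list] map_cong) auto
    then show ?thesis by (simp add: sum_list_triv sl)
  qed
  have 2: "(\<Sum>r\<leftarrow>map (\<lambda>e. row (pat (h e)) False) es. ?c r) = length es * (K - 1)"
  proof -
    have "(\<Sum>r\<leftarrow>map (\<lambda>e. row (pat (h e)) False) es. ?c r) = (\<Sum>e\<leftarrow>es. K - 1)"
      unfolding map_map comp_def using cpat S(1) h by (intro arg_cong[of _ _ sum_list] map_cong) auto
    then show ?thesis by (simp add: sum_list_triv)
  qed
  have 3: "(\<Sum>r\<leftarrow>map (\<lambda>l. row (if l \<in> S then pat l else ?star) False) [0..<K]. ?c r) + N = K * K"
  proof -
    have "(\<Sum>r\<leftarrow>map (\<lambda>l. row (if l \<in> S then pat l else ?star) False) [0..<K]. ?c r) =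
        (\<Sum>l\<leftarrow>[0..<K]. if l \<in> S then K - 1 else K)"
      unfolding map_map comp_def using cpat cstar by (intro arg_cong[of _ _ sum_list] map_cong) auto
    also have "\<dots> = (\<Sum>l<K. if l \<in> S then K - 1 else K)"
      by (simp add: interv_sum_list_conv_sum_set_nat atLeast0LessThan)
    finally have "(\<Sum>r\<leftarrow>map (\<lambda>l. row (if l \<in> S then pat l else ?star) False) [0..<K]. ?c r) + N =
        (\<Sum>l<K. if l \<in> S then K - 1 else K) + (\<Sum>l<K. if l \<in> S then 1 else 0)"
      using S(1,2) by (simp add: sum.If_cases Int_absorb1)
    also have "\<dots> = (\<Sum>l<K. K)"
      unfolding sum.distrib[symmetric] using K by (intro sum.cong) auto
    finally show ?thesis by simp
  qed
  have "stars (labelled K R) + (\<mu> * N + length es + N) = K * (N + 1 + \<mu> * K + length es)"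
  proof -
    let ?A = "\<Sum>r\<leftarrow>map (\<lambda>l. row (if l \<in> S then pat l else ?star) False) [0..<K]. ?c r"
    have "stars (labelled K R) = N * (K - 1) + K + \<mu> * ?A + length es * (K - 1)"
      unfolding stars_labelled R_def by (simp only: map_append sum_list_append sum_list_concat_replicate 1 2) (simp add: cstar)
    moreover have "\<mu> * ?A + \<mu> * N = \<mu> * (K * K)" by (simp only: distrib_left[symmetric] 3)
    moreover have "m * (K - 1) + m = m * K" for m using K by (cases K) auto
    from this[of N] this[of "length es"] have "N * (K - 1) + N = N * K" "length es * (K - 1) + length es = length es * K"
      by auto
    ultimately show ?thesis by (simp add: algebra_simps)
  qed
  with k have "stars (labelled K R) \<le> k" by linarith
  with supp div show ?thesis by blast
qed

lemma hitting_rows_nth_red: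
  "i < N + 1 \<Longrightarrow> hitting_rows K N \<mu> es ! i = replicate K True @ replicate 3 True"
  by (simp add: hitting_rows_def nth_append del: replicate_Suc)

lemma hitting_rows_nth_anchor:
  "i < \<mu> * K \<Longrightarrow> hitting_rows K N \<mu> es ! (N + 1 + i) = unit K (i mod K) @ replicate 3 False"
proof -
  assume i: "i < \<mu> * K"
  then have "K > 0" by (metis gr0I less_nat_zero_code mult_0_right)
  then show ?thesis
    using i by (simp add: hitting_rows_def nth_append nth_concat_replicate del: replicate_Suc)
qed

lemma hitting_rows_nth_element:
  "u < length es \<Longrightarrow> hitting_rows K N \<mu> es ! (N + 1 + \<mu> * K + u) = es ! u @ replicate 3 False"
  by (simp add: hitting_rows_def nth_append del: replicate_Suc)

lemma sum_split_at:
  "(\<Sum>i<a + b :: nat. f i :: nat) = (\<Sum>i<a. f i) + (\<Sum>i<b. f (a + i))"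
  by (induction b) auto

text \<open>Every non-star entry of a row is shared with a row of sensitive values \<^term>\<open>True\<close>, so it
  is 1. There are only \<^term>\<open>N + 1\<close> such rows, hence at most \<^term>\<open>N + 1\<close> patterns of stars, and
  the many copies of the unit vectors force \<^term>\<open>N\<close> of these patterns to keep exactly one column.\<close>

lemma diverse_imp_hitting_set:
  fixes es :: "bool list list"
  assumes K: "N + 1 < K" and \<mu>: "\<mu> \<ge> K * (N + 1 + length es)" and es: "\<And>e. e \<in> set es \<Longrightarrow> length e = K"
    and supp: "suppression (labelled K (hitting_rows K N \<mu> es)) E" and div: "diverse 2 E"
    and cost: "stars E \<le> k"
    and k: "k + (\<mu> * N + length es + N) = K * (N + 1 + \<mu> * K + length es)"
  shows "\<exists>S. S \<subseteq> {..<K} \<and> card S = N \<and> (\<forall>e\<in>set es. \<exists>j\<in>S. e ! j)"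
proof -
  let ?D = "hitting_rows K N \<mu> es" and ?U = "length es"
  let ?R = "N + 1 + \<mu> * K + ?U"
  have lab: "labels E = replicate K Quasi @ replicate 3 Sensitive" and len: "length (rows E) = ?R"
    and ent: "\<And>i j. i < ?R \<Longrightarrow> j < K + 3 \<Longrightarrow>
      rows E ! i ! j = Some (?D ! i ! j) \<or> j < K \<and> rows E ! i ! j = None"
    using supp by (auto simp: suppression_def length_hitting_rows)
  have E: "E = labelled K (rows E)"
    using lab by (simp add: labelled_def)
  have qs: "quasi E = {..<K}" "sensitive E = {K..<K + 3}"
    by (subst E, simp)+
  define J where "J i = {j. j < K \<and> rows E ! i ! j \<noteq> None}" for i
  have J: "finite (J i)" "J i \<subseteq> {..<K}" for i by (auto simp: J_def)
  have cJ: "card (J i) \<le> K" for i using card_mono[OF _ J(2)[of i]] by simp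
  \<comment> \<open>The first sensitive column already tells red rows from the others.\<close>
  have sens: "rows E ! i ! K = Some (i < N + 1)" if i: "i < ?R" for i
  proof -
    have "rows E ! i ! K = Some (?D ! i ! K)" using ent[OF i, of K] by auto
    moreover have "?D ! i ! K = (i < N + 1)"
    proof -
      consider "i < N + 1" | i' where "i = N + 1 + i'" "i' < \<mu> * K" | u where "i = N + 1 + \<mu> * K + u" "u < ?U"
      proof (cases "i < N + 1")
        case False
        then obtain i' where i': "i = N + 1 + i'" using le_Suc_ex[of "N + 1" i] by auto
        show ?thesis
        proof (cases "i' < \<mu> * K")
          case False
          then obtain u where "i' = \<mu> * K + u" using le_Suc_ex[of "\<mu> * K" i'] by auto
          with i' i that(3) show ?thesis by auto
        qed (use i' that in auto)
      qed (use that in auto)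
      then show ?thesis
      proof cases
        case 1
        then show ?thesis using hitting_rows_nth_red[OF 1, of K \<mu> es] by (simp add: nth_append)
      next
        case 2
        then show ?thesis using hitting_rows_nth_anchor[OF 2(2), of N es]
          by (simp add: nth_append unit_def)
      next
        case 3
        then show ?thesis using hitting_rows_nth_element[OF 3(2), of K N \<mu>] es
          by (simp add: nth_append)
      qed
    qed
    ultimately show ?thesis by simp
  qed
  have red: "\<exists>r<N + 1. J r = J i \<and> (\<forall>j\<in>J i. ?D ! i ! j)" if i: "i < ?R" for i
  proof -
    have "\<exists>r<N + 1. \<forall>j<K. rows E ! r ! j = rows E ! i ! j"
    proof (cases "i < N + 1")
      case False
      obtain i' where i': "i' < length (rows E)"
        "\<And>q. q \<in> quasi E \<Longrightarrow> rows E ! i ! q = rows E ! i' ! q"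
        "\<And>s. s \<in> sensitive E \<Longrightarrow> rows E ! i ! s \<noteq> rows E ! i' ! s"
        by (rule diverse_2D[OF div, of i]) (use i len in auto)
      have "rows E ! i ! K \<noteq> rows E ! i' ! K" by (rule i'(3)) (simp add: qs)
      then have "i' < N + 1" using sens[OF i] sens[of i'] i'(1) False by (auto simp: len)
      moreover have "\<forall>j<K. rows E ! i' ! j = rows E ! i ! j" using i'(2) by (simp add: qs)
      ultimately show ?thesis by blast
    qed auto
    then obtain r where r: "r < N + 1" "\<And>j. j < K \<Longrightarrow> rows E ! r ! j = rows E ! i ! j" by blast
    have "?D ! i ! j" if j: "j \<in> J i" for j
    proof -
      have jK: "j < K" using j by (simp add: J_def)
      have "rows E ! i ! j = Some (?D ! i ! j)" using ent[OF i, of j] j by (auto simp: J_def)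
      moreover have "rows E ! r ! j = Some (?D ! r ! j)"
        using ent[of r j] r j by (auto simp: J_def)
      moreover have "?D ! r ! j" using hitting_rows_nth_red[OF r(1), of K \<mu> es] jK by (simp add: nth_append)
      ultimately show ?thesis using r(2)[OF jK] by simp
    qed
    moreover have "J r = J i" using r(2) by (auto simp: J_def)
    ultimately show ?thesis using r(1) by blast
  qed
  \<comment> \<open>The candidate for the hitting set: the columns that some red row keeps as its
    only one.\<close>
  define A where "A = {l. \<exists>i<N + 1. J i = {l}}"
  have A: "A \<subseteq> {..<K}" using J(2) unfolding A_def by blast
  then have finA: "finite A" by (rule finite_subset) simp
  have Jred: "J i = {l} \<Longrightarrow> i < ?R \<Longrightarrow> l \<in> A" for i l
    using red[of i] by (auto simp: A_def)
  \<comment> \<open>Kept entries are True, and a unit vector has only one such entry.\<close>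
  have anchor: "J (N + 1 + i) \<subseteq> {i mod K}" if "i < \<mu> * K" for i
  proof
    fix j
    assume j: "j \<in> J (N + 1 + i)"
    have "\<forall>j\<in>J (N + 1 + i). ?D ! (N + 1 + i) ! j" using red[of "N + 1 + i"] that by auto
    with j have "(unit K (i mod K) @ replicate 3 False) ! j"
      unfolding hitting_rows_nth_anchor[OF that] by blast
    then show "j \<in> {i mod K}"
      using j by (auto simp: J_def nth_append unit_def)
  qed
  have canchor: "card (J (N + 1 + i)) \<le> (if i mod K \<in> A then 1 else 0)" if "i < \<mu> * K" for i
  proof (cases "J (N + 1 + i) = {}")
    case False
    then have "J (N + 1 + i) = {i mod K}" using anchor[OF that] by auto
    moreover from Jred[OF this] have "i mod K \<in> A" using that by simp
    ultimately show ?thesis by simp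
  qed simp
  \<comment> \<open>The bound on the stars is turned into a lower bound on the number of kept
    entries.\<close>
  have total: "\<mu> * N + ?U + N \<le> (\<Sum>i<?R. card (J i))"
  proof -
    have "card {j. j < K \<and> rows E ! i ! j = None} + card (J i) = K" for i
    proof -
      have "card {j. j < K \<and> rows E ! i ! j = None} + card (J i) =
          card ({j. j < K \<and> rows E ! i ! j = None} \<union> J i)"
        by (rule card_Un_disjoint[symmetric]) (auto simp: J_def)
      also have "{j. j < K \<and> rows E ! i ! j = None} \<union> J i = {..<K}" by (auto simp: J_def)
      finally show ?thesis by simp
    qed
    then have "(\<Sum>i<?R. card {j. j < K \<and> rows E ! i ! j = None} + card (J i)) = (\<Sum>i<?R. K)"
      by (intro sum.cong) auto
    then have "(\<Sum>i<?R. card {j. j < K \<and> rows E ! i ! j = None}) + (\<Sum>i<?R. card (J i)) = ?R * K"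
      unfolding sum.distrib sum_constant card_lessThan of_nat_id .
    moreover have "stars E = (\<Sum>i<?R. card {j. j < K \<and> rows E ! i ! j = None})"
      by (subst E, subst stars_labelled) (simp add: sum_list_sum_nth len atLeast0LessThan)
    moreover have "?R * K = K * ?R" by (rule mult.commute)
    ultimately show ?thesis using cost k by linarith
  qed
  have split: "(\<Sum>i<?R. card (J i)) = (\<Sum>i<N + 1. card (J i)) + (\<Sum>i<\<mu> * K. card (J (N + 1 + i))) +
      (\<Sum>u<?U. card (J (N + 1 + \<mu> * K + u)))"
    by (simp only: sum_split_at)
  have cA: "(\<Sum>i<m * K. if i mod K \<in> A then 1 else 0) = m * card A" for m
  proof (induction m)
    case (Suc m)
    have "(\<Sum>i<Suc m * K. if i mod K \<in> A then 1 else 0) =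
        (\<Sum>i<m * K + K. if i mod K \<in> A then 1 else (0 :: nat))" by (simp add: add.commute)
    also have "\<dots> = m * card A + (\<Sum>i<K. if (m * K + i) mod K \<in> A then 1 else 0)"
      by (simp only: sum_split_at Suc)
    also have "(\<Sum>i<K. if (m * K + i) mod K \<in> A then 1 else 0) = (\<Sum>i<K. if i \<in> A then 1 else (0 :: nat))"
      by (intro sum.cong) auto
    also have "\<dots> = card A" using A by (simp add: sum.If_cases Int_absorb1)
    finally show ?case by simp
  qed simp
  have anchors: "(\<Sum>i<\<mu> * K. card (J (N + 1 + i))) \<le> \<mu> * card A"
    unfolding cA[symmetric] by (intro sum_mono canchor) simp
  \<comment> \<open>With fewer than \<open>N\<close> columns the anchors lose at least \<mu> kept
    entries, and all remaining rows together have at most \<mu> entries to make up for it. Then at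
    most \<open>\<mu> * N\<close> entries are kept, which contradicts \<open>total\<close>.\<close>
  have "card A \<ge> N"
  proof (rule ccontr)
    assume "\<not> card A \<ge> N"
    then have "card A + 1 \<le> N" by simp
    then have "\<mu> * (card A + 1) \<le> \<mu> * N" by (rule mult_le_mono2)
    moreover have "(\<Sum>i<N + 1. card (J i)) \<le> (N + 1) * K"
      using sum_bounded_above[of "{..<N + 1}" "\<lambda>i. card (J i)" K] cJ by simp
    moreover have "(\<Sum>u<?U. card (J (N + 1 + \<mu> * K + u))) \<le> ?U * K"
      using sum_bounded_above[of "{..<?U}" "\<lambda>u. card (J (N + 1 + \<mu> * K + u))" K] cJ by simp
    moreover have "K * (N + 1 + ?U) = (N + 1) * K + ?U * K" by (simp add: algebra_simps)
    moreover have "\<mu> * (card A + 1) = \<mu> * card A + \<mu>" by simp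
    ultimately have "(\<Sum>i<?R. card (J i)) \<le> \<mu> * N"
      unfolding split using anchors \<mu> by linarith
    with total \<open>card A + 1 \<le> N\<close> show False by simp
  qed
  \<comment> \<open>Otherwise no anchor consists of stars only, so every column is the single kept
    column of an anchor and lies in \<open>A\<close>; but \<open>N + 1\<close> red rows account for
    fewer than \<open>K\<close> columns.\<close>
  have "\<exists>z<N + 1. J z = {}"
  proof (rule ccontr)
    assume no: "\<not> (\<exists>z<N + 1. J z = {})"
    have "l \<in> A" if l: "l < K" for l
    proof -
      have "K * (N + 1 + ?U) > 0" using K by simp
      with \<mu> have "1 \<le> \<mu>" by linarith
      then have "1 * K \<le> \<mu> * K" by (rule mult_le_mono1)
      with l have lm: "l < \<mu> * K" by linarith
      then have "N + 1 + l < ?R" by simp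
      with red no obtain r where "r < N + 1" "J r = J (N + 1 + l)" by blast
      with no have "J (N + 1 + l) \<noteq> {}" by metis
      with anchor[OF lm] l have "J (N + 1 + l) = {l}" by auto
      then show ?thesis using Jred \<open>N + 1 + l < ?R\<close> by blast
    qed
    then have "{..<K} \<subseteq> A" by auto
    also have "A \<subseteq> (\<lambda>i. the_elem (J i)) ` {..<N + 1}"
    proof
      fix l
      assume "l \<in> A"
      then obtain i where "i < N + 1" "J i = {l}" by (auto simp: A_def)
      then show "l \<in> (\<lambda>i. the_elem (J i)) ` {..<N + 1}" by (intro image_eqI[of _ _ i]) simp_all
    qed
    finally have "{..<K} \<subseteq> (\<lambda>i. the_elem (J i)) ` {..<N + 1}" .
    from surj_card_le[OF _ this] K show False by simp
  qed
  then obtain z where z: "z < N + 1" "J z = {}" by blast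
  \<comment> \<open>At most \<open>N\<close> red rows differ from \<open>z\<close>, and they have to
    supply the columns of \<open>A\<close>, of which there are at least \<open>N\<close>. Hence each
    of them keeps exactly one column.\<close>
  define G where "G = {i. i < N + 1 \<and> (\<exists>l. J i = {l})}"
  have G: "G \<subseteq> {..<N + 1} - {z}" using z by (auto simp: G_def)
  then have finG: "finite G" by (rule finite_subset) simp
  have AG: "A \<subseteq> (\<lambda>i. the_elem (J i)) ` G"
  proof
    fix l
    assume "l \<in> A"
    then obtain i where "i < N + 1" "J i = {l}" by (auto simp: A_def)
    then show "l \<in> (\<lambda>i. the_elem (J i)) ` G" by (intro image_eqI[of _ _ i]) (auto simp: G_def)
  qed
  have "card G \<le> N" using card_mono[OF _ G] z by simp
  moreover have "card A \<le> card G" by (rule surj_card_le[OF finG AG])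
  ultimately have card: "card A = N" "card G = N" using \<open>card A \<ge> N\<close> by auto
  have G_eq: "G = {..<N + 1} - {z}"
    by (rule card_seteq[OF _ G]) (use z card in auto)
  have one: "card (J i) = (if i = z then 0 else 1)" if "i < N + 1" for i
  proof -
    from that G_eq have "i = z \<or> i \<in> G" by auto
    then show ?thesis using z G by (auto simp: G_def)
  qed
  have reds: "(\<Sum>i<N + 1. card (J i)) = N"
  proof -
    have "(\<Sum>i<N + 1. card (J i)) = card (J z) + (\<Sum>i\<in>{..<N + 1} - {z}. card (J i))"
      using z by (intro sum.remove) auto
    also have "(\<Sum>i\<in>{..<N + 1} - {z}. card (J i)) = (\<Sum>i\<in>{..<N + 1} - {z}. 1)"
      using one by (intro sum.cong) auto
    finally show ?thesis using z by simp
  qed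
  let ?e = "\<lambda>u. card (J (N + 1 + \<mu> * K + u))"
  have le1: "?e u \<le> 1" if "u < ?U" for u
  proof -
    from red[of "N + 1 + \<mu> * K + u"] that obtain r where "r < N + 1" "J r = J (N + 1 + \<mu> * K + u)" by auto
    with one[of r] show ?thesis by auto
  qed
  \<comment> \<open>The red rows keep exactly \<open>N\<close> entries and the anchors at most
    \<open>\<mu> * N\<close>, so the remaining rows keep at least one each on average. Each shares
    its pattern with a red row, so it keeps at most one.\<close>
  have U: "?U \<le> (\<Sum>u<?U. ?e u)"
    using total anchors unfolding split reds card by simp
  have eq1: "?e u = 1" if u: "u < ?U" for u
  proof (rule ccontr)
    assume "?e u \<noteq> 1"
    with le1[OF u] have "?e u < 1" by simp
    then have "(\<Sum>u<?U. ?e u) < (\<Sum>u<?U. 1)"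
      by (intro sum_strict_mono_ex1) (use le1 u in auto)
    with U show False by simp
  qed
  have "\<exists>j\<in>A. e ! j" if "e \<in> set es" for e
  proof -
    from that obtain u where u: "u < ?U" "e = es ! u" by (auto simp: in_set_conv_nth)
    let ?i = "N + 1 + \<mu> * K + u"
    have i: "?i < ?R" using u by simp
    from eq1[OF u(1)] obtain l where l: "J ?i = {l}" using card_1_singletonE by blast
    then have "l \<in> A" using Jred i by blast
    moreover have "?D ! ?i ! l" using red[OF i] l by auto
    then have "e ! l"
      using hitting_rows_nth_element[OF u(1), of K N \<mu>] es that u(2) A \<open>l \<in> A\<close> by (auto simp: nth_append)
    ultimately show ?thesis by blast
  qed
  with A card show ?thesis by blast
qed

subsection \<open>Computations as clauses\<close>

text \<open>The facts of a computation, at a time and a position: the state, the position of the head of a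
  tape, the symbol in a cell of a tape, and the symbol read on a tape (at position 0 where there is
  no position).\<close>

datatype kind = St nat | Hd nat | Ce nat nat | Rd nat nat

text \<open>In a literal, the sign and the kind are followed by the variables for time and position (or by
  their values). Variable 0 is constantly 0; in clauses, 1 and 2 are a time and the next one, and 3 and 4
  are positions. The variables 5 and 6 range over columns, and 7 to 14 only serve for repetition.\<close>

type_synonym literal = "bool \<times> kind \<times> nat \<times> nat"

definition Disj :: "test \<Rightarrow> test \<Rightarrow> test" where
  "Disj c d = Neg (Conj (Neg c) (Neg d))"

lemma holds_Disj [simp]: "holds N J (Disj c d) e \<longleftrightarrow> holds N J c e \<or> holds N J d e"
  by (simp add: Disj_def)

definition always :: test where
  "always = Eq 0 0"

lemma holds_always [simp]: "holds N J always e"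
  by (simp add: always_def)

text \<open>Positions form a cycle, in which the positions to the left of the origin come last.\<close>

definition cyclic_succ :: "nat \<Rightarrow> nat \<Rightarrow> test" where
  "cyclic_succ u v = Disj (Succ u v) (Conj (Eq u 0) (Final v))"

fun moved :: "move \<Rightarrow> nat \<Rightarrow> nat \<Rightarrow> test" where
  "moved Stay u v = Eq u v"
| "moved Right u v = cyclic_succ u v"
| "moved Left u v = cyclic_succ v u"

text \<open>The halting state idles, so that the clauses describe every time below \<open>N\<close>
  and the result can be inspected at the last one.\<close>

definition transition :: "tm \<Rightarrow> nat \<Rightarrow> nat list \<Rightarrow> nat \<times> (nat \<times> move) list" where
  "transition M q rs = (if q < states M then delta M q rs else (q, map (\<lambda>r. (r, Stay)) rs))"

text \<open>The premises of an implication, hence negated: the state and the symbols read at time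
  variable 1.\<close>

definition reading :: "nat \<Rightarrow> nat list \<Rightarrow> literal list" where
  "reading q rs = (False, St q, 1, 0) # map (\<lambda>i. (False, Rd i (rs ! i), 1, 0)) [0..<length rs]"

text \<open>In \<open>Symbol 3 3\<close>, the first 3 is a position variable and the second one the
  mark of a guessed cell. The clause with two marked cells carries blanks to the right, so that what
  is guessed is a bit string followed by blanks.\<close>

definition initial_clauses :: "tm \<Rightarrow> (test \<times> literal list) list" where
  "initial_clauses M =
     [(always, [(True, St 0, 0, 0)]),
      (Symbol 3 0, [(True, Ce 0 0, 0, 3)]),
      (Symbol 3 1, [(True, Ce 0 1, 0, 3)]),
      (Symbol 3 2, [(True, Ce 0 2, 0, 3)]),
      (Symbol 3 3, [(True, Ce 0 0, 0, 3), (True, Ce 0 1, 0, 3), (True, Ce 0 2, 0, 3)]),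
      (Conj (Symbol 3 3) (Conj (Symbol 4 3) (Succ 4 3)), [(False, Ce 0 0, 0, 3), (True, Ce 0 0, 0, 4)])] @
     map (\<lambda>i. (always, [(True, Hd i, 0, 0)])) [0..<tapes M] @
     map (\<lambda>i. (always, [(True, Ce i 0, 0, 3)])) [1..<tapes M]"

text \<open>The first clause derives the symbol read from head and cell; the second is the frame
  rule for the cells away from the head.\<close>

definition cell_clauses :: "tm \<Rightarrow> (test \<times> literal list) list" where
  "cell_clauses M = concat (map (\<lambda>(i, s).
     [(always, [(False, Hd i, 1, 3), (False, Ce i s, 1, 3), (True, Rd i s, 1, 0)]),
      (Conj (Succ 2 1) (Neg (Eq 3 4)),
        [(False, Hd i, 1, 3), (False, Ce i s, 1, 4), (True, Ce i s, 2, 4)])])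
     (List.product [0..<tapes M] [0..<symbols M]))"

definition transition_clauses :: "tm \<Rightarrow> nat \<Rightarrow> nat list \<Rightarrow> (test \<times> literal list) list" where
  "transition_clauses M q rs =
     (Succ 2 1, reading q rs @ [(True, St (fst (transition M q rs)), 2, 0)]) #
     concat (map (\<lambda>i. let a = snd (transition M q rs) ! i in
       [(Succ 2 1, reading q rs @ [(False, Hd i, 1, 3), (True, Ce i (fst a), 2, 3)]),
        (Conj (Succ 2 1) (moved (snd a) 4 3), reading q rs @ [(False, Hd i, 1, 3), (True, Hd i, 2, 4)])])
       [0..<tapes M])"

text \<open>The last clause demands acceptance: at time \<open>N - 1\<close>, cell 0 of the output
  tape must not contain the symbol 1, which stands for False.\<close>

definition clauses :: "tm \<Rightarrow> (test \<times> literal list) list" where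
  "clauses M = initial_clauses M @ cell_clauses M @
     concat (map (\<lambda>(q, rs). transition_clauses M q rs)
       (List.product [0..<Suc (states M)] (List.n_lists (tapes M) [0..<symbols M]))) @
     [(Final 1, [(False, Ce (tapes M - 1) 1, 1, 0)])]"

definition assigns :: "nat \<Rightarrow> (nat \<Rightarrow> nat) \<Rightarrow> bool" where
  "assigns N e \<longleftrightarrow> e 0 = 0 \<and> (\<forall>v. e v < N) \<and> (\<forall>v>4. e v = 0)"

text \<open>A guarded clause is a schema with one ground clause for each assignment of the variables
  that passes the guard.\<close>

definition satisfies :: "nat \<Rightarrow> (int \<Rightarrow> nat) \<Rightarrow> (kind \<Rightarrow> nat \<Rightarrow> nat \<Rightarrow> bool) \<Rightarrow> test \<times> literal list \<Rightarrow> bool" where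
  "satisfies N J \<sigma> c \<longleftrightarrow> (\<forall>e. assigns N e \<longrightarrow> holds N J (fst c) e \<longrightarrow>
     (\<exists>(b, \<kappa>, u, v)\<in>set (snd c). \<sigma> \<kappa> (e u) (e v) = b))"

text \<open>The last \<open>T + 2\<close> indices denote the cells \<open>- T - 2\<close> to -1, the
  others the cells from 0 on. A head moves at most \<open>T\<close> cells away in \<open>T\<close>
  steps, so both sides have room to spare.\<close>

definition pos :: "nat \<Rightarrow> nat \<Rightarrow> nat \<Rightarrow> int" where
  "pos N T p = (if int p < int N - int T - 2 then int p else int p - int N)"

lemma pos_inj: "p < N \<Longrightarrow> p' < N \<Longrightarrow> pos N T p = pos N T p' \<Longrightarrow> p = p'"
  by (auto simp: pos_def split: if_splits)

lemma ex_pos: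
  assumes "\<bar>h\<bar> \<le> int T + 1" and "2 * T + 5 \<le> N"
  shows "\<exists>p<N. pos N T p = h"
proof (cases "h \<ge> 0")
  case True
  then show ?thesis using assms by (intro exI[of _ "nat h"]) (auto simp: pos_def)
next
  case False
  then show ?thesis using assms by (intro exI[of _ "nat (h + int N)"]) (auto simp: pos_def)
qed

text \<open>The cyclic order of indices differs from the order of cells only between the indices
  \<open>N - T - 3\<close> and \<open>N - T - 2\<close>, and no head within distance
  \<open>T\<close> of the origin is at either of them.\<close>

lemma holds_moved:
  assumes "\<bar>pos N T (e v)\<bar> \<le> int T" and "2 * T + 5 \<le> N" and "assigns N e"
  shows "holds N J (moved d u v) e \<longleftrightarrow> pos N T (e u) = pos N T (e v) + head_shift d"
proof -
  have "e u < N" "e v < N" "e 0 = 0" using assms(3) by (auto simp: assigns_def)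
  then show ?thesis
    using assms(1,2) by (cases d) (auto simp: cyclic_succ_def pos_def split: if_splits)
qed

section \<open>The computation of a machine on a fixed word\<close>

locale computation =
  fixes M :: tm and w :: "bool list"
  assumes valid: "valid_tm M"
begin

definition config :: "nat \<Rightarrow> nat \<times> tape list" where
  "config t = (step M ^^ t) (initial M w)"

definition state :: "nat \<Rightarrow> nat" where
  "state t = fst (config t)"

definition tape :: "nat \<Rightarrow> nat \<Rightarrow> tape" where
  "tape t i = snd (config t) ! i"

definition reads :: "nat \<Rightarrow> nat list" where
  "reads t = map read_tape (snd (config t))"

lemma config_Suc: "config (Suc t) = step M (config t)"
  by (simp add: config_def)

lemma step_transition:
  assumes "length tps = tapes M" "q \<le> states M"
  shows "step M (q, tps) = (fst (transition M q (map read_tape tps)),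
    map2 act (snd (transition M q (map read_tape tps))) tps)"
proof -
  have "act (read_tape t, Stay) t = t" for t by (cases t) (simp add: read_tape_def)
  then have "map2 act (map (\<lambda>r. (r, Stay)) (map read_tape tps)) tps = tps"
    by (simp add: zip_map1 zip_same_conv_map comp_def)
  then show ?thesis by (simp add: transition_def split_def Let_def)
qed

lemma transition_valid:
  assumes "q \<le> states M" "length rs = tapes M" "\<forall>r\<in>set rs. r < symbols M"
  shows "fst (transition M q rs) \<le> states M" "length (snd (transition M q rs)) = tapes M"
    "i < tapes M \<Longrightarrow> fst (snd (transition M q rs) ! i) < symbols M"
proof -
  have "q < states M \<Longrightarrow> fst (delta M q rs) \<le> states M \<and> length (snd (delta M q rs)) = tapes M \<and>
      (\<forall>(w, d)\<in>set (snd (delta M q rs)). w < symbols M)"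
    using valid assms by (auto simp: valid_tm_def)
  then show "fst (transition M q rs) \<le> states M" "length (snd (transition M q rs)) = tapes M"
    "i < tapes M \<Longrightarrow> fst (snd (transition M q rs) ! i) < symbols M"
    using assms by (auto simp: transition_def split_def)
qed

lemma config_invariant:
  "state t \<le> states M \<and> length (snd (config t)) = tapes M \<and>
   (\<forall>i<tapes M. \<forall>p. fst (tape t i) p < symbols M)"
proof (induction t)
  case 0
  have "tapes M \<ge> 1" "symbols M \<ge> 3" using valid by (auto simp: valid_tm_def)
  moreover have "inscribe y p < 3" for y p by (simp add: inscribe_def)
  ultimately show ?case
    by (auto simp: state_def tape_def config_def initial_def nth_Cons' intro: less_le_trans)
next
  case (Suc t)
  obtain q tps where c: "config t = (q, tps)" by (cases "config t")
  with Suc have q: "q \<le> states M" and l: "length tps = tapes M"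
    and s: "\<And>i p. i < tapes M \<Longrightarrow> fst (tps ! i) p < symbols M"
    by (auto simp: state_def tape_def)
  let ?rs = "map read_tape tps"
  have rd: "read_tape (tps ! i) < symbols M" if "i < tapes M" for i
    using s[OF that] by (simp add: read_tape_def)
  then have "\<forall>tp\<in>set tps. read_tape tp < symbols M"
    by (metis in_set_conv_nth l)
  then have rs: "length ?rs = tapes M" "\<forall>r\<in>set ?rs. r < symbols M"
    using l by simp_all
  note v = transition_valid[OF q rs]
  have "config (Suc t) = (fst (transition M q ?rs), map2 act (snd (transition M q ?rs)) tps)"
    using step_transition[OF l q] by (simp add: config_Suc c)
  moreover have "fst (act a tp) p < symbols M"
    if "\<And>p. fst tp p < symbols M" "fst a < symbols M" for a tp p
    using that by (cases a; cases tp) auto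
  ultimately show ?case
    using v l s by (auto simp: state_def tape_def)
qed

lemma length_reads: "length (reads t) = tapes M"
  using config_invariant by (simp add: reads_def)

lemma nth_reads: "i < tapes M \<Longrightarrow> reads t ! i = fst (tape t i) (snd (tape t i))"
  using config_invariant[of t] by (simp add: reads_def read_tape_def tape_def)

lemma reads_less: "r \<in> set (reads t) \<Longrightarrow> r < symbols M"
  using config_invariant[of t] by (force simp: in_set_conv_nth length_reads nth_reads)

lemma state_Suc: "state (Suc t) = fst (transition M (state t) (reads t))"
  using step_transition[of "snd (config t)" "fst (config t)"] config_invariant[of t]
  by (simp add: state_def reads_def config_Suc)

lemma tape_Suc:
  assumes "i < tapes M"
  shows "tape (Suc t) i = act (snd (transition M (state t) (reads t)) ! i) (tape t i)"
proof -
  have "length (snd (transition M (state t) (reads t))) = tapes M"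
    using transition_valid(2) config_invariant length_reads reads_less by blast
  then show ?thesis
    using step_transition[of "snd (config t)" "fst (config t)"] config_invariant[of t] assms
    by (simp add: state_def reads_def config_Suc tape_def)
qed

lemma head_Suc:
  "i < tapes M \<Longrightarrow>
   snd (tape (Suc t) i) = snd (tape t i) + head_shift (snd (snd (transition M (state t) (reads t)) ! i))"
  by (cases "snd (transition M (state t) (reads t)) ! i"; cases "tape t i") (simp add: tape_Suc)

lemma cell_Suc:
  "i < tapes M \<Longrightarrow> fst (tape (Suc t) i) p = (if p = snd (tape t i)
     then fst (snd (transition M (state t) (reads t)) ! i) else fst (tape t i) p)"
  by (cases "snd (transition M (state t) (reads t)) ! i"; cases "tape t i") (simp add: tape_Suc)

lemma state_0: "state 0 = 0"
  by (simp add: state_def config_def initial_def)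

lemma tape_0: "i < tapes M \<Longrightarrow> tape 0 i = (if i = 0 then inscribe w else inscribe [], 0)"
  by (auto simp: tape_def config_def initial_def nth_Cons')

lemma halted:
  assumes "state T = states M" and "T \<le> t"
  shows "config t = config T"
  using assms(2)
proof (induction rule: dec_induct)
  case (step t)
  obtain tps where "config T = (states M, tps)" using assms(1) by (cases "config T") (auto simp: state_def)
  then show ?case using step by (simp add: config_Suc)
qed simp

lemma head_bound: "i < tapes M \<Longrightarrow> \<bar>snd (tape t i)\<bar> \<le> int t"
proof (induction t)
  case 0
  then show ?case by (simp add: tape_0)
next
  case (Suc t)
  have "\<bar>head_shift d\<bar> \<le> 1" for d by (cases d) auto
  from Suc.IH[OF Suc.prems] this[of "snd (snd (transition M (state t) (reads t)) ! i)"] show ?case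
    unfolding head_Suc[OF Suc.prems] by linarith
qed

text \<open>From time \<open>T\<close> on the configuration is frozen, so the bound holds at all
  times; this keeps the heads within the range of \<open>pos\<close> for every time below
  \<open>N\<close>.\<close>

lemma head_bound_halted:
  assumes "i < tapes M" and "state T = states M"
  shows "\<bar>snd (tape t i)\<bar> \<le> int T"
proof (cases "t \<le> T")
  case True
  then show ?thesis using head_bound[OF assms(1), of t] by simp
next
  case False
  then have "tape t i = tape T i" using halted[OF assms(2), of t] by (simp add: tape_def)
  then show ?thesis using head_bound[OF assms(1), of T] by simp
qed

end

lemma satisfiesD:
  assumes "satisfies N J \<sigma> (g, ls)" and "assigns N e" and "holds N J g e"
  shows "\<exists>(b, \<kappa>, u, v)\<in>set ls. \<sigma> \<kappa> (e u) (e v) = b"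
  using assms by (simp add: satisfies_def)

lemma satisfies_readingI:
  assumes "\<And>e. assigns N e \<Longrightarrow> holds N J g e \<Longrightarrow> \<sigma> (St q) (e 1) 0 \<Longrightarrow>
    (\<And>i. i < length rs \<Longrightarrow> \<sigma> (Rd i (rs ! i)) (e 1) 0) \<Longrightarrow> \<exists>(b, \<kappa>, u, v)\<in>set ls. \<sigma> \<kappa> (e u) (e v) = b"
  shows "satisfies N J \<sigma> (g, reading q rs @ ls)"
  unfolding satisfies_def fst_conv snd_conv
proof (intro allI impI)
  fix e
  assume e: "assigns N e" "holds N J g e"
  then have e0: "e 0 = 0" by (simp add: assigns_def)
  show "\<exists>(b, \<kappa>, u, v)\<in>set (reading q rs @ ls). \<sigma> \<kappa> (e u) (e v) = b"
  proof (cases "\<sigma> (St q) (e 1) 0 \<and> (\<forall>i<length rs. \<sigma> (Rd i (rs ! i)) (e 1) 0)")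
    case True
    then show ?thesis using assms[OF e] by auto
  next
    case False
    then consider "\<not> \<sigma> (St q) (e 1) 0" | i where "i < length rs" "\<not> \<sigma> (Rd i (rs ! i)) (e 1) 0" by blast
    then show ?thesis
    proof cases
      case 1
      then show ?thesis by (intro bexI[of _ "(False, St q, 1, 0)"]) (auto simp: e0 reading_def)
    next
      case 2
      then show ?thesis by (intro bexI[of _ "(False, Rd i (rs ! i), 1, 0)"]) (auto simp: e0 reading_def)
    qed
  qed
qed

lemma satisfies_readingD:
  assumes "satisfies N J \<sigma> (g, reading q rs @ ls)" and "assigns N e" and "holds N J g e"
    and "\<sigma> (St q) (e 1) 0" and "\<And>i. i < length rs \<Longrightarrow> \<sigma> (Rd i (rs ! i)) (e 1) 0"
  shows "\<exists>(b, \<kappa>, u, v)\<in>set ls. \<sigma> \<kappa> (e u) (e v) = b"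
proof -
  from satisfiesD[OF assms(1-3)] obtain b \<kappa> u v
    where l: "(b, \<kappa>, u, v) \<in> set (reading q rs @ ls)" "\<sigma> \<kappa> (e u) (e v) = b" by blast
  moreover have "e 0 = 0" using assms(2) by (simp add: assigns_def)
  with assms(4,5) l(2) have "(b, \<kappa>, u, v) \<notin> set (reading q rs)" by (auto simp: reading_def)
  ultimately show ?thesis by auto
qed

lemma set_concat_map_product:
  "set (concat (map (\<lambda>(x, y). f x y) (List.product xs ys))) = (\<Union>x\<in>set xs. \<Union>y\<in>set ys. set (f x y))"
  by auto

lemma set_clauses:
  "set (clauses M) = set (initial_clauses M) \<union> set (cell_clauses M) \<union>
     (\<Union>q\<in>{..states M}. \<Union>rs\<in>{rs. length rs = tapes M \<and> set rs \<subseteq> {..<symbols M}}. set (transition_clauses M q rs)) \<union>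
     {(Final 1, [(False, Ce (tapes M - 1) 1, 1, 0)])}"
proof -
  have "set [0..<Suc (states M)] = {..states M}" by (simp only: set_upt atLeast0LessThan lessThan_Suc_atMost)
  moreover have "set (List.n_lists (tapes M) [0..<symbols M]) = {rs. length rs = tapes M \<and> set rs \<subseteq> {..<symbols M}}"
    by (simp only: set_n_lists set_upt atLeast0LessThan)
  ultimately show ?thesis
    by (simp only: clauses_def set_append set_concat_map_product Un_assoc list.set)
qed

section \<open>The facts of a computation satisfy the clauses\<close>

context computation
begin

fun fact :: "nat \<Rightarrow> nat \<Rightarrow> kind \<Rightarrow> nat \<Rightarrow> nat \<Rightarrow> bool" where
  "fact N T (St q) t p \<longleftrightarrow> state t = q"
| "fact N T (Hd i) t p \<longleftrightarrow> pos N T p = snd (tape t i)"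
| "fact N T (Ce i s) t p \<longleftrightarrow> fst (tape t i) (pos N T p) = s"
| "fact N T (Rd i s) t p \<longleftrightarrow> reads t ! i = s"

lemma reading_facts:
  assumes "fact N T (St q) t 0" and "\<And>i. i < length rs \<Longrightarrow> fact N T (Rd i (rs ! i)) t 0"
    and "length rs = tapes M"
  shows "state t = q" "reads t = rs"
proof -
  show "state t = q" using assms(1) by simp
  show "reads t = rs" by (rule nth_equalityI) (use assms in \<open>auto simp: length_reads\<close>)
qed

lemma transition_clauses_facts:
  assumes N: "2 * T + 5 \<le> N" and halt: "state T = states M" and rs: "length rs = tapes M"
    and c: "c \<in> set (transition_clauses M q rs)"
  shows "satisfies N J (fact N T) c"
proof -
  let ?a = "\<lambda>i. snd (transition M q rs) ! i"
  have "satisfies N J (fact N T) (Succ 2 1, reading q rs @ [(True, St (fst (transition M q rs)), 2, 0)])"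
  proof (rule satisfies_readingI)
    fix e
    assume "holds N J (Succ 2 1) e" and r: "fact N T (St q) (e 1) 0" "\<And>i. i < length rs \<Longrightarrow> fact N T (Rd i (rs ! i)) (e 1) 0"
    then have "e 2 = Suc (e 1)" by simp
    then show "\<exists>(b, \<kappa>, u, v)\<in>set [(True, St (fst (transition M q rs)), 2, 0)]. fact N T \<kappa> (e u) (e v) = b"
      using reading_facts[OF r rs] by (simp add: state_Suc)
  qed
  moreover have "satisfies N J (fact N T) (Succ 2 1, reading q rs @ [(False, Hd i, 1, 3), (True, Ce i (fst (?a i)), 2, 3)])"
    if "i < tapes M" for i
  proof (rule satisfies_readingI)
    fix e
    assume "holds N J (Succ 2 1) e" and r: "fact N T (St q) (e 1) 0" "\<And>i. i < length rs \<Longrightarrow> fact N T (Rd i (rs ! i)) (e 1) 0"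
    then have "e 2 = Suc (e 1)" by simp
    then show "\<exists>(b, \<kappa>, u, v)\<in>set [(False, Hd i, 1, 3), (True, Ce i (fst (?a i)), 2, 3)]. fact N T \<kappa> (e u) (e v) = b"
      using reading_facts[OF r rs] that by (simp add: cell_Suc)
  qed
  moreover have "satisfies N J (fact N T)
      (Conj (Succ 2 1) (moved (snd (?a i)) 4 3), reading q rs @ [(False, Hd i, 1, 3), (True, Hd i, 2, 4)])"
    if "i < tapes M" for i
  proof (rule satisfies_readingI)
    fix e
    assume e: "assigns N e" and h: "holds N J (Conj (Succ 2 1) (moved (snd (?a i)) 4 3)) e"
      and r: "fact N T (St q) (e 1) 0" "\<And>i. i < length rs \<Longrightarrow> fact N T (Rd i (rs ! i)) (e 1) 0"
    then have "e 2 = Suc (e 1)" by simp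
    then show "\<exists>(b, \<kappa>, u, v)\<in>set [(False, Hd i, 1, 3), (True, Hd i, 2, 4)]. fact N T \<kappa> (e u) (e v) = b"
      using reading_facts[OF r rs] that h holds_moved[of N T e 3 J "snd (?a i)" 4, OF _ N e]
        head_bound_halted[OF that halt, of "e 1"] by (auto simp: head_Suc)
  qed
  ultimately show ?thesis using c by (auto simp: transition_clauses_def Let_def)
qed

lemma cell_clauses_facts:
  assumes c: "c \<in> set (cell_clauses M)"
  shows "satisfies N J (fact N T) c"
proof -
  have "satisfies N J (fact N T) (always, [(False, Hd i, 1, 3), (False, Ce i s, 1, 3), (True, Rd i s, 1, 0)])"
    if "i < tapes M" for i s
    using that by (auto simp: satisfies_def nth_reads)
  moreover have "satisfies N J (fact N T) (Conj (Succ 2 1) (Neg (Eq 3 4)),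
      [(False, Hd i, 1, 3), (False, Ce i s, 1, 4), (True, Ce i s, 2, 4)])"
    if "i < tapes M" for i s
    using that pos_inj[of _ N _ T] by (auto simp: satisfies_def cell_Suc assigns_def)
  ultimately show ?thesis using c by (auto simp: cell_clauses_def)
qed

lemma initial_clauses_facts:
  assumes w: "w = w0 @ u" "length u \<le> B" and N: "T + length w0 + B + 5 \<le> N"
    and c: "c \<in> set (initial_clauses M)"
  shows "satisfies N (guess_tape B w0) (fact N T) c"
proof -
  let ?J = "guess_tape B w0"
  have k: "0 < tapes M" using valid by (simp add: valid_tm_def)
  have t0: "fst (tape 0 0) = inscribe w" by (simp add: tape_0[OF k])
  \<comment> \<open>A blank of the guess tape lies beyond the guessed region, so its index denotes a
    cell to the right of \<open>w\<close> or a negative one.\<close>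
  have outside: "inscribe w (pos N T p) = 0" if "p < N" "?J (int p) = 0" for p
    using that w(2) N by (auto simp: w(1) guess_tape_def inscribe_def pos_def split: if_splits)
  have inside: "inscribe w (pos N T p) = s" if "p < N" "?J (int p) = s" "s = 1 \<or> s = 2" for p s
    using that N by (auto simp: w(1) guess_tape_def inscribe_def pos_def nth_append split: if_splits)
  have guess: "pos N T p = int p" if "?J (int p) = 3" for p
  proof -
    from that have "p < length w0 + B" by (auto simp: guess_tape_def split: if_splits)
    with N show ?thesis by (simp add: pos_def)
  qed
  have three: "inscribe w p = 0 \<or> inscribe w p = 1 \<or> inscribe w p = 2" for p
    by (auto simp: inscribe_def)
  \<comment> \<open>The word is a contiguous block starting at cell 0, so from a nonnegative cell on
    a blank persists. This needs no assumption on the length of the certificate.\<close>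
  have blank: "inscribe w (int p + 1) = 0" if "inscribe w (int p) = 0" for p
    using that by (auto simp: inscribe_def split: if_splits)
  have e0: "assigns N e \<Longrightarrow> e 0 = 0 \<and> (\<forall>v. e v < N)" for e by (simp add: assigns_def)
  have pos0: "pos N T 0 = 0" using N by (simp add: pos_def)
  have "satisfies N ?J (fact N T) (always, [(True, St 0, 0, 0)])"
    by (auto simp: satisfies_def state_0 dest: e0)
  moreover have "satisfies N ?J (fact N T) (Symbol 3 0, [(True, Ce 0 0, 0, 3)])"
    using outside by (auto simp: satisfies_def t0 dest!: e0)
  moreover have "satisfies N ?J (fact N T) (Symbol 3 1, [(True, Ce 0 1, 0, 3)])"
    using inside by (auto simp: satisfies_def t0 dest!: e0)
  moreover have "satisfies N ?J (fact N T) (Symbol 3 2, [(True, Ce 0 2, 0, 3)])"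
    using inside by (auto simp: satisfies_def t0 dest!: e0)
  moreover have "satisfies N ?J (fact N T)
      (Symbol 3 3, [(True, Ce 0 0, 0, 3), (True, Ce 0 1, 0, 3), (True, Ce 0 2, 0, 3)])"
    unfolding satisfies_def
  proof (intro allI impI)
    fix e
    assume e: "assigns N e"
      and h: "holds N ?J (fst (Symbol 3 3, [(True, Ce 0 0, 0, 3), (True, Ce 0 1, 0, 3), (True, Ce 0 2, 0, 3)])) e"
    have z: "e 0 = 0" using e0[OF e] by blast
    have "fact N T (Ce 0 0) 0 (e 3) \<or> fact N T (Ce 0 1) 0 (e 3) \<or> fact N T (Ce 0 2) 0 (e 3)"
      using three[of "pos N T (e 3)"] by (simp only: fact.simps t0)
    then show "\<exists>(b, \<kappa>, u, v)\<in>set (snd (Symbol 3 3, [(True, Ce 0 0, 0, 3), (True, Ce 0 1, 0, 3), (True, Ce 0 2, 0, 3)])).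
        fact N T \<kappa> (e u) (e v) = b"
      by (simp add: z del: fact.simps)
  qed
  moreover have "satisfies N ?J (fact N T)
      (Conj (Symbol 3 3) (Conj (Symbol 4 3) (Succ 4 3)), [(False, Ce 0 0, 0, 3), (True, Ce 0 0, 0, 4)])"
    unfolding satisfies_def
  proof (intro allI impI)
    fix e
    assume e: "assigns N e"
      and h: "holds N ?J (fst (Conj (Symbol 3 3) (Conj (Symbol 4 3) (Succ 4 3)), [(False, Ce 0 0, 0, 3), (True, Ce 0 0, 0, 4)])) e"
    have z: "e 0 = 0" using e0[OF e] by blast
    from h have "?J (int (e 3)) = 3" "?J (int (e 4)) = 3" and e4: "e 4 = Suc (e 3)" by auto
    then have g: "pos N T (e 3) = int (e 3)" "pos N T (e 4) = int (e 3) + 1"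
      using guess[of "e 3"] guess[of "e 4"] by simp_all
    have "fact N T (Ce 0 0) 0 (e 4)" if "fact N T (Ce 0 0) 0 (e 3)"
      using blank[of "e 3"] that by (simp add: t0 g)
    then show "\<exists>(b, \<kappa>, u, v)\<in>set (snd (Conj (Symbol 3 3) (Conj (Symbol 4 3) (Succ 4 3)),
        [(False, Ce 0 0, 0, 3), (True, Ce 0 0, 0, 4)])). fact N T \<kappa> (e u) (e v) = b"
      by (simp add: z del: fact.simps)
  qed
  moreover have "satisfies N ?J (fact N T) (always, [(True, Hd i, 0, 0)])" if "i < tapes M" for i
    using that by (auto simp: satisfies_def tape_0 pos0 dest!: e0)
  moreover have "satisfies N ?J (fact N T) (always, [(True, Ce i 0, 0, 3)])" if "i < tapes M" "1 \<le> i" for i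
    using that by (auto simp: satisfies_def tape_0 inscribe_def dest!: e0)
  ultimately show ?thesis using c by (auto simp: initial_clauses_def)
qed

lemma clauses_facts:
  assumes w: "w = w0 @ u" "length u \<le> B" and N: "2 * T + length w0 + B + 5 \<le> N"
    and halt: "state T = states M" and accept: "fst (tape T (tapes M - 1)) 0 \<noteq> 1"
    and c: "c \<in> set (clauses M)"
  shows "satisfies N (guess_tape B w0) (fact N T) c"
proof -
  have final: "satisfies N (guess_tape B w0) (fact N T) (Final 1, [(False, Ce (tapes M - 1) 1, 1, 0)])"
    unfolding satisfies_def
  proof (intro allI impI)
    fix e
    assume e: "assigns N e" "holds N (guess_tape B w0) (fst (Final 1, [(False, Ce (tapes M - 1) 1, 1, 0)])) e"
    then have "e 0 = 0" "Suc (e 1) = N" by (simp_all add: assigns_def)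
    moreover from this have "T \<le> e 1" using N by simp
    then have "tape (e 1) i = tape T i" for i using halted[OF halt, of "e 1"] by (simp add: tape_def)
    moreover have "pos N T 0 = 0" using N by (simp add: pos_def)
    ultimately show "\<exists>(b, \<kappa>, u, v)\<in>set (snd (Final 1, [(False, Ce (tapes M - 1) 1, 1, 0)])).
        fact N T \<kappa> (e u) (e v) = b"
      using accept by simp
  qed
  from c[unfolded set_clauses] consider "c \<in> set (initial_clauses M)" | "c \<in> set (cell_clauses M)"
    | q rs where "length rs = tapes M" "c \<in> set (transition_clauses M q rs)"
    | "c = (Final 1, [(False, Ce (tapes M - 1) 1, 1, 0)])"
    by blast
  then show ?thesis
  proof cases
    case 1
    then show ?thesis using N by (intro initial_clauses_facts[OF w]) simp_all
  next
    case 2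
    then show ?thesis by (rule cell_clauses_facts)
  next
    case (3 q rs)
    show ?thesis by (rule transition_clauses_facts[OF _ halt 3]) (use N in simp)
  next
    case 4
    then show ?thesis by (simp only: final)
  qed
qed

section \<open>Every satisfying assignment contains a computation\<close>

lemma facts_forced:
  assumes N: "2 * T + 5 \<le> N" and halt: "state T = states M"
    and sat: "\<And>c. c \<in> set (clauses M) \<Longrightarrow> satisfies N J \<sigma> c"
    and init: "\<And>p. p < N \<Longrightarrow> \<sigma> (Ce 0 (inscribe w (pos N T p))) 0 p"
    and t: "t < N"
  shows "\<sigma> (St (state t)) t 0 \<and> (\<forall>i<tapes M. \<forall>p<N.
    (pos N T p = snd (tape t i) \<longrightarrow> \<sigma> (Hd i) t p) \<and> \<sigma> (Ce i (fst (tape t i) (pos N T p))) t p)"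
  using t
\<comment> \<open>Each clause used has one positive literal; the facts of time \<open>t\<close>
  falsify its negative ones, so \<sigma> must make the positive one true.\<close>
proof (induction t)
  case 0
  define e where "e p = (\<lambda>_ :: nat. 0)(3 := p)" for p :: nat
  have e: "assigns N (e p)" "e p 0 = 0" "e p 3 = p" if "p < N" for p
    using that 0 by (auto simp: e_def assigns_def)
  have "satisfies N J \<sigma> (always, [(True, St 0, 0, 0)])"
    by (rule sat) (simp add: set_clauses initial_clauses_def)
  from satisfiesD[OF this e(1)[OF 0]] have "\<sigma> (St 0) 0 0" using 0 by (simp add: e(2))
  moreover have "\<sigma> (Hd i) 0 0" if "i < tapes M" for i
  proof -
    have "satisfies N J \<sigma> (always, [(True, Hd i, 0, 0)])"
      by (rule sat) (use that in \<open>auto simp: set_clauses initial_clauses_def\<close>)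
    from satisfiesD[OF this e(1)[OF 0]] show ?thesis using 0 by (simp add: e(2))
  qed
  moreover have "\<sigma> (Ce i 0) 0 p" if "i < tapes M" "i > 0" "p < N" for i p
  proof -
    have "satisfies N J \<sigma> (always, [(True, Ce i 0, 0, 3)])"
      by (rule sat) (use that in \<open>auto simp: set_clauses initial_clauses_def\<close>)
    from satisfiesD[OF this e(1)[OF that(3)]] show ?thesis using that by (simp add: e(2,3))
  qed
  moreover have "pos N T p = 0 \<Longrightarrow> p < N \<Longrightarrow> p = 0" for p
    using pos_inj[of p N 0 T] N by (simp add: pos_def)
  ultimately show ?case
    using init by (auto simp: state_0 tape_0 inscribe_def[of "[]"])
next
  case (Suc t)
  let ?q = "state t" and ?rs = "reads t"
  let ?tr = "transition M ?q ?rs"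
  define e where "e p p' = (\<lambda>_ :: nat. 0)(1 := t, 2 := Suc t, 3 := p, 4 := p')" for p p' :: nat
  have e: "assigns N (e p p')" "e p p' 0 = 0" "e p p' 1 = t" "e p p' 2 = Suc t" "e p p' 3 = p" "e p p' 4 = p'"
    if "p < N" "p' < N" for p p'
    using that Suc.prems by (auto simp: e_def assigns_def)
  from Suc have St: "\<sigma> (St ?q) t 0"
    and Hd: "\<And>i p. i < tapes M \<Longrightarrow> p < N \<Longrightarrow> pos N T p = snd (tape t i) \<Longrightarrow> \<sigma> (Hd i) t p"
    and Ce: "\<And>i p. i < tapes M \<Longrightarrow> p < N \<Longrightarrow> \<sigma> (Ce i (fst (tape t i) (pos N T p))) t p"
    by auto
  have N0: "0 < N" using N by simp
  have less: "fst (tape t i) p < symbols M" if "i < tapes M" for i p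
    using config_invariant that by blast
  have hb: "\<bar>snd (tape t i)\<bar> \<le> int T" if "i < tapes M" for t i
    by (rule head_bound_halted[OF that halt])
  have head: "\<exists>p<N. pos N T p = snd (tape t i)" if "i < tapes M" for t i
    using ex_pos[OF _ N] hb[OF that, of t] by simp
  \<comment> \<open>The symbols read are recovered from head and cell facts of the same time, so the
    induction need not carry them.\<close>
  have Rd: "\<sigma> (Rd i (?rs ! i)) t 0" if i: "i < tapes M" for i
  proof -
    from head[OF i] obtain p where p: "p < N" "pos N T p = snd (tape t i)" by blast
    have "satisfies N J \<sigma> (always, [(False, Hd i, 1, 3), (False, Ce i (?rs ! i), 1, 3), (True, Rd i (?rs ! i), 1, 0)])"
      by (rule sat) (use i less[OF i] in \<open>force simp: set_clauses cell_clauses_def nth_reads\<close>)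
    from satisfiesD[OF this e(1)[OF p(1) p(1)]] show ?thesis
      using Hd[OF i p] Ce[OF i p(1)] e[OF p(1) p(1)] by (simp add: nth_reads[OF i] p)
  qed
  have tc: "satisfies N J \<sigma> c" if "c \<in> set (transition_clauses M ?q ?rs)" for c
  proof (rule sat)
    have "?rs \<in> {rs. length rs = tapes M \<and> set rs \<subseteq> {..<symbols M}}"
      using length_reads reads_less by auto
    moreover have "?q \<in> {..states M}" using config_invariant by simp
    ultimately show "c \<in> set (clauses M)" using that unfolding set_clauses by blast
  qed
  have St': "\<sigma> (St (state (Suc t))) (Suc t) 0"
  proof -
    have "satisfies N J \<sigma> (Succ 2 1, reading ?q ?rs @ [(True, St (fst ?tr), 2, 0)])"
      by (rule tc) (simp add: transition_clauses_def)
    from satisfies_readingD[OF this e(1)[OF N0 N0]] show ?thesis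
      using St Rd e[OF N0 N0] by (simp add: state_Suc length_reads)
  qed
  have Hd': "\<sigma> (Hd i) (Suc t) p'" if i: "i < tapes M" and p': "p' < N" "pos N T p' = snd (tape (Suc t) i)" for i p'
  proof -
    from head[OF i] obtain p where p: "p < N" "pos N T p = snd (tape t i)" by blast
    let ?a = "snd ?tr ! i"
    have "satisfies N J \<sigma>
        (Conj (Succ 2 1) (moved (snd ?a) 4 3), reading ?q ?rs @ [(False, Hd i, 1, 3), (True, Hd i, 2, 4)])"
      by (rule tc) (use i in \<open>auto simp: transition_clauses_def Let_def\<close>)
    moreover have "holds N J (moved (snd ?a) 4 3) (e p p')"
      using holds_moved[of N T "e p p'" 3, OF _ N e(1)[OF p(1) p'(1)]] e[OF p(1) p'(1)] p p' hb[OF i]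
      by (simp add: head_Suc[OF i])
    ultimately show ?thesis
      using satisfies_readingD[of N J \<sigma> _ ?q ?rs _ "e p p'"] St Rd Hd[OF i p] e[OF p(1) p'(1)]
      by (fastforce simp: length_reads)
  qed
  have Ce': "\<sigma> (Ce i (fst (tape (Suc t) i) (pos N T p'))) (Suc t) p'" if i: "i < tapes M" and p': "p' < N" for i p'
  proof -
    from head[OF i] obtain p where p: "p < N" "pos N T p = snd (tape t i)" by blast
    let ?a = "snd ?tr ! i"
    show ?thesis
    \<comment> \<open>The cell under the head is covered by the clause for the written symbol, every
      other cell by the frame rule.\<close>
    proof (cases "p = p'")
      case True
      have "satisfies N J \<sigma> (Succ 2 1, reading ?q ?rs @ [(False, Hd i, 1, 3), (True, Ce i (fst ?a), 2, 3)])"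
        by (rule tc) (use i in \<open>auto simp: transition_clauses_def Let_def\<close>)
      from satisfies_readingD[OF this e(1)[OF p(1) p(1)]] show ?thesis
        using St Rd Hd[OF i p] e[OF p(1) p(1)] True p by (simp add: length_reads cell_Suc[OF i])
    next
      case False
      then have ne: "pos N T p' \<noteq> snd (tape t i)" using pos_inj[OF p(1) p'] p(2) by metis
      let ?s = "fst (tape t i) (pos N T p')"
      have "satisfies N J \<sigma> (Conj (Succ 2 1) (Neg (Eq 3 4)),
          [(False, Hd i, 1, 3), (False, Ce i ?s, 1, 4), (True, Ce i ?s, 2, 4)])"
        by (rule sat) (use i less[OF i] in \<open>force simp: set_clauses cell_clauses_def\<close>)
      from satisfiesD[OF this e(1)[OF p(1) p']] show ?thesis
        using Hd[OF i p] Ce[OF i p'] e[OF p(1) p'] False ne by (simp add: cell_Suc[OF i])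
    qed
  qed
  show ?case using St' Hd' Ce' by blast
qed

end

lemma (in computation) halts_withD:
  assumes "halts_with M (config t) y" and "t \<le> T"
  shows "state T = states M" "fst (tape T (tapes M - 1)) = inscribe y"
proof -
  have s: "state t = states M" using assms(1) by (simp add: halts_with_def state_def)
  have "config T = config t" by (rule halted[OF s assms(2)])
  moreover have "snd (config t) \<noteq> []"
    using config_invariant[of t] valid by (auto simp: valid_tm_def)
  then have "last (snd (config t)) = snd (config t) ! (tapes M - 1)"
    using config_invariant[of t] by (simp add: last_conv_nth)
  ultimately show "state T = states M" "fst (tape T (tapes M - 1)) = inscribe y"
    using assms(1) by (simp_all add: halts_with_def state_def tape_def)
qed

lemma clauses_satisfiable_if:
  assumes "valid_tm M" and halt: "\<exists>t\<le>T. halts_with M ((step M ^^ t) (initial M (w0 @ u))) [True]"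
    and u: "length u \<le> B" and N: "2 * T + length w0 + B + 5 \<le> N"
  shows "\<exists>\<sigma>. \<forall>c\<in>set (clauses M). satisfies N (guess_tape B w0) \<sigma> c"
proof -
  interpret computation M "w0 @ u" by unfold_locales (rule assms(1))
  from halt obtain t where "t \<le> T" "halts_with M (config t) [True]" by (auto simp: config_def)
  from halts_withD[OF this(2,1)] have "state T = states M" "fst (tape T (tapes M - 1)) 0 \<noteq> 1"
    by (simp_all add: inscribe_def)
  from clauses_facts[OF refl u N this] show ?thesis by blast
qed

text \<open>The certificate is read off the guessed cells up to the first one where \<sigma> admits
  a blank; from there on the clause that carries blanks makes \<sigma> admit a blank
  everywhere.\<close>

lemma guess_from_assignment:
  assumes sat: "\<And>c. c \<in> set (initial_clauses M) \<Longrightarrow> satisfies N (guess_tape B w0) \<sigma> c"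
    and N: "T + length w0 + B + 5 \<le> N"
  shows "\<exists>u. length u \<le> B \<and> (\<forall>p<N. \<sigma> (Ce 0 (inscribe (w0 @ u) (pos N T p))) 0 p)"
proof -
  let ?J = "guess_tape B w0" and ?L = "length w0"
  define e where "e p p' = (\<lambda>_ :: nat. 0)(3 := p, 4 := p')" for p p' :: nat
  have e: "assigns N (e p p')" "e p p' 0 = 0" "e p p' 3 = p" "e p p' 4 = p'" if "p < N" "p' < N" for p p'
    using that by (auto simp: e_def assigns_def)
  have given: "\<sigma> (Ce 0 s) 0 p" if "p < N" "?J (int p) = s" "s < 3" for p s
  proof -
    have "satisfies N ?J \<sigma> (Symbol 3 s, [(True, Ce 0 s, 0, 3)])"
      by (rule sat) (use that(3) in \<open>auto simp: initial_clauses_def less_Suc_eq numeral_3_eq_3 numeral_2_eq_2\<close>)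
    from satisfiesD[OF this e(1)[OF that(1) that(1)]] show ?thesis
      using that e[OF that(1) that(1)] by simp
  qed
  have guess: "\<sigma> (Ce 0 0) 0 p \<or> \<sigma> (Ce 0 1) 0 p \<or> \<sigma> (Ce 0 2) 0 p" if "p < N" "?J (int p) = 3" for p
  proof -
    have "satisfies N ?J \<sigma> (Symbol 3 3, [(True, Ce 0 0, 0, 3), (True, Ce 0 1, 0, 3), (True, Ce 0 2, 0, 3)])"
      by (rule sat) (simp add: initial_clauses_def)
    from satisfiesD[OF this e(1)[OF that(1) that(1)]] show ?thesis
      using that e[OF that(1) that(1)] by simp
  qed
  have blank: "\<sigma> (Ce 0 0) 0 (Suc p)"
    if "\<sigma> (Ce 0 0) 0 p" "Suc p < N" "?J (int p) = 3" "?J (int (Suc p)) = 3" for p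
  proof -
    have p: "p < N" using that(2) by simp
    have "satisfies N ?J \<sigma>
        (Conj (Symbol 3 3) (Conj (Symbol 4 3) (Succ 4 3)), [(False, Ce 0 0, 0, 3), (True, Ce 0 0, 0, 4)])"
      by (rule sat) (simp add: initial_clauses_def)
    from satisfiesD[OF this e(1)[OF p that(2)]] show ?thesis
      using that e[OF p that(2)] by simp
  qed
  \<comment> \<open>The alternative \<open>j = B\<close> provides a least element if \<sigma> admits
    no blank at all.\<close>
  define l where "l = (LEAST j. j = B \<or> \<sigma> (Ce 0 0) 0 (?L + j))"
  have l: "l = B \<or> \<sigma> (Ce 0 0) 0 (?L + l)" "l \<le> B"
    unfolding l_def by (rule LeastI[of _ B], simp) (rule Least_le, simp)
  have before: "\<not> \<sigma> (Ce 0 0) 0 (?L + j)" if "j < l" for j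
    using not_less_Least[of j "\<lambda>j. j = B \<or> \<sigma> (Ce 0 0) 0 (?L + j)"] that unfolding l_def by blast
  have J3: "?J (int (?L + j)) = 3" if "j < B" for j
    using that by (simp add: guess_tape_def)
  have after: "\<sigma> (Ce 0 0) 0 (?L + j)" if "l \<le> j" "j < B" for j
    using that
  proof (induction j rule: dec_induct)
    case base
    then show ?case using l by auto
  next
    case (step j)
    then show ?case using blank[of "?L + j"] J3[of j] J3[of "Suc j"] N by simp
  qed
  define u where "u = map (\<lambda>j. \<sigma> (Ce 0 2) 0 (?L + j)) [0..<l]"
  have "\<sigma> (Ce 0 (inscribe (w0 @ u) (pos N T p))) 0 p" if p: "p < N" for p
  proof -
    consider "p < ?L" | j where "p = ?L + j" "j < B" | "?L + B \<le> p"
    proof (cases "p < ?L")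
      case False
      then obtain j where "p = ?L + j" using le_Suc_ex[of ?L p] by auto
      then show ?thesis using that by (cases "j < B") auto
    qed
    then show ?thesis
    proof cases
      case 1
      then have "pos N T p = int p" using N by (simp add: pos_def)
      then have "inscribe (w0 @ u) (pos N T p) = sym (w0 ! p)" "?J (int p) = sym (w0 ! p)"
        using 1 by (simp_all add: inscribe_def guess_tape_def nth_append)
      then show ?thesis using given[OF p] by simp
    next
      case (2 j)
      then have pos: "pos N T p = int (?L + j)" using N by (simp add: pos_def)
      show ?thesis
      proof (cases "j < l")
        case True
        then have "inscribe (w0 @ u) (pos N T p) = sym (u ! j)"
          unfolding pos by (simp add: inscribe_def nth_append u_def nat_add_distrib)
        moreover have "u ! j = \<sigma> (Ce 0 2) 0 p" using True 2 by (simp add: u_def)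
        ultimately show ?thesis
          using before[OF True] guess[OF p] J3[of j] 2 by auto
      next
        case False
        then have "inscribe (w0 @ u) (pos N T p) = 0"
          unfolding pos by (simp add: inscribe_def u_def)
        then show ?thesis using after[of j] False 2 by simp
      qed
    next
      case 3
      then have "?J (int p) = 0" by (simp add: guess_tape_def)
      moreover have "inscribe (w0 @ u) (pos N T p) = 0"
        using 3 l(2) p by (auto simp: pos_def inscribe_def u_def)
      ultimately show ?thesis using given[OF p, of 0] by simp
    qed
  qed
  moreover have "length u \<le> B" using l(2) by (simp add: u_def)
  ultimately show ?thesis by blast
qed

lemma clauses_satisfiable_only_if:
  assumes "valid_tm M" and halt: "\<And>u. length u \<le> B \<Longrightarrow>
      \<exists>t\<le>T. halts_with M ((step M ^^ t) (initial M (w0 @ u))) [acc u]"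
    and N: "2 * T + length w0 + B + 5 \<le> N"
    and sat: "\<forall>c\<in>set (clauses M). satisfies N (guess_tape B w0) \<sigma> c"
  shows "\<exists>u. length u \<le> B \<and> acc u"
proof -
  have "\<exists>u. length u \<le> B \<and> (\<forall>p<N. \<sigma> (Ce 0 (inscribe (w0 @ u) (pos N T p))) 0 p)"
    by (rule guess_from_assignment) (use sat N in \<open>auto simp: set_clauses\<close>)
  then obtain u where u: "length u \<le> B"
    and init: "\<And>p. p < N \<Longrightarrow> \<sigma> (Ce 0 (inscribe (w0 @ u) (pos N T p))) 0 p" by blast
  interpret computation M "w0 @ u" by unfold_locales (rule assms(1))
  from halt[OF u] obtain t where "t \<le> T" "halts_with M (config t) [acc u]" by (auto simp: config_def)
  \<comment> \<open>The output stays fixed after halting, so it can be inspected at time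
    \<open>N - 1\<close>, which is the time singled out by the last clause.\<close>
  then have t: "t \<le> N - 1" "halts_with M (config t) [acc u]" using N by simp_all
  note T = halts_withD(1)[OF \<open>halts_with M (config t) [acc u]\<close> \<open>t \<le> T\<close>]
  note final = halts_withD(2)[OF t(2,1)]
  have k: "tapes M - 1 < tapes M" using valid by (simp add: valid_tm_def)
  have N0: "0 < N" "N - 1 < N" using N by simp_all
  have "pos N T 0 = 0" using N by (simp add: pos_def)
  moreover have "\<sigma> (Ce (tapes M - 1) (fst (tape (N - 1) (tapes M - 1)) (pos N T 0))) (N - 1) 0"
  proof -
    have "2 * T + 5 \<le> N" using N by simp
    from facts_forced[where J = "guess_tape B w0" and \<sigma> = \<sigma>, OF this T] sat init N0(2)
    have "\<forall>i<tapes M. \<forall>p<N. \<sigma> (Ce i (fst (tape (N - 1) i) (pos N T p))) (N - 1) p" by blast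
    with k N0(1) show ?thesis by blast
  qed
  ultimately have *: "\<sigma> (Ce (tapes M - 1) (inscribe [acc u] 0)) (N - 1) 0"
    by (simp only: final)
  define e where "e = (\<lambda>_ :: nat. 0)(1 := N - 1)"
  have e: "assigns N e" "e 0 = 0" "e 1 = N - 1" using N0 by (auto simp: e_def assigns_def)
  have "satisfies N (guess_tape B w0) \<sigma> (Final 1, [(False, Ce (tapes M - 1) 1, 1, 0)])"
    using sat by (simp add: set_clauses)
  from satisfiesD[OF this e(1)] have "\<not> \<sigma> (Ce (tapes M - 1) 1) (N - 1) 0"
    using e(2,3) N0 by simp
  \<comment> \<open>The output of a rejecting computation has the symbol 1 in cell 0, and \<sigma>
    would have to contain this fact.\<close>
  with * have "acc u" by (cases "acc u") (auto simp: inscribe_def)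
  with u show ?thesis by blast
qed

subsection \<open>The reduction\<close>

primrec seq_progs :: "prog list \<Rightarrow> prog" where
  "seq_progs [] = Nop"
| "seq_progs (p # ps) = Then p (seq_progs ps)"

definition emits :: "bool list \<Rightarrow> prog" where
  "emits bs = seq_progs (map Emit bs)"

primrec for_all :: "nat list \<Rightarrow> prog \<Rightarrow> prog" where
  "for_all [] p = p"
| "for_all (v # vs) p = For v (for_all vs p)"

lemma emission_seq_progs [simp]:
  "emission N J (seq_progs ps) e = concat (map (\<lambda>p. emission N J p e) ps)"
  by (induction ps) auto

lemma emission_emits [simp]: "emission N J (emits bs) e = bs"
  by (induction bs) (auto simp: emits_def)

lemma admissible_seq_progs [simp]: "admissible (seq_progs ps) \<longleftrightarrow> (\<forall>p\<in>set ps. admissible p)"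
  by (induction ps) auto

lemma loop_vars_seq_progs [simp]: "loop_vars (seq_progs ps) = (\<Union>p\<in>set ps. loop_vars p)"
  by (induction ps) auto

lemma emits_simps [simp]: "admissible (emits bs)" "loop_vars (emits bs) = {}"
  by (auto simp: emits_def)

lemma admissible_for_all:
  "admissible (for_all vs p) \<longleftrightarrow> admissible p \<and> distinct vs \<and> set vs \<subseteq> {..<15} \<and> set vs \<inter> loop_vars p = {}"
  and loop_vars_for_all [simp]: "loop_vars (for_all vs p) = set vs \<union> loop_vars p"
proof -
  show l: "loop_vars (for_all vs p) = set vs \<union> loop_vars p" for vs
    by (induction vs) auto
  show "admissible (for_all vs p) \<longleftrightarrow> admissible p \<and> distinct vs \<and> set vs \<subseteq> {..<15} \<and> set vs \<inter> loop_vars p = {}"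
    by (induction vs) (auto simp: l)
qed

text \<open>The columns of the database are the literals.\<close>

definition columns :: "kind list \<Rightarrow> nat \<Rightarrow> literal list" where
  "columns ks N = concat (map (\<lambda>(b, \<kappa>). concat (map (\<lambda>t. map (\<lambda>p. (b, \<kappa>, t, p)) [0..<N]) [0..<N]))
     (List.product [True, False] ks))"

text \<open>Signs and kinds are fixed by the verifier and are unrolled into the program; only times
  and positions need loops.\<close>

definition for_columns :: "kind list \<Rightarrow> nat \<Rightarrow> nat \<Rightarrow> (bool \<Rightarrow> kind \<Rightarrow> prog) \<Rightarrow> prog" where
  "for_columns ks u v f = seq_progs (map (\<lambda>(b, \<kappa>). for_all [u, v] (f b \<kappa>)) (List.product [True, False] ks))"

lemma concat_map_concat: "concat (map g (concat xss)) = concat (map (\<lambda>xs. concat (map g xs)) xss)"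
  by (induction xss) auto

lemma emission_for_columns:
  "emission N J (for_columns ks u v f) e =
     concat (map (\<lambda>(b, \<kappa>, t, p). emission N J (f b \<kappa>) (e(u := t, v := p))) (columns ks N))"
proof -
  show ?thesis
    by (simp add: concat_map_concat for_columns_def columns_def comp_def split_def)
qed

definition for_facts :: "kind list \<Rightarrow> (kind \<Rightarrow> prog) \<Rightarrow> prog" where
  "for_facts ks f = seq_progs (map (\<lambda>\<kappa>. for_all [1, 2] (f \<kappa>)) ks)"

definition facts :: "kind list \<Rightarrow> nat \<Rightarrow> (kind \<times> nat \<times> nat) list" where
  "facts ks N = concat (map (\<lambda>\<kappa>. concat (map (\<lambda>t. map (\<lambda>p. (\<kappa>, t, p)) [0..<N]) [0..<N])) ks)"

lemma emission_for_facts: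
  "emission N J (for_facts ks f) e =
     concat (map (\<lambda>(\<kappa>, t, p). emission N J (f \<kappa>) (e(1 := t, 2 := p))) (facts ks N))"
proof -
  show ?thesis
    by (simp add: concat_map_concat for_facts_def facts_def comp_def split_def)
qed

definition assignments :: "nat \<Rightarrow> (nat \<Rightarrow> nat) list" where
  "assignments N = concat (map (\<lambda>t. concat (map (\<lambda>t'. concat (map (\<lambda>p. map
     (\<lambda>p'. (\<lambda>_. 0)(1 := t, 2 := t', 3 := p, 4 := p')) [0..<N]) [0..<N])) [0..<N])) [0..<N])"

lemma set_assignments: "set (assignments N) = {e. assigns N e}"
proof
  have mem: "e \<in> set (assignments N) \<longleftrightarrow> (\<exists>t<N. \<exists>t'<N. \<exists>p<N. \<exists>p'<N.
      e = (\<lambda>_. 0)(1 := t, 2 := t', 3 := p, 4 := p'))" for e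
    by (simp only: assignments_def set_concat set_map set_upt image_image UN_iff) (simp add: image_iff Bex_def)
  show "set (assignments N) \<subseteq> {e. assigns N e}"
    by (auto simp: assignments_def assigns_def)
  show "{e. assigns N e} \<subseteq> set (assignments N)"
  proof clarify
    fix e
    assume e: "assigns N e"
    have "e = (\<lambda>_. 0)(1 := e 1, 2 := e 2, 3 := e 3, 4 := e 4)"
    proof
      fix v :: nat
      consider "v = 0" | "v = 1" | "v = 2" | "v = 3" | "v = 4" | "v > 4" by linarith
      then show "e v = ((\<lambda>_. 0)(1 := e 1, 2 := e 2, 3 := e 3, 4 := e 4)) v"
        using e by cases (auto simp: assigns_def)
    qed
    moreover have "e v < N" for v using e by (simp add: assigns_def)
    ultimately show "e \<in> set (assignments N)"
      unfolding mem by blast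
  qed
qed

lemma length_assignments: "length (assignments N) = N ^ 4"
  by (simp add: assignments_def length_concat comp_def sum_list_triv power4_eq_xxxx)

lemma emission_for_assignments:
  "emission N J (for_all [1, 2, 3, 4] p) (\<lambda>_. 0) = concat (map (emission N J p) (assignments N))"
proof -
  show ?thesis
    by (simp add: concat_map_concat assignments_def comp_def)
qed

text \<open>Eight loops over variables on which the output of \<open>p\<close> does not depend; this
  produces the multiplicity \<open>N ^ 8\<close> of the unit vectors.\<close>

lemma emission_repeat_8:
  assumes "\<And>e'. (\<forall>v. v < 7 \<longrightarrow> e' v = e v) \<Longrightarrow> emission N J p e' = r"
  shows "emission N J (for_all [7..<15] p) e = concat (replicate (N ^ 8) r)"
proof -
  have *: "emission N J (for_all vs p) e = concat (replicate (N ^ length vs) r)"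
    if "set vs \<subseteq> {7..}" "\<forall>e'. (\<forall>v. v < 7 \<longrightarrow> e' v = e v) \<longrightarrow> emission N J p e' = r" for vs e
    using that
  proof (induction vs arbitrary: e)
    case (Cons v vs)
    have "emission N J (for_all vs p) (e(v := i)) = concat (replicate (N ^ length vs) r)" for i
      using Cons.prems by (intro Cons.IH) auto
    moreover have "concat (replicate a (concat (replicate b r))) = concat (replicate (a * b) r)" for a b
      by (induction a) (auto simp: replicate_add)
    ultimately show ?case by (simp add: map_replicate_const)
  qed auto
  have "emission N J (for_all [7..<15] p) e = concat (replicate (N ^ length [7..<15 :: nat]) r)"
    by (rule *) (use assms in auto)
  moreover have "length [7..<15 :: nat] = 8" by simp
  ultimately show ?thesis by (simp only:)
qed

text \<open>Decides whether the column given by \<open>b\<close>, \<kappa> and the variables 5 and 6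
  occurs in the clause. Sign and kind are compared while the program is built, time and position
  when it is run.\<close>

definition matches :: "literal list \<Rightarrow> bool \<Rightarrow> kind \<Rightarrow> test" where
  "matches ls b \<kappa> = foldr (\<lambda>(b', \<kappa>', u, v) c. if b' = b \<and> \<kappa>' = \<kappa> then Disj (Conj (Eq 5 u) (Eq 6 v)) c else c)
     ls (Neg always)"

fun ground :: "(nat \<Rightarrow> nat) \<Rightarrow> literal \<Rightarrow> literal" where
  "ground e (b, \<kappa>, u, v) = (b, \<kappa>, e u, e v)"

text \<open>The variables of the literals are below 5, so loading the column into 5 and 6 leaves
  their values alone.\<close>

lemma holds_matches:
  assumes "\<forall>(b, \<kappa>, u, v)\<in>set ls. u < 5 \<and> v < 5"
  shows "holds N J (matches ls b \<kappa>) (e(5 := t, 6 := p)) \<longleftrightarrow> (b, \<kappa>, t, p) \<in> ground e ` set ls"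
  using assms by (induction ls) (auto simp: matches_def split: if_splits)

text \<open>The first True announces another row in the list of rows, every entry is again preceded
  by True, and the final False closes the row.\<close>

definition row_prog :: "kind list \<Rightarrow> (bool \<Rightarrow> kind \<Rightarrow> test) \<Rightarrow> bool \<Rightarrow> prog" where
  "row_prog ks g s = seq_progs [Emit True,
     for_columns ks 5 6 (\<lambda>b \<kappa>. Cond (g b \<kappa>) (emits [True, True]) (emits [True, False])),
     emits [True, s, True, s, True, s, False]]"

lemma emission_row_prog:
  "emission N J (row_prog ks g s) e =
     True # enc_list enc_bool (map (\<lambda>(b, \<kappa>, t, p). holds N J (g b \<kappa>) (e(5 := t, 6 := p))) (columns ks N) @ replicate 3 s)"
proof -
  define P where "P = (\<lambda>(b, \<kappa>, t, p). holds N J (g b \<kappa>) (e(5 := t, 6 := p)))"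
  have "concat (map (\<lambda>c. if P c then [True, True] else [True, False]) cs) =
      concat (map (\<lambda>x. True # enc_bool x) (map P cs))" for cs
    by (induction cs) (auto simp: enc_bool_def)
  moreover have "(\<lambda>(b, \<kappa>, t, p). emission N J (Cond (g b \<kappa>) (emits [True, True]) (emits [True, False])) (e(5 := t, 6 := p))) =
      (\<lambda>c. if P c then [True, True] else [True, False])"
    by (auto simp: P_def fun_eq_iff)
  ultimately show ?thesis
    unfolding P_def[symmetric]
    by (simp add: row_prog_def emission_for_columns enc_list_def numeral_3_eq_3 enc_bool_def)
qed

text \<open>The number of stars of a row in unary: one True for each column, except that a row that
  is to keep an entry omits one fixed column, the positive literal of the first kind at time and
  position 0.\<close>

definition weight_prog :: "kind list \<Rightarrow> bool \<Rightarrow> prog" where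
  "weight_prog ks full = for_columns ks 5 6 (\<lambda>b \<kappa>.
     if full \<or> \<not> b \<or> \<kappa> \<noteq> hd ks then Emit True
     else Cond (Conj (Eq 5 0) (Eq 6 0)) Nop (Emit True))"

text \<open>The skeleton is used for the rows and, with their contributions, for the cost.\<close>

definition skeleton :: "kind list \<Rightarrow> (test \<times> literal list) list \<Rightarrow> prog \<Rightarrow> prog \<Rightarrow> (bool \<Rightarrow> kind \<Rightarrow> prog) \<Rightarrow>
    (literal list \<Rightarrow> prog) \<Rightarrow> prog" where
  "skeleton ks cls r r' f h = seq_progs [for_facts ks (\<lambda>_. r), r',
     for_all [7..<15] (for_columns ks 1 2 f),
     for_facts ks (\<lambda>\<kappa>. h [(True, \<kappa>, 1, 2), (False, \<kappa>, 1, 2)]),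
     seq_progs (map (\<lambda>(g, ls). for_all [1, 2, 3, 4] (Cond g (h ls) Nop)) cls)]"

text \<open>The budget has to be written without knowing the hitting set. Only the number of chosen
  columns matters, which is half of all, so the unit vectors of positive literals are charged as if
  they kept an entry and those of negative literals as if they did not.\<close>

definition reduction :: "kind list \<Rightarrow> (test \<times> literal list) list \<Rightarrow> prog" where
  "reduction ks cls = seq_progs
     [for_columns ks 5 6 (\<lambda>_ _. emits [True, False]), emits [True, True, True, True, True, True, False],
      skeleton ks cls (row_prog ks (\<lambda>_ _. always) True) (row_prog ks (\<lambda>_ _. always) True)
        (\<lambda>b \<kappa>. row_prog ks (matches [(b, \<kappa>, 1, 2)]) False) (\<lambda>ls. row_prog ks (matches ls) False),
      Emit False,
      skeleton ks cls (weight_prog ks False) (weight_prog ks True)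
        (\<lambda>b \<kappa>. weight_prog ks (\<not> b)) (\<lambda>_. weight_prog ks False),
      Emit False]"

lemma loop_vars_for_columns:
  "loop_vars (for_columns ks u v f) \<subseteq> {u, v} \<union> (\<Union>b \<kappa>. loop_vars (f b \<kappa>))"
  by (auto simp: for_columns_def)

lemma admissible_for_columns:
  assumes "u < 15" "v < 15" "u \<noteq> v" "\<And>b \<kappa>. admissible (f b \<kappa>) \<and> u \<notin> loop_vars (f b \<kappa>) \<and> v \<notin> loop_vars (f b \<kappa>)"
  shows "admissible (for_columns ks u v f)"
  using assms by (auto simp: for_columns_def)

lemma test_vars_matches:
  "\<forall>(b, \<kappa>, u, v)\<in>set ls. u < 5 \<and> v < 5 \<Longrightarrow> test_vars (matches ls b \<kappa>) \<subseteq> {..<15}"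
  by (induction ls) (auto simp: matches_def always_def Disj_def split: if_splits)

lemma admissible_row_prog:
  assumes "\<And>b \<kappa>. test_vars (g b \<kappa>) \<subseteq> {..<15}"
  shows "admissible (row_prog ks g s)" "loop_vars (row_prog ks g s) \<subseteq> {5, 6}"
  using assms loop_vars_for_columns[of ks 5 6 "\<lambda>b \<kappa>. Cond (g b \<kappa>) (emits [True, True]) (emits [True, False])"]
  by (auto simp: row_prog_def intro!: admissible_for_columns)

lemma admissible_weight_prog:
  "admissible (weight_prog ks b)" "loop_vars (weight_prog ks b) \<subseteq> {5, 6}"
  by (auto simp: weight_prog_def for_columns_def split: if_splits)

text \<open>The contributions loop over 5 and 6 only, which keeps them apart from the surrounding
  loops over 1 to 4 and 7 to 14.\<close>

lemma admissible_skeleton: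
  assumes "admissible r \<and> loop_vars r \<subseteq> {5, 6}" "admissible r' \<and> loop_vars r' \<subseteq> {5, 6}"
    and "\<And>b \<kappa>. admissible (f b \<kappa>) \<and> loop_vars (f b \<kappa>) \<subseteq> {5, 6}"
    and h: "\<And>ls. \<forall>(b, \<kappa>, u, v)\<in>set ls. u < 5 \<and> v < 5 \<Longrightarrow> admissible (h ls) \<and> loop_vars (h ls) \<subseteq> {5, 6}"
    and cls: "\<And>g ls. (g, ls) \<in> set cls \<Longrightarrow> test_vars g \<subseteq> {..<15} \<and> (\<forall>(b, \<kappa>, u, v)\<in>set ls. u < 5 \<and> v < 5)"
  shows "admissible (skeleton ks cls r r' f h)"
proof -
  have "admissible (for_facts ks k)" if "\<And>\<kappa>. admissible (k \<kappa>) \<and> loop_vars (k \<kappa>) \<subseteq> {5, 6}" for k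
    using that by (fastforce simp: for_facts_def)
  moreover have "admissible (for_all [7..<15] (for_columns ks 1 2 f))"
  proof -
    have "loop_vars (for_columns ks 1 2 f) \<subseteq> {1, 2, 5, 6}"
      using loop_vars_for_columns[of ks 1 2 f] assms(3) by blast
    moreover have "admissible (for_columns ks 1 2 f)"
      using assms(3) by (intro admissible_for_columns) fastforce+
    ultimately show ?thesis by (auto simp: admissible_for_all)
  qed
  moreover have "admissible (for_all [1, 2, 3, 4] (Cond g (h ls) Nop))" if "(g, ls) \<in> set cls" for g ls
    using cls[OF that] h[of ls] by (auto simp: admissible_for_all)
  ultimately show ?thesis
    using assms(1,2) h[of "[(True, _, 1, 2), (False, _, 1, 2)]"] by (auto simp: skeleton_def)
qed

lemma admissible_reduction:
  assumes "\<And>g ls. (g, ls) \<in> set cls \<Longrightarrow> test_vars g \<subseteq> {..<15} \<and> (\<forall>(b, \<kappa>, u, v)\<in>set ls. u < 5 \<and> v < 5)"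
  shows "admissible (reduction ks cls)"
proof -
  have "admissible (skeleton ks cls (row_prog ks (\<lambda>_ _. always) True) (row_prog ks (\<lambda>_ _. always) True)
        (\<lambda>b \<kappa>. row_prog ks (matches [(b, \<kappa>, 1, 2)]) False) (\<lambda>ls. row_prog ks (matches ls) False))"
    by (rule admissible_skeleton)
      (use assms in \<open>auto intro!: admissible_row_prog test_vars_matches conjI simp: always_def\<close>)
  moreover have "admissible (skeleton ks cls (weight_prog ks False) (weight_prog ks True)
        (\<lambda>b \<kappa>. weight_prog ks (\<not> b)) (\<lambda>_. weight_prog ks False))"
    by (rule admissible_skeleton) (use assms admissible_weight_prog in auto)
  ultimately show ?thesis
    by (auto simp: reduction_def intro!: admissible_for_columns)
qed

section \<open>The emitted database and its budget\<close>

lemma columns_facts: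
  "columns ks N = map (\<lambda>\<phi>. (True, \<phi>)) (facts ks N) @ map (\<lambda>\<phi>. (False, \<phi>)) (facts ks N)"
  by (simp add: columns_def facts_def map_concat comp_def)

lemma set_facts: "set (facts ks N) = set ks \<times> {..<N} \<times> {..<N}"
  by (auto simp: facts_def image_iff)

lemma length_facts: "length (facts ks N) = length ks * N ^ 2"
  by (simp add: facts_def length_concat comp_def sum_list_triv power2_eq_square)

lemma distinct_facts:
  assumes "distinct ks"
  shows "distinct (facts ks N)"
proof -
  have "card (set (facts ks N)) = length (facts ks N)"
    using distinct_card[OF assms] by (simp add: set_facts length_facts card_cartesian_product power2_eq_square)
  then show ?thesis by (rule card_distinct)
qed

lemma set_columns: "set (columns ks N) = UNIV \<times> set ks \<times> {..<N} \<times> {..<N}"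
  by (auto simp: columns_facts set_facts)

lemma length_columns: "length (columns ks N) = 2 * length (facts ks N)"
  by (simp add: columns_facts)

lemma distinct_columns: "distinct ks \<Longrightarrow> distinct (columns ks N)"
  by (auto simp: columns_facts distinct_map distinct_facts inj_on_def)

definition vec :: "kind list \<Rightarrow> nat \<Rightarrow> literal set \<Rightarrow> bool list" where
  "vec ks N L = map (\<lambda>c. c \<in> L) (columns ks N)"

text \<open>The pairs of complementary literals make a hitting set choose a truth value for every
  fact; the other sets are the ground clauses.\<close>

definition elements :: "kind list \<Rightarrow> nat \<Rightarrow> (int \<Rightarrow> nat) \<Rightarrow> (test \<times> literal list) list \<Rightarrow> bool list list" where
  "elements ks N J cls =
     map (\<lambda>\<phi>. vec ks N {(True, \<phi>), (False, \<phi>)}) (facts ks N) @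
     concat (map (\<lambda>(g, ls). concat (map (\<lambda>e.
       if holds N J g e then [vec ks N (ground e ` set ls)] else []) (assignments N))) cls)"

lemma length_elements:
  "length (elements ks N J cls) \<le> length ks * N ^ 2 + length cls * N ^ 4"
proof -
  have *: "length (concat (map (\<lambda>e. if P e then [f e] else []) es)) \<le> length es"
    for P and f :: "(nat \<Rightarrow> nat) \<Rightarrow> bool list" and es
    by (induction es) auto
  define G where "G = (\<lambda>(g, ls). concat (map (\<lambda>e.
       if holds N J g e then [vec ks N (ground e ` set ls)] else []) (assignments N)))"
  have "length (G c) \<le> N ^ 4" for c
    using *[where es = "assignments N"] unfolding length_assignments by (simp add: G_def case_prod_unfold)
  then have "length (concat (map G cls)) \<le> length cls * N ^ 4"
    by (induction cls) (simp_all add: add_mono)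
  then have "length (concat (map (\<lambda>(g, ls). concat (map (\<lambda>e.
       if holds N J g e then [vec ks N (ground e ` set ls)] else []) (assignments N))) cls)) \<le> length cls * N ^ 4"
    unfolding G_def .
  then show ?thesis by (simp add: elements_def length_facts)
qed

lemma assigns_zero: "e \<in> set (assignments N) \<Longrightarrow> e 0 = 0"
  using set_assignments[of N] by (auto simp: assigns_def)

lemma emission_skeleton:
  assumes r: "\<And>e. e 0 = 0 \<Longrightarrow> emission N J r e = R" and r': "emission N J r' (\<lambda>_. 0) = R'"
    and f: "\<And>e b \<kappa> t p. e 0 = 0 \<Longrightarrow> emission N J (f b \<kappa>) (e(1 := t, 2 := p)) = F (b, \<kappa>, t, p)"
    and h: "\<And>e ls. e 0 = 0 \<Longrightarrow> \<forall>(b, \<kappa>, u, v)\<in>set ls. u < 5 \<and> v < 5 \<Longrightarrow>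
      emission N J (h ls) e = H (vec ks N (ground e ` set ls))"
    and cls: "\<And>g ls. (g, ls) \<in> set cls \<Longrightarrow> \<forall>(b, \<kappa>, u, v)\<in>set ls. u < 5 \<and> v < 5"
  shows "emission N J (skeleton ks cls r r' f h) (\<lambda>_. 0) =
    concat (replicate (length (facts ks N)) R) @ R' @
    concat (replicate (N ^ 8) (concat (map F (columns ks N)))) @ concat (map H (elements ks N J cls))"
proof -
  have "emission N J (for_facts ks (\<lambda>_. r)) (\<lambda>_. 0) = concat (map (\<lambda>_. R) (facts ks N))"
    unfolding emission_for_facts by (intro arg_cong[of _ _ concat] map_cong) (auto intro!: r)
  then have 1: "emission N J (for_facts ks (\<lambda>_. r)) (\<lambda>_. 0) = concat (replicate (length (facts ks N)) R)"
    by (simp add: map_replicate_const)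
  have 2: "emission N J (for_all [7..<15] (for_columns ks 1 2 f)) (\<lambda>_. 0) =
      concat (replicate (N ^ 8) (concat (map F (columns ks N))))"
  proof (rule emission_repeat_8)
    fix e :: "nat \<Rightarrow> nat"
    assume "\<forall>v<7. e v = 0"
    then have "e 0 = 0" by simp
    then show "emission N J (for_columns ks 1 2 f) e = concat (map F (columns ks N))"
      unfolding emission_for_columns by (intro arg_cong[of _ _ concat] map_cong) (auto simp: f[unfolded One_nat_def])
  qed
  have 3: "emission N J (for_facts ks (\<lambda>\<kappa>. h [(True, \<kappa>, 1, 2), (False, \<kappa>, 1, 2)])) (\<lambda>_. 0) =
      concat (map H (map (\<lambda>\<phi>. vec ks N {(True, \<phi>), (False, \<phi>)}) (facts ks N)))"
    unfolding emission_for_facts map_map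
    by (intro arg_cong[of _ _ concat] map_cong) (auto simp: h)
  define G where "G = (\<lambda>(g, ls). concat (map (\<lambda>e.
       if holds N J g e then [vec ks N (ground e ` set ls)] else []) (assignments N)))"
  have "emission N J (for_all [1, 2, 3, 4] (Cond g (h ls) Nop)) (\<lambda>_. 0) = concat (map H (G (g, ls)))"
    if "(g, ls) \<in> set cls" for g ls
    unfolding emission_for_assignments concat_map_concat map_map G_def prod.case
    by (intro arg_cong[of _ _ concat] map_cong) (auto simp: h[OF assigns_zero cls[OF that]])
  then have 4: "emission N J (seq_progs (map (\<lambda>(g, ls). for_all [1, 2, 3, 4] (Cond g (h ls) Nop)) cls)) (\<lambda>_. 0) =
      concat (map H (concat (map G cls)))"
    unfolding emission_seq_progs concat_map_concat map_map
    by (intro arg_cong[of _ _ concat] map_cong) (auto simp del: for_all.simps)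
  have "emission N J (skeleton ks cls r r' f h) (\<lambda>_. 0) =
      emission N J (for_facts ks (\<lambda>_. r)) (\<lambda>_. 0) @ emission N J r' (\<lambda>_. 0) @
      emission N J (for_all [7..<15] (for_columns ks 1 2 f)) (\<lambda>_. 0) @
      emission N J (for_facts ks (\<lambda>\<kappa>. h [(True, \<kappa>, 1, 2), (False, \<kappa>, 1, 2)])) (\<lambda>_. 0) @
      emission N J (seq_progs (map (\<lambda>(g, ls). for_all [1, 2, 3, 4] (Cond g (h ls) Nop)) cls)) (\<lambda>_. 0)"
    unfolding skeleton_def by (subst emission_seq_progs) (simp only: list.map concat.simps append_Nil2)
  then show ?thesis
    unfolding 1 2 3 4 r' by (simp add: elements_def G_def)
qed

lemma concat_replicate_const:
  "concat (map (\<lambda>_. replicate m True) xs) = replicate (length xs * m) True"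
  by (induction xs) (auto simp: replicate_add)

lemma concat_replicate_replicate:
  "concat (replicate l (replicate m x)) = replicate (l * m) x"
  by (induction l) (auto simp: replicate_add)

lemma emission_weight_prog:
  assumes "distinct ks" and "ks \<noteq> []" and "N > 0" and "e 0 = 0"
  shows "emission N J (weight_prog ks full) e =
    replicate (if full then length (columns ks N) else length (columns ks N) - 1) True"
proof (cases full)
  case True
  have "emission N J (weight_prog ks full) e = concat (map (\<lambda>_. replicate 1 True) (columns ks N))"
    unfolding weight_prog_def emission_for_columns using True
    by (intro arg_cong[of _ _ concat] map_cong) auto
  then show ?thesis using True by (simp only: concat_replicate_const mult_1_right if_True)
next
  case False
  let ?c = "(True, hd ks, 0, 0)"
  have "emission N J (weight_prog ks full) e = concat (map (\<lambda>c. if c = ?c then [] else [True]) (columns ks N))"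
    unfolding weight_prog_def emission_for_columns using False assms(4)
    by (intro arg_cong[of _ _ concat] map_cong) (auto split: if_splits)
  moreover have "concat (map (\<lambda>c. if c = ?c then [] else [True]) cs) = replicate (length (remove1 ?c cs)) True"
    if "distinct cs" for cs :: "literal list"
  proof -
    have "concat (map (\<lambda>c. if c = ?c then [] else [True]) cs) = replicate (length (removeAll ?c cs)) True"
      by (induction cs) auto
    then show ?thesis using that by (simp add: distinct_remove1_removeAll)
  qed
  moreover have "?c \<in> set (columns ks N)" using assms by (simp add: set_columns)
  ultimately show ?thesis
    using False distinct_columns[OF assms(1), of N] by (simp add: length_remove1)
qed

lemma vec_unit:
  assumes "distinct ks" and "l < length (columns ks N)"
  shows "vec ks N {columns ks N ! l} = unit (length (columns ks N)) l"
proof -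
  have "vec ks N {columns ks N ! l} ! j = unit (length (columns ks N)) l ! j" if "j < length (columns ks N)" for j
    using that assms nth_eq_iff_index_eq[OF distinct_columns[OF assms(1)], of j N l]
    by (simp add: vec_def unit_def)
  then show ?thesis by (intro nth_equalityI) (auto simp: vec_def unit_def)
qed

definition enc_row :: "bool list \<Rightarrow> bool list" where
  "enc_row r = True # enc_list enc_bool r"

text \<open>The emitted number is the budget of the hitting set lemmas. What is \<open>N\<close>
  there is \<open>m\<close> here, while \<open>N\<close> is the loop range.\<close>

lemma emission_reduction:
  fixes J :: "int \<Rightarrow> nat"
  assumes ks: "distinct ks" "ks \<noteq> []" and N: "N > 0"
    and cls: "\<And>g ls. (g, ls) \<in> set cls \<Longrightarrow> \<forall>(b, \<kappa>, u, v)\<in>set ls. u < 5 \<and> v < 5"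
  defines "K \<equiv> length (columns ks N)" and "m \<equiv> length (facts ks N)" and "es \<equiv> elements ks N J cls"
  shows "\<exists>k. emission N J (reduction ks cls) (\<lambda>_. 0) =
      enc_database (labelled K (hitting_rows K m (N ^ 8) es)) @ enc_nat k \<and>
    k + (N ^ 8 * m + length es + m) = K * (m + 1 + N ^ 8 * K + length es)"
proof -
  let ?T = "replicate K True @ replicate 3 True"
  have red: "emission N J (row_prog ks (\<lambda>_ _. always) True) e = enc_row ?T" for e
  proof -
    have "map (\<lambda>(b, \<kappa>, t, p). holds N J always (e(5 := t, 6 := p))) (columns ks N) = replicate K True"
      by (simp add: K_def case_prod_unfold map_replicate_const)
    then show ?thesis by (simp only: emission_row_prog enc_row_def)
  qed
  have mat: "emission N J (row_prog ks (matches ls) False) e =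
      enc_row (vec ks N (ground e ` set ls) @ replicate 3 False)"
    if "\<forall>(b, \<kappa>, u, v)\<in>set ls. u < 5 \<and> v < 5" for e ls
  proof -
    have "map (\<lambda>(b, \<kappa>, t, p). holds N J (matches ls b \<kappa>) (e(5 := t, 6 := p))) (columns ks N) =
        vec ks N (ground e ` set ls)"
      unfolding vec_def using holds_matches[OF that] by (intro map_cong) auto
    then show ?thesis by (simp only: emission_row_prog enc_row_def)
  qed
  have "emission N J (skeleton ks cls (row_prog ks (\<lambda>_ _. always) True) (row_prog ks (\<lambda>_ _. always) True)
        (\<lambda>b \<kappa>. row_prog ks (matches [(b, \<kappa>, 1, 2)]) False) (\<lambda>ls. row_prog ks (matches ls) False)) (\<lambda>_. 0) =
      concat (replicate m (enc_row ?T)) @ enc_row ?T @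
      concat (replicate (N ^ 8) (concat (map (\<lambda>c. enc_row (vec ks N {c} @ replicate 3 False)) (columns ks N)))) @
      concat (map (\<lambda>v. enc_row (v @ replicate 3 False)) es)"
    unfolding m_def es_def
    by (rule emission_skeleton[where F = "\<lambda>c. enc_row (vec ks N {c} @ replicate 3 False)"
          and H = "\<lambda>v. enc_row (v @ replicate 3 False)"])
      (use red mat cls in auto)
  also have "map (\<lambda>c. enc_row (vec ks N {c} @ replicate 3 False)) (columns ks N) =
      map (\<lambda>l. enc_row (unit K l @ replicate 3 False)) [0..<K]"
    by (rule nth_equalityI) (auto simp: K_def vec_unit[OF ks(1)])
  also have "concat (replicate m (enc_row ?T)) @ enc_row ?T @
      concat (replicate (N ^ 8) (concat (map (\<lambda>l. enc_row (unit K l @ replicate 3 False)) [0..<K]))) @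
      concat (map (\<lambda>v. enc_row (v @ replicate 3 False)) es) = concat (map enc_row (hitting_rows K m (N ^ 8) es))"
  proof -
    have "concat (map enc_row (concat (replicate a xs))) = concat (replicate a (concat (map enc_row xs)))" for a xs
      by (induction a) auto
    moreover have "concat (replicate m r) @ r = concat (replicate (m + 1) r)" for r :: "bool list"
      by (induction m) auto
    ultimately show ?thesis
      by (simp add: hitting_rows_def comp_def map_concat[symmetric] del: replicate_Suc append_assoc)
  qed
  finally have rows: "emission N J (skeleton ks cls (row_prog ks (\<lambda>_ _. always) True) (row_prog ks (\<lambda>_ _. always) True)
        (\<lambda>b \<kappa>. row_prog ks (matches [(b, \<kappa>, 1, 2)]) False) (\<lambda>ls. row_prog ks (matches ls) False)) (\<lambda>_. 0) =
      concat (map enc_row (hitting_rows K m (N ^ 8) es))" .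
  have K: "K = 2 * m" by (simp add: K_def m_def length_columns)
  have m0: "m > 0" using ks(2) N by (simp add: m_def length_facts)
  note weight = emission_weight_prog[OF ks N, folded K_def]
  \<comment> \<open>In order: \<open>m\<close> red rows that keep an entry, the red row of stars,
    the copies of the unit vectors, half of which keep an entry, and the sets to be hit.\<close>
  define k where "k = m * (K - 1) + K + N ^ 8 * (m * (K - 1) + m * K) + length es * (K - 1)"
  have "emission N J (skeleton ks cls (weight_prog ks False) (weight_prog ks True)
        (\<lambda>b \<kappa>. weight_prog ks (\<not> b)) (\<lambda>_. weight_prog ks False)) (\<lambda>_. 0) =
      concat (replicate m (replicate (K - 1) True)) @ replicate K True @
      concat (replicate (N ^ 8) (concat (map (\<lambda>(b, \<kappa>, t, p). replicate (if \<not> b then K else K - 1) True) (columns ks N)))) @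
      concat (map (\<lambda>_. replicate (K - 1) True) es)"
    unfolding m_def es_def
    by (rule emission_skeleton) (use cls in \<open>auto simp: weight\<close>)
  also have "concat (map (\<lambda>(b, \<kappa>, t, p). replicate (if \<not> b then K else K - 1) True) (columns ks N)) =
      replicate (m * (K - 1) + m * K) True"
    by (simp add: columns_facts comp_def concat_replicate_const m_def replicate_add)
  finally have cost: "emission N J (skeleton ks cls (weight_prog ks False) (weight_prog ks True)
        (\<lambda>b \<kappa>. weight_prog ks (\<not> b)) (\<lambda>_. weight_prog ks False)) (\<lambda>_. 0) = replicate k True"
    by (simp only: concat_replicate_const replicate_add[symmetric] concat_replicate_replicate k_def add.assoc)
  have "emission N J (for_columns ks 5 6 (\<lambda>_ _. emits [True, False])) (\<lambda>_. 0) @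
      [True, True, True, True, True, True, False] =
      enc_list (\<lambda>a. enc_bool (a = Sensitive)) (replicate K Quasi @ replicate 3 Sensitive)"
    by (simp add: emission_for_columns enc_list_def case_prod_unfold map_replicate_const K_def
        enc_bool_def numeral_3_eq_3)
  note labels = this
  have enc_row: "(\<lambda>x. True # enc_list enc_bool x) = enc_row" by (rule ext) (simp add: enc_row_def)
  have "emission N J (reduction ks cls) (\<lambda>_. 0) =
      enc_database (labelled K (hitting_rows K m (N ^ 8) es)) @ enc_nat k"
    unfolding reduction_def enc_database_def labelled_simps emission_seq_progs list.map rows cost
      labels[symmetric] enc_list_def[of "enc_list enc_bool"] enc_row
    by (simp add: enc_nat_def)
  moreover have "k + (N ^ 8 * m + length es + m) = K * (m + 1 + N ^ 8 * K + length es)"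
  proof -
    have less: "x * (K - 1) + x = x * K" for x
      unfolding K using m0 by (cases m) (auto simp: algebra_simps)
    have "N ^ 8 * (m * (K - 1) + m * K) + N ^ 8 * m = N ^ 8 * ((m * (K - 1) + m) + m * K)"
      by (simp only: distrib_left ac_simps)
    also have "(m * (K - 1) + m) + m * K = K * K" by (simp only: less) (simp add: K)
    finally have "N ^ 8 * (m * (K - 1) + m * K) + N ^ 8 * m = N ^ 8 * (K * K)" .
    moreover note less[of m] less[of "length es"]
    moreover have "K * (m + 1 + N ^ 8 * K + length es) = m * K + K + N ^ 8 * (K * K) + length es * K"
      by (simp add: algebra_simps)
    ultimately show ?thesis
      unfolding k_def by linarith
  qed
  ultimately show ?thesis by blast
qed

text \<open>The pairs of complementary literals are disjoint and there are as many as the hitting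
  set has elements, so it contains exactly one literal of each pair: it is a truth assignment, and
  hitting a ground clause means satisfying it.\<close>

lemma hitting_set_iff_satisfiable:
  fixes N :: nat
  assumes ks: "distinct ks"
    and cls: "\<And>g ls b \<kappa> u v. (g, ls) \<in> set cls \<Longrightarrow> (b, \<kappa>, u, v) \<in> set ls \<Longrightarrow> \<kappa> \<in> set ks"
  defines "K \<equiv> length (columns ks N)"
  shows "(\<exists>S. S \<subseteq> {..<K} \<and> card S = length (facts ks N) \<and> (\<forall>v\<in>set (elements ks N J cls). \<exists>j\<in>S. v ! j)) \<longleftrightarrow>
    (\<exists>\<sigma>. \<forall>c\<in>set cls. satisfies N J \<sigma> c)"
    (is "?hit \<longleftrightarrow> ?sat")
proof -
  let ?cs = "columns ks N" and ?fs = "facts ks N"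
  have inj: "inj_on ((!) ?cs) {..<K}"
    unfolding K_def by (rule inj_on_nth[OF distinct_columns[OF ks]]) simp
  have vec: "vec ks N L ! j \<longleftrightarrow> ?cs ! j \<in> L" if "j < K" for L j
    using that by (simp add: vec_def K_def)
  have card_fs: "card (set ?fs) = length ?fs"
    by (rule distinct_card[OF distinct_facts[OF ks]])
  have el: "v \<in> set (elements ks N J cls) \<longleftrightarrow>
      (\<exists>\<phi>\<in>set ?fs. v = vec ks N {(True, \<phi>), (False, \<phi>)}) \<or>
      (\<exists>g ls e. (g, ls) \<in> set cls \<and> assigns N e \<and> holds N J g e \<and> v = vec ks N (ground e ` set ls))" for v
    unfolding elements_def set_append set_map set_concat Un_iff
    using set_assignments[of N] by (fastforce split: if_splits)
  show ?thesis
  proof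
    assume ?hit
    then obtain S where S: "S \<subseteq> {..<K}" "card S = length ?fs"
      "\<And>v. v \<in> set (elements ks N J cls) \<Longrightarrow> \<exists>j\<in>S. v ! j" by blast
    define C where "C = (!) ?cs ` S"
    have "card C = card S" unfolding C_def by (rule card_image) (rule inj_on_subset[OF inj S(1)])
    then have cC: "card C = length ?fs" using S(2) by simp
    have finC: "finite C" unfolding C_def using S(1) finite_subset by blast
    have hit: "\<exists>c\<in>L. c \<in> C" if "vec ks N L \<in> set (elements ks N J cls)" for L
    proof -
      from S(3)[OF that] obtain j where "j \<in> S" "vec ks N L ! j" by blast
      then show ?thesis using vec[of j L] S(1) by (auto simp: C_def)
    qed
    have "set ?fs \<subseteq> snd ` C"
    proof
      fix \<phi>
      assume "\<phi> \<in> set ?fs"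
      then have "vec ks N {(True, \<phi>), (False, \<phi>)} \<in> set (elements ks N J cls)" unfolding el by blast
      from hit[OF this] show "\<phi> \<in> snd ` C" by force
    qed
    then have "length ?fs \<le> card (snd ` C)" unfolding card_fs[symmetric] using finC by (intro card_mono) auto
    then have "card (snd ` C) = card C" using card_image_le[OF finC, of snd] cC by simp
    \<comment> \<open>\<open>C\<close> covers all facts and has no more elements than there are
      facts, so it cannot contain both literals of a fact.\<close>
    then have injC: "inj_on snd C" by (rule eq_card_imp_inj_on[OF finC])
    define \<sigma> where "\<sigma> \<kappa> t p \<longleftrightarrow> (True, \<kappa>, t, p) \<in> C" for \<kappa> t p
    have \<sigma>: "\<sigma> \<kappa> t p = b" if "(b, \<kappa>, t, p) \<in> C" for b \<kappa> t p
    proof (cases b)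
      case True
      then show ?thesis using that by (simp add: \<sigma>_def)
    next
      case False
      have "(True, \<kappa>, t, p) \<notin> C"
        using inj_onD[OF injC, of "(True, \<kappa>, t, p)" "(b, \<kappa>, t, p)"] that False by auto
      then show ?thesis using False by (simp add: \<sigma>_def)
    qed
    have "satisfies N J \<sigma> c" if c: "c \<in> set cls" for c
      unfolding satisfies_def
    proof (intro allI impI)
      fix e
      assume "assigns N e" "holds N J (fst c) e"
      then have "vec ks N (ground e ` set (snd c)) \<in> set (elements ks N J cls)"
        unfolding el using c by (metis prod.collapse)
      from hit[OF this] obtain b \<kappa> u v where "(b, \<kappa>, u, v) \<in> set (snd c)" "(b, \<kappa>, e u, e v) \<in> C"
        by auto
      then show "\<exists>(b, \<kappa>, u, v)\<in>set (snd c). \<sigma> \<kappa> (e u) (e v) = b" using \<sigma> by blast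
    qed
    then show ?sat by blast
  next
    assume ?sat
    then obtain \<sigma> where \<sigma>: "\<And>c. c \<in> set cls \<Longrightarrow> satisfies N J \<sigma> c" by blast
    define C where "C = (\<lambda>(\<kappa>, t, p). (\<sigma> \<kappa> t p, \<kappa>, t, p)) ` set ?fs"
    have "card C = length ?fs"
      unfolding C_def card_fs[symmetric] by (rule card_image) (auto simp: inj_on_def)
    have "C \<subseteq> set ?cs" by (auto simp: C_def set_columns set_facts)
    define S where "S = {j. j < K \<and> ?cs ! j \<in> C}"
    have CS: "(!) ?cs ` S = C"
      using \<open>C \<subseteq> set ?cs\<close> by (force simp: S_def K_def in_set_conv_nth)
    have "card ((!) ?cs ` S) = card S"
      by (rule card_image) (rule inj_on_subset[OF inj], auto simp: S_def)
    then have "card S = length ?fs" using CS \<open>card C = length ?fs\<close> by simp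
    moreover have member: "\<exists>j\<in>S. vec ks N L ! j" if "c \<in> C" "c \<in> L" for c L
    proof -
      from that(1) CS obtain j where "j \<in> S" "?cs ! j = c" by blast
      then show ?thesis using that(2) vec[of j L] by (auto simp: S_def)
    qed
    have "\<exists>j\<in>S. v ! j" if "v \<in> set (elements ks N J cls)" for v
      using that unfolding el
    proof (elim disjE bexE exE conjE)
      fix \<phi>
      assume \<phi>: "\<phi> \<in> set ?fs" and v: "v = vec ks N {(True, \<phi>), (False, \<phi>)}"
      obtain \<kappa> t p where "\<phi> = (\<kappa>, t, p)" by (cases \<phi>)
      with \<phi> have "(\<sigma> \<kappa> t p, \<phi>) \<in> C" by (force simp: C_def)
      then show ?thesis unfolding v by (rule member) simp
    next
      fix g ls e
      assume c: "(g, ls) \<in> set cls" and e: "assigns N e" "holds N J g e" and v: "v = vec ks N (ground e ` set ls)"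
      from satisfiesD[OF \<sigma>[OF c] e] obtain b \<kappa> u w
        where l: "(b, \<kappa>, u, w) \<in> set ls" "\<sigma> \<kappa> (e u) (e w) = b" by blast
      have "(\<kappa>, e u, e w) \<in> set ?fs"
        using cls[OF c l(1)] e(1) by (simp add: set_facts assigns_def)
      then have "(b, \<kappa>, e u, e w) \<in> C" using l(2) by (force simp: C_def)
      moreover have "(b, \<kappa>, e u, e w) \<in> ground e ` set ls" using l(1) by force
      ultimately show ?thesis unfolding v by (rule member)
    qed
    moreover have "S \<subseteq> {..<K}" by (auto simp: S_def)
    ultimately show ?hit using \<open>card S = length ?fs\<close> by blast
  qed
qed

section \<open>Assembling the reduction\<close>

lemma clauses_variables:
  assumes "(g, ls) \<in> set (clauses M)"
  shows "test_vars g \<subseteq> {..<15}" and "\<forall>(b, \<kappa>, u, v)\<in>set ls. u < 5 \<and> v < 5"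
proof -
  have "test_vars (moved d u v) \<subseteq> {0, u, v}" for d u v
    by (cases d) (auto simp: cyclic_succ_def Disj_def)
  then have moved: "test_vars (moved d 4 3) \<subseteq> {..<15}" for d
    by (rule order_trans) auto
  define good where "good c \<longleftrightarrow> test_vars (fst c) \<subseteq> {..<15} \<and> (\<forall>(b, \<kappa>, u, v)\<in>set (snd c). u < 5 \<and> v < 5)"
    for c :: "test \<times> literal list"
  have "\<forall>c\<in>set (initial_clauses M). good c"
    by (auto simp: good_def initial_clauses_def always_def)
  moreover have "\<forall>c\<in>set (cell_clauses M). good c"
    by (auto simp: good_def cell_clauses_def always_def)
  moreover have "\<forall>c\<in>set (transition_clauses M q rs). good c" for q rs
    using moved by (auto simp: good_def transition_clauses_def reading_def Let_def)
  moreover have "good (Final 1, [(False, Ce (tapes M - 1) 1, 1, 0)])"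
    by (simp add: good_def)
  ultimately have "\<forall>c\<in>set (clauses M). good c"
    unfolding set_clauses by blast
  then have "good (g, ls)" using assms by blast
  then show "test_vars g \<subseteq> {..<15}" "\<forall>(b, \<kappa>, u, v)\<in>set ls. u < 5 \<and> v < 5"
    by (simp_all add: good_def)
qed

text \<open>A list that depends on the verifier alone, so the program is fixed; duplicates are
  removed because columns have to be distinct literals.\<close>

definition kinds :: "tm \<Rightarrow> kind list" where
  "kinds M = remdups (concat (map (\<lambda>(g, ls). map (\<lambda>(b, \<kappa>, u, v). \<kappa>) ls) (clauses M)))"

lemma kinds_not_empty: "kinds M \<noteq> []"
proof -
  have "(always, [(True, St 0, 0, 0)]) \<in> set (clauses M)"
    by (simp add: set_clauses initial_clauses_def)
  then have "St 0 \<in> set (kinds M)" by (force simp: kinds_def)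
  then show ?thesis by auto
qed

lemma mem_kinds: "(g, ls) \<in> set (clauses M) \<Longrightarrow> (b, \<kappa>, u, v) \<in> set ls \<Longrightarrow> \<kappa> \<in> set (kinds M)"
  by (force simp: kinds_def)

text \<open>Costs are natural numbers, so as soon as there is a solution there is an optimal one,
  and the optimum is at most \<open>k\<close> iff some solution costs at most \<open>k\<close>. The
  injective encoding ensures that the word denotes no other instance.\<close>

lemma hitting_database_in_decision_version:
  assumes es: "\<And>e. e \<in> set es \<Longrightarrow> length e = K"
  shows "enc_database (labelled K (hitting_rows K N \<mu> es)) @ enc_nat k \<in> decision_version enc_database
      (restrict_instances (diversity_problem 2 :: (bool database, bool option database) min_problem)
       {D. card (sensitive D) = 3}) \<longleftrightarrow>
    (\<exists>E. suppression (labelled K (hitting_rows K N \<mu> es)) E \<and> diverse 2 E \<and> stars E \<le> k)"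
proof -
  let ?D = "labelled K (hitting_rows K N \<mu> es)"
  let ?P = "restrict_instances (diversity_problem 2 :: (bool database, bool option database) min_problem)
       {D. card (sensitive D) = 3}"
  have "valid_database ?D"
    using es by (auto simp: valid_database_def hitting_rows_def unit_def split: if_splits)
  then have D: "?D \<in> instances ?P"
    by (simp add: restrict_instances_def diversity_problem_def)
  have "enc_database ?D @ enc_nat k \<in> decision_version enc_database ?P \<longleftrightarrow>
      (\<exists>E. optimal ?P ?D E \<and> cost ?P ?D E \<le> k)"
    unfolding decision_version_def using D enc_instance_inj by blast
  also have "\<dots> \<longleftrightarrow> (\<exists>E. E \<in> solutions ?P ?D \<and> cost ?P ?D E \<le> k)"
  proof
    assume "\<exists>E. E \<in> solutions ?P ?D \<and> cost ?P ?D E \<le> k"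
    then obtain E where E: "E \<in> solutions ?P ?D" "cost ?P ?D E \<le> k" by blast
    from ex_has_least_nat[of "\<lambda>E. E \<in> solutions ?P ?D", OF E(1), of "cost ?P ?D"]
    obtain F where "F \<in> solutions ?P ?D" "\<And>G. G \<in> solutions ?P ?D \<Longrightarrow> cost ?P ?D F \<le> cost ?P ?D G" by blast
    then show "\<exists>E. optimal ?P ?D E \<and> cost ?P ?D E \<le> k"
      using E unfolding optimal_def by (meson order_trans)
  qed (auto simp: optimal_def)
  finally show ?thesis
    by (simp add: restrict_instances_def diversity_problem_def conj_assoc)
qed

text \<open>With \<open>a\<close> kinds and \<open>b\<close> clause schemata, the left side bounds
  the entries outside the copies of the unit vectors. It is a constant times \<open>N ^ 6\<close>,
  and the constant is at most \<open>N\<close>.\<close>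

lemma power_bound:
  fixes N a b :: nat
  assumes N: "2 * a * (2 * a + 1 + b) \<le> N" and "0 < N"
  shows "(2 * (a * N ^ 2)) * (a * N ^ 2 + 1 + (a * N ^ 2 + b * N ^ 4)) \<le> N ^ 8"
proof -
  have "1 \<le> N ^ 4" "N ^ 2 \<le> N ^ 4" using assms(2) by (auto intro: power_increasing)
  then have "a * N ^ 2 + 1 + (a * N ^ 2 + b * N ^ 4) \<le> a * N ^ 4 + N ^ 4 + (a * N ^ 4 + b * N ^ 4)"
    by (intro add_mono mult_le_mono2) auto
  also have "\<dots> = (2 * a + 1 + b) * N ^ 4" by (simp add: algebra_simps)
  finally have "(2 * (a * N ^ 2)) * (a * N ^ 2 + 1 + (a * N ^ 2 + b * N ^ 4)) \<le>
      (2 * (a * N ^ 2)) * ((2 * a + 1 + b) * N ^ 4)" by (rule mult_le_mono2)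
  also have "\<dots> = (2 * a * (2 * a + 1 + b)) * N ^ 6" by (simp add: algebra_simps power_add[symmetric])
  also have "\<dots> \<le> N * N ^ 6" using N by (rule mult_le_mono1)
  also have "\<dots> = N ^ 7" by (simp add: power_Suc[symmetric] del: power_Suc)
  also have "\<dots> \<le> N ^ 8" using assms(2) by (intro power_increasing) auto
  finally show ?thesis .
qed

theorem theorem6:
  "NP_hard_min enc_database
     (restrict_instances
       (diversity_problem 2 :: (bool database, bool option database) min_problem)
       {D. card (sensitive D) = 3})"
  unfolding NP_hard_min_def NP_hard_def
proof
  fix A :: language
  assume "A \<in> class_NP"
  then obtain R c d where R: "R \<in> class_P" and A: "\<And>x. x \<in> A \<longleftrightarrow>
      (\<exists>u. length u \<le> c * length x ^ d + c \<and> enc_list enc_bool x @ u \<in> R)"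
    by (auto simp: class_NP_def)
  from R obtain M c' d' where M: "valid_tm M" and run: "\<And>w. \<exists>t\<le>c' * length w ^ d' + c'.
      halts_with M ((step M ^^ t) (initial M w)) [w \<in> R]"
    unfolding class_P_def polytime_function_def by blast
  let ?ks = "kinds M" and ?cls = "clauses M"
  define B where "B n = c * n ^ d + c" for n
  \<comment> \<open>The verifier runs on the encoded input, of length \<open>2 * n + 1\<close>,
    followed by a certificate of length at most \<open>B n\<close>.\<close>
  define T where "T n = c' * (2 * n + 1 + B n) ^ d' + c'" for n
  \<comment> \<open>The loop range must leave room for the positions that the heads can reach and
    for the guessed cells; the last summand is the constant required by
    \<open>power_bound\<close>.\<close>
  have "poly_bounded (\<lambda>n. 2 * T n + (2 * n + 1) + B n + 5 +
      2 * length ?ks * (2 * length ?ks + 1 + length ?cls))"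
    unfolding T_def B_def by (intro poly_bounded_intros)
  then obtain C e where N: "2 * T n + (2 * n + 1) + B n + 5 +
      2 * length ?ks * (2 * length ?ks + 1 + length ?cls) \<le> C * n ^ e + C" for n
    by (auto simp: poly_bounded_def)
  have "C > 0" using N[of 0] by (cases C) auto
  define f where "f x = emission (C * length x ^ e + C)
    (guess_tape (c * length x ^ d + c) (enc_list enc_bool x)) (reduction ?ks ?cls) (\<lambda>_. 0)" for x
  have "admissible (reduction ?ks ?cls)"
    by (rule admissible_reduction) (use clauses_variables in blast)
  from polytime_emission[OF this \<open>C > 0\<close>, of e c d] have "polytime_function f"
    unfolding f_def .
  moreover have "x \<in> A \<longleftrightarrow> f x \<in> decision_version enc_database (restrict_instances
       (diversity_problem 2 :: (bool database, bool option database) min_problem)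
       {D. card (sensitive D) = 3})" for x
  proof -
    define n where "n = length x"
    define w where "w = enc_list enc_bool x"
    define N where "N = C * n ^ e + C"
    let ?J = "guess_tape (B n) w"
    define K where "K = length (columns ?ks N)"
    define m where "m = length (facts ?ks N)"
    define es where "es = elements ?ks N ?J ?cls"
    have ks: "distinct ?ks" by (simp add: kinds_def)
    have lw: "length w = 2 * n + 1"
      unfolding w_def n_def by (simp only: enc_list_snoc length_append length_pairs) simp
    note bound = N[of n, folded N_def]
    have N0: "N > 0" and N1: "2 * T n + length w + B n + 5 \<le> N" using bound lw by linarith+
    have run': "\<exists>t\<le>T n. halts_with M ((step M ^^ t) (initial M (w @ u))) [w @ u \<in> R]"
      if u: "length u \<le> B n" for u
    proof -
      have "length (w @ u) \<le> 2 * n + 1 + B n" using u lw by simp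
      then have "c' * length (w @ u) ^ d' + c' \<le> T n"
        unfolding T_def by (intro add_mono mult_le_mono2 power_mono) auto
      with run[of "w @ u"] show ?thesis by (meson order_trans)
    qed
    have "x \<in> A \<longleftrightarrow> (\<exists>u. length u \<le> B n \<and> w @ u \<in> R)"
      unfolding A B_def n_def w_def ..
    also have "\<dots> \<longleftrightarrow> (\<exists>\<sigma>. \<forall>c\<in>set ?cls. satisfies N ?J \<sigma> c)"
    proof
      assume "\<exists>u. length u \<le> B n \<and> w @ u \<in> R"
      then obtain u where u: "length u \<le> B n" "w @ u \<in> R" by blast
      have "\<exists>t\<le>T n. halts_with M ((step M ^^ t) (initial M (w @ u))) [True]"
        using run'[OF u(1)] u(2) by simp
      from clauses_satisfiable_if[OF M this u(1) N1]
      show "\<exists>\<sigma>. \<forall>c\<in>set ?cls. satisfies N ?J \<sigma> c" .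
    next
      assume "\<exists>\<sigma>. \<forall>c\<in>set ?cls. satisfies N ?J \<sigma> c"
      then obtain \<sigma> where "\<forall>c\<in>set ?cls. satisfies N ?J \<sigma> c" by blast
      from clauses_satisfiable_only_if[where acc = "\<lambda>u. w @ u \<in> R", OF M run' N1 this]
      show "\<exists>u. length u \<le> B n \<and> w @ u \<in> R" by blast
    qed
    also have "\<dots> \<longleftrightarrow> (\<exists>S. S \<subseteq> {..<K} \<and> card S = m \<and> (\<forall>v\<in>set es. \<exists>j\<in>S. v ! j))"
      unfolding K_def m_def es_def
      by (rule hitting_set_iff_satisfiable[symmetric, OF ks]) (erule (1) mem_kinds)
    finally have hit: "x \<in> A \<longleftrightarrow> (\<exists>S. S \<subseteq> {..<K} \<and> card S = m \<and> (\<forall>v\<in>set es. \<exists>j\<in>S. v ! j))" .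
    obtain k where k: "f x = enc_database (labelled K (hitting_rows K m (N ^ 8) es)) @ enc_nat k"
      "k + (N ^ 8 * m + length es + m) = K * (m + 1 + N ^ 8 * K + length es)"
      using emission_reduction[OF ks kinds_not_empty N0, of ?cls ?J] clauses_variables(2)[of _ _ M]
      unfolding f_def K_def m_def es_def N_def n_def w_def B_def by blast
    have es: "length v = K" if "v \<in> set es" for v
      using that by (auto simp: es_def K_def elements_def vec_def split: if_splits)
    have m: "m = length ?ks * N ^ 2" and K: "K = 2 * m"
      by (simp_all add: m_def K_def length_columns length_facts)
    \<comment> \<open>At least one kind and \<open>N \<ge> 2\<close> give \<open>m \<ge> 4\<close>,
      so that \<open>m + 1\<close> is below \<open>K = 2 * m\<close>.\<close>
    have "N \<ge> 2" using N1 by simp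
    then have "2 * 2 \<le> N ^ 2" unfolding power2_eq_square by (intro mult_le_mono)
    moreover have "1 * N ^ 2 \<le> length ?ks * N ^ 2"
      using kinds_not_empty[of M] by (intro mult_le_mono1) (simp add: Suc_le_eq)
    ultimately have mK: "m + 1 < K" using m K by linarith
    have "length es \<le> length ?ks * N ^ 2 + length ?cls * N ^ 4"
      unfolding es_def by (rule length_elements)
    then have "K * (m + 1 + length es) \<le>
        (2 * (length ?ks * N ^ 2)) * (length ?ks * N ^ 2 + 1 + (length ?ks * N ^ 2 + length ?cls * N ^ 4))"
      unfolding K m by (intro mult_le_mono2) simp
    also have "\<dots> \<le> N ^ 8"
      by (rule power_bound) (use bound N0 in linarith)+
    finally have \<mu>: "K * (m + 1 + length es) \<le> N ^ 8" .
    have "(\<exists>S. S \<subseteq> {..<K} \<and> card S = m \<and> (\<forall>v\<in>set es. \<exists>j\<in>S. v ! j)) \<longleftrightarrow>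
        (\<exists>E. suppression (labelled K (hitting_rows K m (N ^ 8) es)) E \<and> diverse 2 E \<and> stars E \<le> k)"
    proof
      assume "\<exists>S. S \<subseteq> {..<K} \<and> card S = m \<and> (\<forall>v\<in>set es. \<exists>j\<in>S. v ! j)"
      then obtain S where "S \<subseteq> {..<K}" "card S = m" "\<forall>v\<in>set es. \<exists>j\<in>S. v ! j" by blast
      with N0 es show "\<exists>E. suppression (labelled K (hitting_rows K m (N ^ 8) es)) E \<and> diverse 2 E \<and> stars E \<le> k"
        by (intro hitting_set_imp_diverse[OF mK _ _ _ _ _ k(2)]) auto
    next
      assume "\<exists>E. suppression (labelled K (hitting_rows K m (N ^ 8) es)) E \<and> diverse 2 E \<and> stars E \<le> k"
      then obtain E where "suppression (labelled K (hitting_rows K m (N ^ 8) es)) E" "diverse 2 E" "stars E \<le> k"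
        by blast
      with es show "\<exists>S. S \<subseteq> {..<K} \<and> card S = m \<and> (\<forall>v\<in>set es. \<exists>j\<in>S. v ! j)"
        by (intro diverse_imp_hitting_set[OF mK \<mu> _ _ _ _ k(2)]) auto
    qed
    also have "\<dots> \<longleftrightarrow> f x \<in> decision_version enc_database (restrict_instances
       (diversity_problem 2 :: (bool database, bool option database) min_problem)
       {D. card (sensitive D) = 3})"
      unfolding k(1) by (rule hitting_database_in_decision_version[symmetric]) (rule es)
    finally show ?thesis unfolding hit .
  qed
  ultimately show "A \<le>\<^sub>p decision_version enc_database (restrict_instances
       (diversity_problem 2 :: (bool database, bool option database) min_problem)
       {D. card (sensitive D) = 3})"
    unfolding polytime_reducible_def by blast
qed

end
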